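(* For every $i\ge1$, the following families are in bijection: (1) $i$-enriched Eulerian trees with at least one node; (2) the family $\mathcal R_i$ of admissible marked Eulerian maps with multiplicities adding up to less than $i$. The bijection can be chosen such that, for every $k\ge1$, the number of nodes of degree $2k$ in the first family corresponds to the number of vertices of degree $2k$ in the second family. In particular the total half-degree $E$ of the nodes in the first family and of the vertices in the second family is preserved ($E$ is also the number of edges in the second family). The two families are enumerated by $r_i(t)-i$, where $t$ is conjugate to $E$ and each node (resp. vertex) of degree $2k$ is weighted by $g_k$.
   Context: Maps. A map is a cellular embedding of a connected graph (loops and multiple edges allowed), with at least one edge, in a closed oriented surface of arbitrary genus, up to orientation-preserving homeomorphism. It is rooted if a corner is marked; the root vertex is the vertex at the root corner and the root half-edge is the half-edge just after the root corner in clockwise order around it. A map is Eulerian if all vertex degrees are even; an Eulerian orientation is an orientation of the edges in which every vertex has outdegree equal to half its degree. A marked map is a rooted map where some edges are marked and given a fixed orientation. An orientation of all its edges is compatible if it agrees with the fixed orientation of the marked edges; a compatible orientation is root-accessible if from each vertex there is an oriented path to the root vertex avoiding the marked edges. A marked Eulerian map is admissible if it admits a compatible, root-accessible Eulerian orientation in which the root half-edge (possibly on a marked edge) is outgoing. A marked map with multiplicities is a marked map where each marked edge carries a multiplicity which is a positive integer; $\mathcal R_i$ consists of those admissible marked Eulerian maps with multiplicities for which the sum of all multiplicities is strictly less than $i$. Trees. Trees are plane trees; vertices of degree 1 are leaves, the others are nodes. A rooted tree is a plane tree with a marked leaf (the root leaf); the node adjacent to it, if any, is the root node. A blossoming tree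 is a rooted tree whose leaves are of two kinds, opening and closing, with as many opening as closing leaves, the root leaf being opening. An Eulerian tree is a blossoming tree in which every node has even degree and every node of degree $2k$ has exactly $k-1$ adjacent opening leaves (not counting the root leaf for the root node). For $i\ge1$, read the non-root leaves in a clockwise walk around the tree (outer face on the left) starting at the root leaf, and draw the path starting at height $i$ with an up-step for each opening leaf and a down-step for each closing leaf. A closing leaf has $i$-height $h$ if its down-step goes from $h$ to $h-1$; the tree is $i$-balanced if all its closing leaves have $i$-height at least $1$. An $i$-enriched Eulerian tree is an $i$-balanced Eulerian tree where each closing leaf of $i$-height $h$ carries an integer in $\{0,\dots,h-1\}$. Series. For $i,k\ge1$ let $\mathcal P_k^{(i)}$ be the set of paths of length $2k-1$ with steps $\pm1$, staying in $\mathbb Z_{\ge 0}$, from height $i$ to height $i-1$. The formal power series $r_i(t)$, $i\ge1$, in $t$ with coefficients polynomial in indeterminates $g_1,g_2,\dots$ are uniquely determined by $$r_i(t)=i+\sum_{k\ge1}t^kg_k\sum_{\wp\in\mathcal P_k^{(i)}}\ \prod_{\text{descending steps } h\to h-1 \text{ of }\wp} r_h(t),\qquad i\ge1.$$ *)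

theory Defs
  imports
    "HOL-Computational_Algebra.Formal_Power_Series"
    "HOL-Combinatorics.Permutations"
    "HOL-Combinatorics.Orbits"
    "HOL-Library.Poly_Mapping"
begin

section \<open>Maps\<close>

text \<open>
  A rooted map on an oriented surface is encoded by its half-edges: the permutation \<open>rot\<close> sends a
  half-edge to the next one in clockwise order around its vertex, the fixed-point-free involution
  \<open>opp\<close> exchanges the two halves of an edge. The root corner is the one just before
  \<open>root_half_edge\<close> in clockwise order. Connectedness is transitivity; the genus is arbitrary.
\<close>

record 'h rooted_map =
  half_edges :: "'h set"
  rot :: "'h \<Rightarrow> 'h"
  opp :: "'h \<Rightarrow> 'h"
  root_half_edge :: 'h

definition rooted_map :: "('h, 'm) rooted_map_scheme \<Rightarrow> bool" where
  "rooted_map M \<longleftrightarrow>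
     finite (half_edges M) \<and>
     rot M permutes half_edges M \<and>
     opp M permutes half_edges M \<and>
     (\<forall>h\<in>half_edges M. opp M h \<noteq> h \<and> opp M (opp M h) = h) \<and>
     (\<forall>h\<in>half_edges M. \<forall>h'\<in>half_edges M. (h, h') \<in> {(x, y). y = rot M x \<or> y = opp M x}\<^sup>*) \<and>
     root_half_edge M \<in> half_edges M"

definition vertex_of :: "('h, 'm) rooted_map_scheme \<Rightarrow> 'h \<Rightarrow> 'h set" where
  "vertex_of M h = orbit (rot M) h"

definition vertices :: "('h, 'm) rooted_map_scheme \<Rightarrow> 'h set set" where
  "vertices M = vertex_of M ` half_edges M"

definition edges :: "('h, 'm) rooted_map_scheme \<Rightarrow> 'h set set" where
  "edges M = (\<lambda>h. {h, opp M h}) ` half_edges M"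

text \<open>A vertex is the set of its incident half-edges, so its degree is its cardinality.\<close>

definition eulerian_map :: "('h, 'm) rooted_map_scheme \<Rightarrow> bool" where
  "eulerian_map M \<longleftrightarrow> (\<forall>v\<in>vertices M. even (card v))"

definition map_vertices_of_degree :: "nat \<Rightarrow> ('h, 'm) rooted_map_scheme \<Rightarrow> nat" where
  "map_vertices_of_degree d M = card {v \<in> vertices M. card v = d}"

definition map_half_degree :: "('h, 'm) rooted_map_scheme \<Rightarrow> nat" where
  "map_half_degree M = (\<Sum>v\<in>vertices M. card v div 2)"

definition map_edge_count :: "('h, 'm) rooted_map_scheme \<Rightarrow> nat" where
  "map_edge_count M = card (edges M)"

text \<open>An orientation is given by its set of outgoing half-edges (the tails of the edges).\<close>

definition orientation :: "('h, 'm) rooted_map_scheme \<Rightarrow> 'h set \<Rightarrow> bool" where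
  "orientation M A \<longleftrightarrow> A \<subseteq> half_edges M \<and> (\<forall>h\<in>half_edges M. h \<in> A \<longleftrightarrow> opp M h \<notin> A)"

definition eulerian_orientation :: "('h, 'm) rooted_map_scheme \<Rightarrow> 'h set \<Rightarrow> bool" where
  "eulerian_orientation M A \<longleftrightarrow>
     orientation M A \<and> (\<forall>v\<in>vertices M. 2 * card (v \<inter> A) = card v)"

text \<open>
  Marked edges together with their fixed orientation are given by the set \<open>marked\<close> of their tails;
  \<open>edge_mult h\<close> is the multiplicity of the marked edge with tail \<open>h\<close> (and is meaningless elsewhere).
\<close>

record 'h marked_map = "'h rooted_map" +
  marked :: "'h set"
  edge_mult :: "'h \<Rightarrow> nat"

definition marked_map :: "'h marked_map \<Rightarrow> bool" where
  "marked_map M \<longleftrightarrow>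
     rooted_map M \<and> marked M \<subseteq> half_edges M \<and>
     (\<forall>h\<in>marked M. opp M h \<notin> marked M \<and> edge_mult M h > 0)"

definition compatible :: "'h marked_map \<Rightarrow> 'h set \<Rightarrow> bool" where
  "compatible M A \<longleftrightarrow> marked M \<subseteq> A"

definition unmarked_step :: "'h marked_map \<Rightarrow> 'h set \<Rightarrow> ('h set \<times> 'h set) set" where
  "unmarked_step M A =
     {(vertex_of M h, vertex_of M (opp M h)) | h. h \<in> A \<and> h \<notin> marked M \<and> opp M h \<notin> marked M}"

definition root_accessible :: "'h marked_map \<Rightarrow> 'h set \<Rightarrow> bool" where
  "root_accessible M A \<longleftrightarrow>
     (\<forall>v\<in>vertices M. (v, vertex_of M (root_half_edge M)) \<in> (unmarked_step M A)\<^sup>*)"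

definition admissible :: "'h marked_map \<Rightarrow> bool" where
  "admissible M \<longleftrightarrow>
     (\<exists>A. eulerian_orientation M A \<and> compatible M A \<and> root_accessible M A \<and>
          root_half_edge M \<in> A)"

text \<open>
  Orientation-preserving homeomorphisms of rooted maps correspond to the bijections of half-edges
  commuting with the structure. Every map has a representative with half-edges in \<open>nat\<close>, so that
  maps up to homeomorphism are the classes of \<open>marked_map_iso_rel\<close>.
\<close>

definition marked_map_iso :: "'h marked_map \<Rightarrow> 'k marked_map \<Rightarrow> ('h \<Rightarrow> 'k) \<Rightarrow> bool" where
  "marked_map_iso M N \<phi> \<longleftrightarrow>
     bij_betw \<phi> (half_edges M) (half_edges N) \<and>
     (\<forall>h\<in>half_edges M. \<phi> (rot M h) = rot N (\<phi> h) \<and> \<phi> (opp M h) = opp N (\<phi> h)) \<and>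
     \<phi> (root_half_edge M) = root_half_edge N \<and>
     \<phi> ` marked M = marked N \<and>
     (\<forall>h\<in>marked M. edge_mult N (\<phi> h) = edge_mult M h)"

definition marked_map_iso_rel :: "(nat marked_map \<times> nat marked_map) set" where
  "marked_map_iso_rel = {(M, N). marked_map M \<and> marked_map N \<and> (\<exists>\<phi>. marked_map_iso M N \<phi>)}"

definition admissible_maps :: "nat \<Rightarrow> nat marked_map set set" where
  "admissible_maps i =
     {M. marked_map M \<and> eulerian_map M \<and> admissible M \<and> (\<Sum>h\<in>marked M. edge_mult M h) < i}
       // marked_map_iso_rel"

text \<open>The common value of an isomorphism-invariant quantity on an isomorphism class.\<close>

definition on_class :: "('a \<Rightarrow> 'b) \<Rightarrow> 'a set \<Rightarrow> 'b" where
  "on_class q C = the_elem (q ` C)"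

lemma vertices_iso:
  assumes M: "rooted_map M" and N: "rooted_map N"
    and bij: "bij_betw \<phi> (half_edges M) (half_edges N)"
    and rot: "\<And>h. h \<in> half_edges M \<Longrightarrow> \<phi> (rot M h) = rot N (\<phi> h)"
  shows "bij_betw ((`) \<phi>) (vertices M) (vertices N)"
    and "\<And>v. v \<in> vertices M \<Longrightarrow> card (\<phi> ` v) = card v"
proof -
  have orb: "orbit (rot M) h \<subseteq> half_edges M" if "h \<in> half_edges M" for h
    using M that by (auto simp: rooted_map_def intro: permutes_orbit_subset[THEN subsetD])
  have img: "\<phi> ` vertex_of M h = vertex_of N (\<phi> h)" if h: "h \<in> half_edges M" for h
  proof -
    have "finite (half_edges M)" "rot M permutes half_edges M"
      using M by (auto simp: rooted_map_def)
    then have "h \<in> orbit (rot M) h"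
      by (intro permutation_self_in_orbit) (auto simp: permutation_permutes)
    then show ?thesis
      unfolding vertex_of_def using orb[OF h] rot by (intro orbit_inverse) auto
  qed
  have sub: "v \<subseteq> half_edges M" if "v \<in> vertices M" for v
    using that orb by (auto simp: vertices_def vertex_of_def)
  have inj: "inj_on \<phi> (half_edges M)" and surj: "\<phi> ` half_edges M = half_edges N"
    using bij by (auto simp: bij_betw_def)
  show "bij_betw ((`) \<phi>) (vertices M) (vertices N)"
    unfolding bij_betw_def
  proof
    show "inj_on ((`) \<phi>) (vertices M)"
      using inj_on_image_Pow[OF inj] by (rule inj_on_subset) (use sub in auto)
    show "(`) \<phi> ` vertices M = vertices N"
      unfolding vertices_def image_image surj[symmetric] by (intro image_cong refl img)
  qed
  show "card (\<phi> ` v) = card v" if "v \<in> vertices M" for v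
    using inj_on_subset[OF inj sub[OF that]] by (rule card_image)
qed

lemma edges_iso:
  assumes M: "rooted_map M"
    and bij: "bij_betw \<phi> (half_edges M) (half_edges N)"
    and opp: "\<And>h. h \<in> half_edges M \<Longrightarrow> \<phi> (opp M h) = opp N (\<phi> h)"
  shows "card (edges M) = card (edges N)"
proof -
  have inj: "inj_on \<phi> (half_edges M)" and surj: "\<phi> ` half_edges M = half_edges N"
    using bij by (auto simp: bij_betw_def)
  have "(`) \<phi> ` edges M = edges N"
    unfolding edges_def image_image surj[symmetric] by (intro image_cong refl) (simp add: opp)
  moreover have "edges M \<subseteq> Pow (half_edges M)"
    using M by (auto simp: edges_def rooted_map_def permutes_in_image)
  then have "inj_on ((`) \<phi>) (edges M)"
    using inj_on_image_Pow[OF inj] inj_on_subset by blast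
  ultimately show ?thesis
    using card_image by fastforce
qed

lemma equiv_marked_map_iso_rel: "equiv {M. marked_map M} marked_map_iso_rel"
proof (rule equivI)
  show "marked_map_iso_rel \<subseteq> {M. marked_map M} \<times> {M. marked_map M}"
    by (auto simp: marked_map_iso_rel_def)
  show "refl_on {M. marked_map M} marked_map_iso_rel"
    by (auto simp: refl_on_def marked_map_iso_rel_def marked_map_iso_def intro!: exI[of _ id])
  show "sym marked_map_iso_rel"
  proof (rule symI)
    fix M N assume "(M, N) \<in> marked_map_iso_rel"
    then obtain \<phi> where MN: "marked_map M" "marked_map N" and iso: "marked_map_iso M N \<phi>"
      by (auto simp: marked_map_iso_rel_def)
    define \<psi> where "\<psi> = inv_into (half_edges M) \<phi>"
    have bij: "bij_betw \<phi> (half_edges M) (half_edges N)"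
      using iso by (simp add: marked_map_iso_def)
    have inv1: "\<psi> (\<phi> h) = h" if "h \<in> half_edges M" for h
      using bij that by (simp add: \<psi>_def bij_betw_inv_into_left)
    have ex: "\<exists>x\<in>half_edges M. h = \<phi> x" if "h \<in> half_edges N" for h
      using bij that by (auto simp: bij_betw_def)
    have clos: "rot M h \<in> half_edges M" "opp M h \<in> half_edges M" if "h \<in> half_edges M" for h
      using MN that by (auto simp: marked_map_def rooted_map_def permutes_in_image)
    have sub: "marked M \<subseteq> half_edges M" "root_half_edge M \<in> half_edges M"
      using MN by (auto simp: marked_map_def rooted_map_def)
    have "marked_map_iso N M \<psi>"
      unfolding marked_map_iso_def
    proof (intro conjI ballI)
      show "bij_betw \<psi> (half_edges N) (half_edges M)"
        unfolding \<psi>_def by (rule bij_betw_inv_into[OF bij])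
      show "\<psi> (rot N h) = rot M (\<psi> h)" "\<psi> (opp N h) = opp M (\<psi> h)"
        if h: "h \<in> half_edges N" for h
      proof -
        obtain x where x: "x \<in> half_edges M" "h = \<phi> x"
          using ex[OF h] by blast
        then have "rot N h = \<phi> (rot M x)" "opp N h = \<phi> (opp M x)"
          using iso by (simp_all add: marked_map_iso_def)
        then show "\<psi> (rot N h) = rot M (\<psi> h)" "\<psi> (opp N h) = opp M (\<psi> h)"
          using x clos by (simp_all add: inv1)
      qed
      show "\<psi> (root_half_edge N) = root_half_edge M"
        using iso sub inv1 by (metis marked_map_iso_def)
      have eq: "marked N = \<phi> ` marked M"
        using iso by (simp add: marked_map_iso_def)
      have "(\<psi> \<circ> \<phi>) ` marked M = id ` marked M"
        by (rule image_cong) (use sub inv1 in auto)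
      then show "\<psi> ` marked N = marked M"
        by (simp add: eq image_comp)
      show "edge_mult M (\<psi> h) = edge_mult N h" if "h \<in> marked N" for h
        using that iso sub inv1 by (auto simp: eq marked_map_iso_def subset_iff)
    qed
    then show "(N, M) \<in> marked_map_iso_rel"
      using MN by (auto simp: marked_map_iso_rel_def)
  qed
  show "trans marked_map_iso_rel"
  proof (rule transI)
    fix M N K assume "(M, N) \<in> marked_map_iso_rel" "(N, K) \<in> marked_map_iso_rel"
    then obtain \<phi> \<psi> where *: "marked_map M" "marked_map K" "marked_map_iso M N \<phi>" "marked_map_iso N K \<psi>"
      by (auto simp: marked_map_iso_rel_def)
    then have "marked_map_iso M K (\<psi> \<circ> \<phi>)"
      unfolding marked_map_iso_def
      by (auto simp flip: image_image intro: bij_betw_trans dest: bij_betwE) (metis imageI)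
    with * show "(M, K) \<in> marked_map_iso_rel"
      by (auto simp: marked_map_iso_rel_def)
  qed
qed

lemma on_class_eq:
  assumes C: "C \<in> admissible_maps i" and M: "M \<in> C"
    and inv: "\<And>M N \<phi>. marked_map M \<Longrightarrow> marked_map N \<Longrightarrow> marked_map_iso M N \<phi> \<Longrightarrow> q M = q N"
  shows "on_class q C = q M"
proof -
  obtain K where "C = marked_map_iso_rel `` {K}"
    using C by (auto simp: admissible_maps_def quotient_def)
  then have "(K, N) \<in> marked_map_iso_rel \<longleftrightarrow> N \<in> C" for N
    by simp
  moreover have "q K = q N" if "(K, N) \<in> marked_map_iso_rel" for N
    using that inv by (auto simp: marked_map_iso_rel_def)
  ultimately have "q N = q M" if "N \<in> C" for N
    using that M by metis
  then have "q ` C = {q M}"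
    using M by blast
  then show ?thesis by (simp add: on_class_def)
qed

lemma map_statistics_iso:
  assumes "marked_map M" "marked_map N" "marked_map_iso M N \<phi>"
  shows "map_vertices_of_degree d M = map_vertices_of_degree d N"
    and "map_half_degree M = map_half_degree N"
    and "map_edge_count M = map_edge_count N"
proof -
  have MN: "rooted_map M" "rooted_map N"
    using assms by (auto simp: marked_map_def)
  have iso: "bij_betw \<phi> (half_edges M) (half_edges N)"
    "\<And>h. h \<in> half_edges M \<Longrightarrow> \<phi> (rot M h) = rot N (\<phi> h)"
    "\<And>h. h \<in> half_edges M \<Longrightarrow> \<phi> (opp M h) = opp N (\<phi> h)"
    using assms(3) unfolding marked_map_iso_def by blast+
  have bij: "bij_betw ((`) \<phi>) (vertices M) (vertices N)"
    by (rule vertices_iso(1)[OF MN iso(1,2)])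
  have card: "card (\<phi> ` v) = card v" if "v \<in> vertices M" for v
    by (rule vertices_iso(2)[OF MN iso(1,2) that])
  have "bij_betw ((`) \<phi>) {v \<in> vertices M. card v = d} {v \<in> vertices N. card v = d}"
    by (rule bij_betw_Collect[OF bij]) (simp add: card)
  then show "map_vertices_of_degree d M = map_vertices_of_degree d N"
    unfolding map_vertices_of_degree_def by (rule bij_betw_same_card)
  show "map_half_degree M = map_half_degree N"
    unfolding map_half_degree_def by (subst sum.reindex_bij_betw[OF bij, symmetric]) (simp add: card)
  show "map_edge_count M = map_edge_count N"
    unfolding map_edge_count_def using edges_iso[OF MN(1) iso(1,3)] .
qed


section \<open>Trees\<close>

text \<open>
  A rooted plane tree is represented by the subtree attached to its root leaf, the children of a
  node being listed in clockwise order starting after the edge leading to the root leaf. Thus a node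
  with children \<open>ts\<close> has degree \<open>length ts + 1\<close>, and the clockwise walk meets the non-root leaves
  in depth-first order. Closing leaves carry a decoration of type \<open>'a\<close>.
\<close>

datatype 'a blossom = Opening | Closing 'a | Node "'a blossom list"

fun leaf_word :: "'a blossom \<Rightarrow> 'a option list" where
  "leaf_word Opening = [None]"
| "leaf_word (Closing a) = [Some a]"
| "leaf_word (Node ts) = concat (map leaf_word ts)"

fun node_degrees :: "'a blossom \<Rightarrow> nat list" where
  "node_degrees Opening = []"
| "node_degrees (Closing a) = []"
| "node_degrees (Node ts) = (length ts + 1) # concat (map node_degrees ts)"

text \<open>Vertices of degree 1 are leaves, hence a node has at least one child.\<close>

fun proper_nodes :: "'a blossom \<Rightarrow> bool" where
  "proper_nodes Opening \<longleftrightarrow> True"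
| "proper_nodes (Closing a) \<longleftrightarrow> True"
| "proper_nodes (Node ts) \<longleftrightarrow> ts \<noteq> [] \<and> (\<forall>t\<in>set ts. proper_nodes t)"

text \<open>The root leaf, which does not occur in \<open>leaf_word\<close>, counts as an opening leaf.\<close>

definition blossoming_tree :: "'a blossom \<Rightarrow> bool" where
  "blossoming_tree t \<longleftrightarrow>
     proper_nodes t \<and>
     length (filter (\<lambda>l. l = None) (leaf_word t)) + 1 = length (filter (\<lambda>l. l \<noteq> None) (leaf_word t))"

fun eulerian_nodes :: "'a blossom \<Rightarrow> bool" where
  "eulerian_nodes Opening \<longleftrightarrow> True"
| "eulerian_nodes (Closing a) \<longleftrightarrow> True"
| "eulerian_nodes (Node ts) \<longleftrightarrow>
     (\<exists>k. length ts + 1 = 2 * k \<and> count_list ts Opening = k - 1) \<and> (\<forall>t\<in>set ts. eulerian_nodes t)"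

definition eulerian_tree :: "'a blossom \<Rightarrow> bool" where
  "eulerian_tree t \<longleftrightarrow> blossoming_tree t \<and> eulerian_nodes t"

text \<open>The closing leaves, each with the height before its down-step and its decoration.\<close>

fun closing_heights :: "int \<Rightarrow> 'a option list \<Rightarrow> (int \<times> 'a) list" where
  "closing_heights h [] = []"
| "closing_heights h (None # w) = closing_heights (h + 1) w"
| "closing_heights h (Some a # w) = (h, a) # closing_heights (h - 1) w"

definition balanced :: "nat \<Rightarrow> 'a blossom \<Rightarrow> bool" where
  "balanced i t \<longleftrightarrow> (\<forall>(h, a)\<in>set (closing_heights (int i) (leaf_word t)). h \<ge> 1)"

definition enriched_eulerian_tree :: "nat \<Rightarrow> int blossom \<Rightarrow> bool" where
  "enriched_eulerian_tree i t \<longleftrightarrow>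
     eulerian_tree t \<and> balanced i t \<and>
     (\<forall>(h, a)\<in>set (closing_heights (int i) (leaf_word t)). a \<in> {0..h - 1})"

definition enriched_trees :: "nat \<Rightarrow> int blossom set" where
  "enriched_trees i = {t. enriched_eulerian_tree i t \<and> node_degrees t \<noteq> []}"

definition tree_nodes_of_degree :: "nat \<Rightarrow> 'a blossom \<Rightarrow> nat" where
  "tree_nodes_of_degree d t = count_list (node_degrees t) d"

definition tree_half_degree :: "'a blossom \<Rightarrow> nat" where
  "tree_half_degree t = (\<Sum>d\<leftarrow>node_degrees t. d div 2)"


section \<open>Generating functions\<close>

text \<open>Polynomials over the integers in indeterminates indexed by natural numbers.\<close>

type_synonym gpoly = "(nat \<Rightarrow>\<^sub>0 nat) \<Rightarrow>\<^sub>0 int"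

definition g_var :: "nat \<Rightarrow> gpoly" where
  "g_var k = Poly_Mapping.single (Poly_Mapping.single k 1) 1"

text \<open>A path of length \<open>2 * k - 1\<close> is the list of the \<open>2 * k\<close> heights it visits.\<close>

definition paths :: "nat \<Rightarrow> nat \<Rightarrow> nat list set" where
  "paths i k =
     {p. length p = 2 * k \<and> hd p = i \<and> last p = i - 1 \<and>
         (\<forall>j<2 * k - 1. p ! Suc j = p ! j + 1 \<or> p ! j = p ! Suc j + 1)}"

definition path_weight :: "(nat \<Rightarrow> gpoly fps) \<Rightarrow> nat list \<Rightarrow> gpoly fps" where
  "path_weight r p = (\<Prod>j | j < length p - 1 \<and> p ! Suc j < p ! j. r (p ! j))"

text \<open>
  Convergence is with respect to the usual topology on formal power series; the sum over
  \<open>k \<ge> 1\<close> is shifted to \<open>k \<ge> 0\<close>. The value at index 0 is a dummy, needed only for uniqueness.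
\<close>

definition r_system :: "(nat \<Rightarrow> gpoly fps) \<Rightarrow> bool" where
  "r_system r \<longleftrightarrow>
     r 0 = 0 \<and>
     (\<forall>i\<ge>1. (\<lambda>k. fps_X ^ Suc k * fps_const (g_var (Suc k)) * (\<Sum>p\<in>paths i (Suc k). path_weight r p))
              sums (r i - of_nat i))"

definition r_series :: "nat \<Rightarrow> gpoly fps" where
  "r_series = (THE r. r_system r)"

lemma r_system_ex1: "\<exists>!r. r_system r"
proof -
  define b :: "(nat \<Rightarrow> gpoly fps) \<Rightarrow> nat \<Rightarrow> nat \<Rightarrow> gpoly fps" where
    "b r i k = fps_const (g_var (Suc k)) * (\<Sum>p\<in>paths i (Suc k). path_weight r p)" for r i k
  define F :: "(nat \<Rightarrow> gpoly fps) \<Rightarrow> nat \<Rightarrow> gpoly fps" where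
    "F r i = (if i = 0 then 0
              else Abs_fps (\<lambda>n. fps_nth (of_nat i) n + (\<Sum>k<n. fps_nth (b r i k) (n - Suc k))))" for r i
  have sums_iff: "(\<lambda>k. fps_X ^ Suc k * c k) sums s \<longleftrightarrow>
      (\<forall>n. fps_nth s n = (\<Sum>k<n. fps_nth (c k) (n - Suc k)))" for c and s :: "gpoly fps"
  proof -
    have nth: "fps_nth (\<Sum>k<m. fps_X ^ Suc k * c k) n = (\<Sum>k<n. fps_nth (c k) (n - Suc k))"
      if "n \<le> m" for m n
    proof -
      have "fps_nth (\<Sum>k<m. fps_X ^ Suc k * c k) n
          = (\<Sum>k<m. if k < n then fps_nth (c k) (n - Suc k) else 0)"
        unfolding fps_sum_nth by (intro sum.cong refl) (auto simp: fps_X_power_mult_nth simp del: power_Suc)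
      also have "\<dots> = (\<Sum>k<n. fps_nth (c k) (n - Suc k))"
        using that by (intro sum.mono_neutral_cong_right) auto
      finally show ?thesis .
    qed
    have "(\<lambda>k. fps_X ^ Suc k * c k) sums s \<longleftrightarrow>
        (\<forall>n. \<forall>\<^sub>F m in sequentially. fps_nth (\<Sum>k<m. fps_X ^ Suc k * c k) n = fps_nth s n)"
      unfolding sums_def by (rule tendsto_fps_iff)
    also have "\<dots> \<longleftrightarrow>
        (\<forall>n. \<forall>\<^sub>F m in sequentially. (\<Sum>k<n. fps_nth (c k) (n - Suc k)) = fps_nth s n)"
    proof (intro all_cong1 eventually_subst)
      fix n
      show "\<forall>\<^sub>F m in sequentially.
          (fps_nth (\<Sum>k<m. fps_X ^ Suc k * c k) n = fps_nth s n) =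
          ((\<Sum>k<n. fps_nth (c k) (n - Suc k)) = fps_nth s n)"
        using eventually_ge_at_top[of n] by eventually_elim (simp only: nth)
    qed
    finally show ?thesis by auto
  qed
  have system_iff: "r_system r \<longleftrightarrow> F r = r" for r
  proof -
    have "r_system r \<longleftrightarrow> r 0 = 0 \<and> (\<forall>i\<ge>1. (\<lambda>k. fps_X ^ Suc k * b r i k) sums (r i - of_nat i))"
      by (simp add: r_system_def b_def mult.assoc del: power_Suc)
    also have "\<dots> \<longleftrightarrow> (\<forall>i. F r i = r i)"
      unfolding sums_iff by (auto simp: F_def fps_eq_iff algebra_simps)
    finally show ?thesis by (simp add: fun_eq_iff)
  qed
  have prod_agree: "fps_cutoff n (prod f A) = fps_cutoff n (prod f' A)"
    if "\<And>x. x \<in> A \<Longrightarrow> fps_cutoff n (f x) = fps_cutoff n (f' x)"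
    for n and f f' :: "nat \<Rightarrow> gpoly fps" and A
    using that
  proof (induction A rule: infinite_finite_induct)
    case (insert x A)
    then have eqs: "fps_nth (f x) j = fps_nth (f' x) j" "fps_nth (prod f A) j = fps_nth (prod f' A) j"
      if "j < n" for j
      using that by (auto simp: fps_cutoff_eq_fps_cutoff_iff)
    have "fps_nth (f x * prod f A) j = fps_nth (f' x * prod f' A) j" if "j < n" for j
      unfolding fps_mult_nth using that by (intro sum.cong refl) (simp add: eqs)
    with insert.hyps show ?case by (simp add: fps_cutoff_eq_fps_cutoff_iff)
  qed auto
  have F_agree: "fps_cutoff (Suc n) (F r i) = fps_cutoff (Suc n) (F r' i)"
    if agree: "\<And>i. fps_cutoff n (r i) = fps_cutoff n (r' i)" for n r r' i
  proof -
    have "fps_cutoff n (path_weight r p) = fps_cutoff n (path_weight r' p)" for p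
      unfolding path_weight_def by (rule prod_agree) (rule agree)
    then have w: "fps_nth (path_weight r p) j = fps_nth (path_weight r' p) j" if "j < n" for p j
      using that by (auto simp: fps_cutoff_eq_fps_cutoff_iff)
    have "fps_nth (b r i k) j = fps_nth (b r' i k) j" if "j < n" for k j
      using that by (simp add: b_def fps_sum_nth w)
    then show ?thesis
      by (auto simp: F_def fps_cutoff_eq_fps_cutoff_iff intro!: sum.cong)
  qed
  have iter: "fps_cutoff n ((F ^^ n) r i) = fps_cutoff n ((F ^^ n) r' i)" for n r r' i
  proof (induction n arbitrary: i)
    case (Suc n)
    show ?case
      unfolding funpow.simps o_apply by (rule F_agree) (rule Suc.IH)
  qed (simp add: fps_eq_iff)
  have stab: "fps_cutoff n ((F ^^ m) r i) = fps_cutoff n ((F ^^ n) r i)" if "n \<le> m" for n m r i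
  proof -
    have "(F ^^ m) r = (F ^^ n) ((F ^^ (m - n)) r)"
      using that by (metis funpow_add le_add_diff_inverse o_apply)
    then show ?thesis by (simp only: iter[of n "(F ^^ (m - n)) r" i r])
  qed
  define r where "r i = Abs_fps (\<lambda>n. fps_nth ((F ^^ Suc n) (\<lambda>_. 0) i) n)" for i
  have r: "fps_cutoff n (r i) = fps_cutoff n ((F ^^ n) (\<lambda>_. 0) i)" for n i
  proof -
    have "fps_nth ((F ^^ Suc j) (\<lambda>_. 0) i) j = fps_nth ((F ^^ n) (\<lambda>_. 0) i) j" if "j < n" for j
    proof -
      have "\<forall>k<Suc j. fps_nth ((F ^^ n) (\<lambda>_. 0) i) k = fps_nth ((F ^^ Suc j) (\<lambda>_. 0) i) k"
        using stab[of "Suc j" n "\<lambda>_. 0" i] that unfolding fps_cutoff_eq_fps_cutoff_iff by simp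
      then show ?thesis by (metis lessI)
    qed
    then show ?thesis by (simp add: r_def fps_cutoff_eq_fps_cutoff_iff)
  qed
  have "F r = r"
  proof (rule ext, rule fps_ext)
    fix i n
    have "fps_cutoff (Suc n) (F r i) = fps_cutoff (Suc n) (r i)"
    proof -
      have "fps_cutoff (Suc n) (F r i) = fps_cutoff (Suc n) (F ((F ^^ n) (\<lambda>_. 0)) i)"
        by (rule F_agree) (rule r)
      then show ?thesis
        unfolding r[of "Suc n" i] by simp
    qed
    then show "fps_nth (F r i) n = fps_nth (r i) n"
      by (auto simp: fps_cutoff_eq_fps_cutoff_iff)
  qed
  moreover have "r' = r''" if "F r' = r'" "F r'' = r''" for r' r''
  proof (rule ext, rule fps_ext)
    fix i n
    have "(F ^^ m) r' = r'" "(F ^^ m) r'' = r''" for m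
      using that by (induction m) auto
    then have "fps_cutoff (Suc n) (r' i) = fps_cutoff (Suc n) (r'' i)"
      using iter[of "Suc n" r' i r''] by metis
    then show "fps_nth (r' i) n = fps_nth (r'' i) n"
      by (auto simp: fps_cutoff_eq_fps_cutoff_iff)
  qed
  ultimately show ?thesis
    unfolding system_iff by (intro ex1I[of _ r])
qed

lemma r_system_r_series: "r_system r_series"
  unfolding r_series_def by (rule theI'[OF r_system_ex1])

definition tree_weight :: "'a blossom \<Rightarrow> gpoly" where
  "tree_weight t = (\<Prod>d\<leftarrow>node_degrees t. g_var (d div 2))"

definition map_weight :: "('h, 'm) rooted_map_scheme \<Rightarrow> gpoly" where
  "map_weight M = (\<Prod>v\<in>vertices M. g_var (card v div 2))"

lemma map_weight_iso:
  assumes "marked_map M" "marked_map N" "marked_map_iso M N \<phi>"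
  shows "map_weight M = map_weight N"
proof -
  have MN: "rooted_map M" "rooted_map N"
    using assms by (auto simp: marked_map_def)
  have iso: "bij_betw \<phi> (half_edges M) (half_edges N)"
    "\<And>h. h \<in> half_edges M \<Longrightarrow> \<phi> (rot M h) = rot N (\<phi> h)"
    using assms by (auto simp: marked_map_iso_def)
  have bij: "bij_betw ((`) \<phi>) (vertices M) (vertices N)"
    by (rule vertices_iso(1)[OF MN iso])
  have card: "card (\<phi> ` v) = card v" if "v \<in> vertices M" for v
    by (rule vertices_iso(2)[OF MN iso that])
  show ?thesis
    unfolding map_weight_def by (subst prod.reindex_bij_betw[OF bij, symmetric]) (simp add: card)
qed

text \<open>Meaningful if \<open>A\<close> has finitely many elements of each size.\<close>

definition gen_fun :: "('x \<Rightarrow> nat) \<Rightarrow> ('x \<Rightarrow> gpoly) \<Rightarrow> 'x set \<Rightarrow> gpoly fps" where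
  "gen_fun sz w A = Abs_fps (\<lambda>n. \<Sum>x\<in>{x \<in> A. sz x = n}. w x)"

end

theory Submission
  imports
    Defs
    "HOL-Combinatorics.Cycles"
begin

text \<open>
  Cutting an enriched tree at its root node turns the children of this node into a path and each
  down-step into a smaller enriched tree, which is the recursion that defines the series \<open>r i\<close>.

  Let a map be explored depth-first from its root, where the edge of the current half-edge is crossed
  (and becomes an edge of a spanning tree) if and only if this half-edge is the head of the edge and
  the edge is neither marked nor met before. By a cut argument due to Bernardi, among the Eulerian
  orientations that agree on the marked edges and on the root edge, the resulting tree is the same for
  all those whose exploration meets the tail of every unmarked non-tree edge first, and one such
  orientation exists if some orientation is root-accessible: let the current edge be oriented outwards
  whenever this is compatible with the earlier choices; then an edge of the current vertex that comes
  from one of its ancestors would close a directed cycle that should have been reversed earlier. So a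
  map is the same thing as an undecorated Eulerian tree together with a matching of its opening and
  closing leaves in which the unmarked pairs have the opening leaf first.

  For a fixed tree, reading the leaf word from left to right, a closing leaf is matched with one of the
  free opening leaves or set aside for a marked edge. If \<open>d\<close> leaves have been set aside, this adds up
  to \<open>(i - 1) (i - 2) \<cdots> (i - d)\<close> times the product of the heights of the remaining closing leaves,
  which initially is the number of decorations of the enriched trees with this shape.
\<close>

section \<open>The generating function of enriched trees\<close>

text \<open>A map in \<open>admissible_maps\<close> carries no orientation, so a tree can be read
  off it only if the result does not depend on the orientation that witnesses admissibility; this is
  why cuts have to be compared between two orientations. \<open>explores\<close> is a relation
  between a map and a given tree, not a function: the same predicate serves for reading the code of
  a map and for checking the map built from a code. The factor (i - 1) (i - 2) ... (i - d) is d!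
  times the binomial coefficient of i - 1 over d: the d leaves set aside are matched arbitrarily
  with the d opening leaves left over, and the binomial coefficient counts the d-tuples of positive
  multiplicities with sum less than i. The count starts at height i - 1 because the root half-edge
  is itself an opening leaf, which can be matched like the others and lifts the height to i. Only
  the numbers of labellings and of matchings over each shape are compared, so the bijection is an
  arbitrary one within each fibre; degrees, size and weight depend on the shape alone.\<close>

definition excess :: "'a option list \<Rightarrow> int" where
  "excess w = (\<Sum>l\<leftarrow>w. if l = None then 1 else - 1)"

lemma excess_simps [simp]:
  "excess [] = 0" "excess (None # w) = excess w + 1" "excess (Some a # w) = excess w - 1"
  "excess (u @ v) = excess u + excess v"
  by (simp_all add: excess_def)

lemma excess_conv_length:
  "excess w = int (length (filter (\<lambda>l. l = None) w)) - int (length (filter (\<lambda>l. l \<noteq> None) w))"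
  by (induction w) (auto simp: excess_def)

text \<open>A node of degree \<open>2 * k\<close> has \<open>k - 1\<close> opening children of
  excess 1 and \<open>k\<close> other children of excess -1, so the value -1 passes from the
  children to the node. A non-opening child therefore acts as a single down-step.\<close>

lemma excess_eulerian:
  "eulerian_nodes t \<Longrightarrow> excess (leaf_word t) = (if t = Opening then 1 else - 1)"
proof (induction t)
  case (Node ts)
  have "excess (concat (map leaf_word ts)) = 2 * int (count_list ts Opening) - int (length ts)"
    if "\<forall>t\<in>set ts. excess (leaf_word t) = (if t = Opening then 1 else - 1)" for ts :: "'a blossom list"
    using that by (induction ts) auto
  then have "excess (concat (map leaf_word ts)) = 2 * int (count_list ts Opening) - int (length ts)"
    using Node by auto
  with Node.prems show ?case by auto
qed auto

lemma eulerian_proper: "eulerian_nodes t \<Longrightarrow> proper_nodes t"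
  by (induction t) auto

text \<open>Balance is built in: a label in \<open>{0..<h}\<close> exists only if \<open>h\<close>
  is at least 1.\<close>

fun labelled :: "int \<Rightarrow> int option list \<Rightarrow> bool" where
  "labelled h [] \<longleftrightarrow> True"
| "labelled h (None # w) \<longleftrightarrow> labelled (h + 1) w"
| "labelled h (Some a # w) \<longleftrightarrow> 0 \<le> a \<and> a < h \<and> labelled (h - 1) w"

lemma labelled_append: "labelled h (u @ v) \<longleftrightarrow> labelled h u \<and> labelled (h + excess u) v"
  by (induction h u rule: labelled.induct) (auto simp: algebra_simps)

lemma labelled_closing_heights:
  "labelled h w \<longleftrightarrow> (\<forall>(h', a)\<in>set (closing_heights h w). a \<in> {0..h' - 1})"
  by (induction h w rule: labelled.induct) auto

lemma labelled_nonneg: "labelled h w \<Longrightarrow> 0 \<le> h \<Longrightarrow> 0 \<le> h + excess w"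
  by (induction h w rule: labelled.induct) (auto simp: algebra_simps)

text \<open>Two conditions of the definition come for free: the numbers of leaves follow from the
  excess, and balance follows from the presence of a label at each closing leaf.\<close>

lemma enriched_iff:
  "enriched_eulerian_tree i t \<longleftrightarrow> t \<noteq> Opening \<and> eulerian_nodes t \<and> labelled (int i) (leaf_word t)"
proof -
  have "blossoming_tree t \<longleftrightarrow> t \<noteq> Opening" if "eulerian_nodes t"
    using excess_eulerian[OF that] eulerian_proper[OF that]
    by (auto simp: blossoming_tree_def excess_conv_length split: if_splits)
  moreover have "balanced i t" if "labelled (int i) (leaf_word t)"
    using that by (fastforce simp: balanced_def labelled_closing_heights)
  ultimately show ?thesis
    unfolding enriched_eulerian_tree_def eulerian_tree_def labelled_closing_heights by blast
qed

definition enriched :: "nat \<Rightarrow> int blossom set" where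
  "enriched i = {t. enriched_eulerian_tree i t}"

text \<open>A labelled word never goes below height 0, but the excess -1 would end there. This
  provides the dummy value that \<open>r_system\<close> requires at index 0.\<close>

lemma enriched_0: "enriched 0 = {}"
  using labelled_nonneg excess_eulerian by (fastforce simp: enriched_def enriched_iff)

lemma Closing_enriched: "Closing a \<in> enriched i \<longleftrightarrow> 0 \<le> a \<and> a < int i"
  by (simp add: enriched_def enriched_iff)

lemma Opening_enriched: "Opening \<notin> enriched i"
  by (simp add: enriched_def enriched_iff)

text \<open>A list of children is read as a path: an opening child is an up-step, any other child, which
  contains one more closing than opening leaf, is a down-step.\<close>

primrec child_lists :: "nat \<Rightarrow> nat \<Rightarrow> nat \<Rightarrow> int blossom list set" where
  "child_lists 0 h e = (if h = e then {[]} else {})"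
| "child_lists (Suc m) h e =
     (#) Opening ` child_lists m (Suc h) e \<union>
     (case h of 0 \<Rightarrow> {} | Suc h' \<Rightarrow> (\<lambda>(t, ts). t # ts) ` (enriched h \<times> child_lists m h' e))"

text \<open>An opening child lifts the height by 1 and any other child lowers it by 1, so the end
  height only depends on the number of opening children.\<close>

lemma child_lists_iff:
  "ts \<in> child_lists m h e \<longleftrightarrow>
     length ts = m \<and> (\<forall>t\<in>set ts. eulerian_nodes t) \<and> labelled (int h) (concat (map leaf_word ts)) \<and>
     int e = int h + 2 * int (count_list ts Opening) - int m"
proof (induction m arbitrary: h ts)
  case (Suc m)
  show ?case
  proof (cases ts)
    case (Cons t us)
    show ?thesis
    proof (cases "t = Opening")
      case True
      then have "ts \<in> child_lists (Suc m) h e \<longleftrightarrow> us \<in> child_lists m (Suc h) e"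
        using Cons by (auto simp: Opening_enriched image_iff split: nat.split)
      then show ?thesis
        using Cons True by (auto simp: Suc.IH algebra_simps)
    next
      case False
      have *: "ts \<in> child_lists (Suc m) h e \<longleftrightarrow> (\<exists>h'. h = Suc h' \<and> t \<in> enriched h \<and> us \<in> child_lists m h' e)"
        using Cons False by (auto split: nat.split)
      show ?thesis
      proof (cases "eulerian_nodes t \<and> labelled (int h) (leaf_word t)")
        case True
        then have "excess (leaf_word t) = - 1"
          using False excess_eulerian[of t] by simp
        \<comment> \<open>A tree of excess -1 cannot be labelled from height 0, so the down-step
          stays on or above 0.\<close>
        moreover from this obtain h' where "h = Suc h'"
          using labelled_nonneg[of "int h" "leaf_word t"] True by (cases h) auto
        ultimately show ?thesis
          unfolding * using True Cons False
          by (auto simp: enriched_def enriched_iff Suc.IH labelled_append)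
      next
        case False
        then show ?thesis
          unfolding * using Cons by (auto simp: enriched_def enriched_iff labelled_append)
      qed
    qed
  qed (auto split: nat.split)
qed auto

declare child_lists.simps(2) [simp del]

text \<open>Degree \<open>2 * (k + 1)\<close> with \<open>k\<close> opening children means
  \<open>2 * k + 1\<close> steps, one more down than up, which lead from \<open>i\<close> to
  \<open>i - 1\<close>.\<close>

lemma Node_enriched:
  assumes "i \<ge> 1"
  shows "Node ts \<in> enriched i \<longleftrightarrow> (\<exists>k. ts \<in> child_lists (2 * k + 1) i (i - 1))"
proof
  assume "Node ts \<in> enriched i"
  then have *: "\<forall>t\<in>set ts. eulerian_nodes t" "labelled (int i) (concat (map leaf_word ts))"
    and "eulerian_nodes (Node ts)"
    by (auto simp: enriched_def enriched_iff)
  from this(3) obtain k where "length ts + 1 = 2 * k" "count_list ts Opening = k - 1"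
    by auto
  with * assms have "ts \<in> child_lists (2 * (k - 1) + 1) i (i - 1)"
    by (auto simp: child_lists_iff)
  then show "\<exists>k. ts \<in> child_lists (2 * k + 1) i (i - 1)" by blast
next
  assume "\<exists>k. ts \<in> child_lists (2 * k + 1) i (i - 1)"
  then obtain k where k: "length ts = 2 * k + 1" "\<forall>t\<in>set ts. eulerian_nodes t"
    "labelled (int i) (concat (map leaf_word ts))"
    "int (i - 1) = int i + 2 * int (count_list ts Opening) - int (2 * k + 1)"
    by (auto simp: child_lists_iff)
  then have "length ts + 1 = 2 * Suc k \<and> count_list ts Opening = Suc k - 1"
    using assms by auto
  then have "\<exists>k. length ts + 1 = 2 * k \<and> count_list ts Opening = k - 1"
    by blast
  then have "eulerian_nodes (Node ts)"
    using k by simp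
  with k show "Node ts \<in> enriched i"
    by (simp add: enriched_def enriched_iff)
qed

section \<open>Finitely many enriched trees of each size\<close>

lemma tree_half_degree_simps [simp]:
  "tree_half_degree Opening = 0" "tree_half_degree (Closing a) = 0"
  "tree_half_degree (Node ts) = (length ts + 1) div 2 + sum_list (map tree_half_degree ts)"
proof -
  have "(\<Sum>d\<leftarrow>concat (map node_degrees ts). d div 2) = sum_list (map tree_half_degree ts)"
    by (induction ts) (auto simp: tree_half_degree_def)
  then show "tree_half_degree (Node ts) = (length ts + 1) div 2 + sum_list (map tree_half_degree ts)"
    by (simp add: tree_half_degree_def)
qed (simp_all add: tree_half_degree_def)

lemma tree_weight_simps [simp]:
  "tree_weight Opening = 1" "tree_weight (Closing a) = 1"
  "tree_weight (Node ts) = g_var ((length ts + 1) div 2) * prod_list (map tree_weight ts)"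
proof -
  have "(\<Prod>d\<leftarrow>concat (map node_degrees ts). g_var (d div 2)) = prod_list (map tree_weight ts)"
    by (induction ts) (auto simp: tree_weight_def)
  then show "tree_weight (Node ts) = g_var ((length ts + 1) div 2) * prod_list (map tree_weight ts)"
    by (simp add: tree_weight_def)
qed (simp_all add: tree_weight_def)

lemma finite_child_lists:
  assumes "\<And>h. finite {t \<in> enriched h. tree_half_degree t < n}"
  shows "finite {ts \<in> child_lists m h e. \<forall>t\<in>set ts. tree_half_degree t < n}"
proof (induction m arbitrary: h)
  case (Suc m)
  have "{ts \<in> child_lists (Suc m) h e. \<forall>t\<in>set ts. tree_half_degree t < n} \<subseteq>
      (#) Opening ` {ts \<in> child_lists m (Suc h) e. \<forall>t\<in>set ts. tree_half_degree t < n} \<union>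
      (\<lambda>(t, ts). t # ts) ` ({t \<in> enriched h. tree_half_degree t < n} \<times>
        {ts \<in> child_lists m (h - 1) e. \<forall>t\<in>set ts. tree_half_degree t < n})"
    by (auto simp: child_lists.simps(2) split: nat.splits)
  moreover have "finite \<dots>"
    using assms Suc.IH by blast
  ultimately show ?case by (rule finite_subset)
qed auto

text \<open>The root node adds at least 1 to the half-degree, so its children are strictly smaller,
  and its own degree is bounded as well. The trees without node are finitely many labelled closing
  leaves.\<close>

lemma finite_enriched_less: "finite {t \<in> enriched i. tree_half_degree t < n}"
proof (induction n arbitrary: i)
  case (Suc n)
  show ?case
  proof (cases i)
    case (Suc i')
    have le: "tree_half_degree t \<le> sum_list (map tree_half_degree ts)" if "t \<in> set ts"
      for t :: "int blossom" and ts
      using that by (intro member_le_sum_list) auto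
    have "{t \<in> enriched i. tree_half_degree t < Suc n} \<subseteq> Closing ` {0..<int i} \<union>
        Node ` (\<Union>k\<in>{..n}. {ts \<in> child_lists (2 * k + 1) i (i - 1). \<forall>t\<in>set ts. tree_half_degree t < n})"
    proof
      fix t assume t: "t \<in> {t \<in> enriched i. tree_half_degree t < Suc n}"
      show "t \<in> Closing ` {0..<int i} \<union>
        Node ` (\<Union>k\<in>{..n}. {ts \<in> child_lists (2 * k + 1) i (i - 1). \<forall>t\<in>set ts. tree_half_degree t < n})"
      proof (cases t)
        case (Node ts)
        then obtain k where k: "ts \<in> child_lists (2 * k + 1) i (i - 1)"
          using t Suc by (auto simp: Node_enriched)
        then have "length ts = 2 * k + 1" by (simp add: child_lists_iff)
        then have "k + 1 + sum_list (map tree_half_degree ts) < Suc n"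
          using t Node by simp
        then have "k \<le> n" "\<forall>t\<in>set ts. tree_half_degree t < n"
          using le[of _ ts] by fastforce+
        then show ?thesis using k Node by auto
      qed (use t in \<open>auto simp: Opening_enriched Closing_enriched\<close>)
    qed
    moreover have "finite \<dots>"
      using finite_child_lists[OF Suc.IH] by blast
    ultimately show ?thesis by (rule finite_subset)
  qed (simp add: enriched_0)
qed auto

lemma finite_enriched: "finite {t \<in> enriched i. tree_half_degree t = n}"
  by (rule finite_subset[OF _ finite_enriched_less[of i "Suc n"]]) auto

lemma finite_child_lists_eq:
  "finite {ts \<in> child_lists m h e. sum_list (map tree_half_degree ts) = n}"
proof (rule finite_subset)
  show "finite {ts \<in> child_lists m h e. \<forall>t\<in>set ts. tree_half_degree t < Suc n}"
    by (rule finite_child_lists) (rule finite_enriched_less)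
  have "tree_half_degree t \<le> sum_list (map tree_half_degree ts)" if "t \<in> set ts"
    for t :: "int blossom" and ts
    using that by (intro member_le_sum_list) auto
  then show "{ts \<in> child_lists m h e. sum_list (map tree_half_degree ts) = n} \<subseteq>
      {ts \<in> child_lists m h e. \<forall>t\<in>set ts. tree_half_degree t < Suc n}"
    by (auto simp: less_Suc_eq_le)
qed

section \<open>Generating functions of lists of children and of weighted paths\<close>

lemma gen_fun_reindex:
  assumes "bij_betw f A B" "\<And>x. x \<in> A \<Longrightarrow> sz' (f x) = sz x" "\<And>x. x \<in> A \<Longrightarrow> w' (f x) = w x"
  shows "gen_fun sz' w' B = gen_fun sz w A"
proof (rule fps_ext)
  fix n
  have "bij_betw f {x \<in> A. sz x = n} {y \<in> B. sz' y = n}"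
    by (rule bij_betw_Collect[OF assms(1)]) (simp add: assms(2))
  from sum.reindex_bij_betw[OF this, of w']
  show "fps_nth (gen_fun sz' w' B) n = fps_nth (gen_fun sz w A) n"
    by (simp add: gen_fun_def assms(3))
qed

lemma gen_fun_Un:
  assumes "\<And>n. finite {x \<in> A. sz x = n}" "\<And>n. finite {x \<in> B. sz x = n}" "A \<inter> B = {}"
  shows "gen_fun sz w (A \<union> B) = gen_fun sz w A + gen_fun sz w B"
proof (rule fps_ext)
  fix n
  have *: "{x \<in> A \<union> B. sz x = n} = {x \<in> A. sz x = n} \<union> {x \<in> B. sz x = n}" by auto
  show "fps_nth (gen_fun sz w (A \<union> B)) n = fps_nth (gen_fun sz w A + gen_fun sz w B) n"
    unfolding gen_fun_def fps_nth_Abs_fps fps_add_nth *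
    by (rule sum.union_disjoint) (use assms in auto)
qed

lemma gen_fun_times:
  assumes A: "\<And>n. finite {x \<in> A. sz x = n}" and B: "\<And>n. finite {x \<in> B. sz' x = n}"
  shows "gen_fun (\<lambda>(x, y). sz x + sz' y) (\<lambda>(x, y). w x * w' y) (A \<times> B) = gen_fun sz w A * gen_fun sz' w' B"
proof (rule fps_ext)
  fix n
  have *: "{p \<in> A \<times> B. (\<lambda>(x, y). sz x + sz' y) p = n} =
      (\<Union>j\<in>{0..n}. {x \<in> A. sz x = j} \<times> {y \<in> B. sz' y = n - j})" by auto
  have "(\<Sum>p\<in>{p \<in> A \<times> B. (\<lambda>(x, y). sz x + sz' y) p = n}. (\<lambda>(x, y). w x * w' y) p) =
      (\<Sum>j=0..n. \<Sum>p\<in>{x \<in> A. sz x = j} \<times> {y \<in> B. sz' y = n - j}. (\<lambda>(x, y). w x * w' y) p)"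
    unfolding * using A B by (intro sum.UNION_disjoint) auto
  also have "\<dots> = (\<Sum>j=0..n. (\<Sum>x\<in>{x \<in> A. sz x = j}. w x) * (\<Sum>y\<in>{y \<in> B. sz' y = n - j}. w' y))"
    by (simp add: sum_product sum.cartesian_product)
  finally show "fps_nth (gen_fun (\<lambda>(x, y). sz x + sz' y) (\<lambda>(x, y). w x * w' y) (A \<times> B)) n
      = fps_nth (gen_fun sz w A * gen_fun sz' w' B) n"
    by (simp add: gen_fun_def fps_mult_nth)
qed

text \<open>The transfer recursion for weighted paths by their first step. It is the common form to
  which lists of children and sums of \<open>path_weight\<close> are both reduced.\<close>

primrec path_sum :: "(nat \<Rightarrow> gpoly fps) \<Rightarrow> nat \<Rightarrow> nat \<Rightarrow> nat \<Rightarrow> gpoly fps" where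
  "path_sum r 0 h e = (if h = e then 1 else 0)"
| "path_sum r (Suc m) h e =
     path_sum r m (Suc h) e + (case h of 0 \<Rightarrow> 0 | Suc h' \<Rightarrow> r h * path_sum r m h' e)"

text \<open>Splitting off the first child is splitting off the first step: an opening child has size
  0 and weight 1, and any other child ranges over all enriched trees for the current height, which
  gives the factor of a down-step.\<close>

lemma gen_fun_child_lists:
  "gen_fun (\<lambda>ts. sum_list (map tree_half_degree ts)) (\<lambda>ts. prod_list (map tree_weight ts)) (child_lists m h e)
   = path_sum (\<lambda>h. gen_fun tree_half_degree tree_weight (enriched h)) m h e"
proof (induction m arbitrary: h)
  case 0
  have "{x. x = [] \<and> sum_list (map tree_half_degree x) = n} = (if n = 0 then {[] :: int blossom list} else {})" for n
    by auto
  then show ?case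
    by (auto simp: gen_fun_def fps_eq_iff)
next
  case (Suc m)
  let ?sz = "\<lambda>ts. sum_list (map tree_half_degree ts)"
  let ?w = "\<lambda>ts. prod_list (map tree_weight ts)"
  let ?R = "\<lambda>h. gen_fun tree_half_degree tree_weight (enriched h)"
  let ?O = "(#) Opening ` child_lists m (Suc h) e"
  have O: "gen_fun ?sz ?w ?O = path_sum ?R m (Suc h) e"
    unfolding Suc.IH[symmetric] by (rule gen_fun_reindex, rule inj_on_imp_bij_betw) auto
  show ?case
  proof (cases h)
    case 0
    then show ?thesis using O by (simp add: child_lists.simps(2))
  next
    case (Suc h')
    let ?C = "(\<lambda>(t, ts). t # ts) ` (enriched h \<times> child_lists m h' e)"
    have "gen_fun ?sz ?w ?C = gen_fun (\<lambda>(t, ts). tree_half_degree t + ?sz ts) (\<lambda>(t, ts). tree_weight t * ?w ts)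
        (enriched h \<times> child_lists m h' e)"
      by (rule gen_fun_reindex, rule inj_on_imp_bij_betw) (auto simp: inj_on_def)
    also have "\<dots> = ?R h * path_sum ?R m h' e"
      unfolding Suc.IH[symmetric] by (rule gen_fun_times[OF finite_enriched finite_child_lists_eq])
    finally have C: "gen_fun ?sz ?w ?C = ?R h * path_sum ?R m h' e" .
    have eq: "child_lists (Suc m) h e = ?O \<union> ?C" using Suc by (simp add: child_lists.simps(2))
    have "gen_fun ?sz ?w (?O \<union> ?C) = gen_fun ?sz ?w ?O + gen_fun ?sz ?w ?C"
    proof (rule gen_fun_Un)
      show "finite {ts \<in> ?O. ?sz ts = n}" "finite {ts \<in> ?C. ?sz ts = n}" for n
        by (rule finite_subset[OF _ finite_child_lists_eq[of "Suc m" h e n]], use eq in blast)+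
    qed (auto simp: Opening_enriched)
    then show ?thesis
      unfolding eq C O using Suc by simp
  qed
qed

text \<open>\<open>paths\<close> with arbitrary length and end point, so that removing the first
  step stays inside the family.\<close>

definition walks :: "nat \<Rightarrow> nat \<Rightarrow> nat \<Rightarrow> nat list set" where
  "walks m h e = {p. length p = Suc m \<and> hd p = h \<and> last p = e \<and>
     (\<forall>j<m. p ! Suc j = p ! j + 1 \<or> p ! j = p ! Suc j + 1)}"

lemma walks_nonempty: "p \<in> walks m h e \<Longrightarrow> p \<noteq> []" and walks_hd: "p \<in> walks m h e \<Longrightarrow> hd p = h"
  by (auto simp: walks_def)

lemma walks_0: "walks 0 h e = (if h = e then {[h]} else {})"
  by (auto simp: walks_def length_Suc_conv)

lemma walks_Suc:
  "walks (Suc m) h e = (#) h ` walks m (Suc h) e \<union> (case h of 0 \<Rightarrow> {} | Suc h' \<Rightarrow> (#) h ` walks m h' e)"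
proof -
  have "p \<in> walks (Suc m) h e \<longleftrightarrow>
     (\<exists>q. p = h # q \<and> (q \<in> walks m (Suc h) e \<or> (\<exists>h'. h = Suc h' \<and> q \<in> walks m h' e)))" for p
  proof (cases p)
    case (Cons x q)
    show ?thesis
      by (cases q) (auto simp: Cons walks_def All_less_Suc2)
  qed (simp add: walks_def)
  then show ?thesis by (auto split: nat.split)
qed

lemma finite_walks: "finite (walks m h e)"
  by (induction m arbitrary: h) (auto simp: walks_0 walks_Suc split: nat.split)

lemma path_weight_Cons:
  assumes "q \<noteq> []"
  shows "path_weight r (h # q) = (if hd q < h then r h else 1) * path_weight r q"
proof -
  have "{j. j < length (h # q) - 1 \<and> (h # q) ! Suc j < (h # q) ! j} =
      (if hd q < h then {0} else {}) \<union> Suc ` {j. j < length q - 1 \<and> q ! Suc j < q ! j}"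
  proof (intro set_eqI)
    fix j
    show "j \<in> {j. j < length (h # q) - 1 \<and> (h # q) ! Suc j < (h # q) ! j} \<longleftrightarrow>
      j \<in> (if hd q < h then {0} else {}) \<union> Suc ` {j. j < length q - 1 \<and> q ! Suc j < q ! j}"
      using assms by (cases j) (auto simp: hd_conv_nth)
  qed
  then show ?thesis
    unfolding path_weight_def
    by (simp add: prod.union_disjoint prod.reindex)
qed

lemma path_sum_walks: "(\<Sum>p\<in>walks m h e. path_weight r p) = path_sum r m h e"
proof (induction m arbitrary: h)
  case 0
  then show ?case by (simp add: walks_0 path_weight_def)
next
  case (Suc m)
  have up: "(\<Sum>p\<in>(#) h ` walks m (Suc h) e. path_weight r p) = path_sum r m (Suc h) e"
    unfolding Suc.IH[symmetric]
    by (subst sum.reindex) (auto simp: path_weight_Cons walks_nonempty walks_hd intro!: sum.cong)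
  show ?case
  proof (cases h)
    case (Suc h')
    have "(\<Sum>p\<in>(#) h ` walks m h' e. path_weight r p) = r h * path_sum r m h' e"
      unfolding Suc.IH[symmetric] sum_distrib_left
      by (subst sum.reindex) (auto simp: Suc path_weight_Cons walks_nonempty walks_hd intro!: sum.cong)
    moreover have "(#) h ` walks m (Suc h) e \<inter> (#) h ` walks m h' e = {}"
      using Suc by (auto simp: walks_def)
    ultimately show ?thesis
      unfolding walks_Suc using Suc up by (simp add: sum.union_disjoint finite_walks)
  qed (use up in \<open>simp add: walks_Suc\<close>)
qed

lemma paths_walks: "paths i (Suc k) = walks (2 * k + 1) i (i - 1)"
  by (auto simp: paths_def walks_def)

text \<open>The coefficient of degree \<open>n\<close> only receives contributions from
  \<open>k < n\<close>, so the partial sums are eventually constant in each degree.\<close>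

lemma sums_fps_shift:
  fixes s :: "gpoly fps"
  assumes "\<And>n. fps_nth s n = (\<Sum>k<n. fps_nth (c k) (n - Suc k))"
  shows "(\<lambda>k. fps_X ^ Suc k * c k) sums s"
  unfolding sums_def
proof (rule tendsto_fpsI)
  fix n
  have "fps_nth (\<Sum>k<m. fps_X ^ Suc k * c k) n = fps_nth s n" if "n \<le> m" for m
  proof -
    have "fps_nth (\<Sum>k<m. fps_X ^ Suc k * c k) n = (\<Sum>k<m. if k < n then fps_nth (c k) (n - Suc k) else 0)"
      unfolding fps_sum_nth by (intro sum.cong refl) (auto simp: fps_X_power_mult_nth simp del: power_Suc)
    also have "\<dots> = (\<Sum>k<n. fps_nth (c k) (n - Suc k))"
      using that by (intro sum.mono_neutral_cong_right) auto
    finally show ?thesis using assms by simp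
  qed
  then show "\<forall>\<^sub>F m in sequentially. fps_nth (\<Sum>k<m. fps_X ^ Suc k * c k) n = fps_nth s n"
    by (rule eventually_sequentiallyI)
qed

lemma enriched_trees_alt: "enriched_trees i = {t \<in> enriched i. t \<in> range Node}"
proof -
  have "node_degrees t \<noteq> [] \<longleftrightarrow> t \<in> range Node" for t :: "int blossom"
    by (cases t) auto
  then show ?thesis by (auto simp: enriched_trees_def enriched_def)
qed

text \<open>The trees without node are the closing leaves labelled \<open>0\<close>, ...,
  \<open>i - 1\<close>, each of size 0 and weight 1; they are the constant term \<open>i\<close> of
  the system.\<close>

lemma gen_fun_enriched:
  assumes "i \<ge> 1"
  shows "gen_fun tree_half_degree tree_weight (enriched i)
    = gen_fun tree_half_degree tree_weight (enriched_trees i) + of_nat i"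
proof -
  have "enriched i = enriched_trees i \<union> Closing ` {0..<int i}"
    unfolding enriched_trees_alt
  proof (intro set_eqI)
    fix t
    show "t \<in> enriched i \<longleftrightarrow> t \<in> {t \<in> enriched i. t \<in> range Node} \<union> Closing ` {0..<int i}"
      by (cases t) (auto simp: Opening_enriched Closing_enriched)
  qed
  moreover have "gen_fun tree_half_degree tree_weight (Closing ` {0..<int i}) = of_nat i"
  proof (rule fps_ext)
    fix n
    have "{t \<in> Closing ` {0..<int i}. tree_half_degree t = n} = (if n = 0 then Closing ` {0..<int i} else {})"
      by auto
    then show "fps_nth (gen_fun tree_half_degree tree_weight (Closing ` {0..<int i})) n = fps_nth (of_nat i) n"
      by (auto simp: gen_fun_def sum.reindex inj_on_def fps_of_nat[symmetric])
  qed
  moreover have "gen_fun tree_half_degree tree_weight (enriched_trees i \<union> Closing ` {0..<int i}) =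
      gen_fun tree_half_degree tree_weight (enriched_trees i) +
      gen_fun tree_half_degree tree_weight (Closing ` {0..<int i})"
    by (rule gen_fun_Un)
      (auto simp: enriched_trees_alt intro: finite_subset[OF _ finite_enriched] rev_finite_subset)
  ultimately show ?thesis by simp
qed

text \<open>Removing a root node of degree \<open>2 * Suc k\<close> leaves a list of
  \<open>2 * k + 1\<close> children; the node itself accounts for \<open>fps_X ^ Suc k\<close> and
  \<open>g_var (Suc k)\<close>.\<close>

lemma r_system_enriched: "r_system (\<lambda>i. gen_fun tree_half_degree tree_weight (enriched i))"
  unfolding r_system_def
proof (intro conjI allI impI)
  show "gen_fun tree_half_degree tree_weight (enriched 0) = 0"
    by (simp add: enriched_0 gen_fun_def fps_eq_iff)
next
  fix i :: nat assume i: "i \<ge> 1"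
  let ?R = "\<lambda>i. gen_fun tree_half_degree tree_weight (enriched i)"
  let ?L = "\<lambda>k. child_lists (2 * k + 1) i (i - 1)"
  let ?sz = "\<lambda>ts. sum_list (map tree_half_degree ts)"
  let ?w = "\<lambda>ts. prod_list (map tree_weight ts)"
  let ?c = "\<lambda>k. fps_const (g_var (Suc k)) * (\<Sum>p\<in>paths i (Suc k). path_weight ?R p)"
  have "fps_nth (gen_fun tree_half_degree tree_weight (enriched_trees i)) n = (\<Sum>k<n. fps_nth (?c k) (n - Suc k))" for n
  proof -
    have "{t \<in> enriched_trees i. tree_half_degree t = n} =
        (\<Union>k\<in>{..<n}. Node ` {ts \<in> ?L k. ?sz ts = n - Suc k})"
    proof (intro set_eqI iffI)
      fix t assume t: "t \<in> {t \<in> enriched_trees i. tree_half_degree t = n}"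
      then obtain ts k where ts: "t = Node ts" "ts \<in> ?L k"
        using Node_enriched[OF i] by (auto simp: enriched_trees_alt)
      then have "length ts = 2 * k + 1" by (simp add: child_lists_iff)
      then have "Suc k + ?sz ts = n" using t ts by simp
      then show "t \<in> (\<Union>k\<in>{..<n}. Node ` {ts \<in> ?L k. ?sz ts = n - Suc k})"
        using ts by force
    next
      fix t assume "t \<in> (\<Union>k\<in>{..<n}. Node ` {ts \<in> ?L k. ?sz ts = n - Suc k})"
      then obtain k ts where ts: "k < n" "t = Node ts" "ts \<in> ?L k" "?sz ts = n - Suc k" by auto
      then have "length ts = 2 * k + 1" by (simp add: child_lists_iff)
      then show "t \<in> {t \<in> enriched_trees i. tree_half_degree t = n}"
        using ts Node_enriched[OF i] by (auto simp: enriched_trees_alt)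
    qed
    then have "(\<Sum>t\<in>{t \<in> enriched_trees i. tree_half_degree t = n}. tree_weight t) =
        (\<Sum>k<n. \<Sum>t\<in>Node ` {ts \<in> ?L k. ?sz ts = n - Suc k}. tree_weight t)"
    proof (simp only:, intro sum.UNION_disjoint)
      show "\<forall>k\<in>{..<n}. finite (Node ` {ts \<in> ?L k. ?sz ts = n - Suc k})"
        using finite_child_lists_eq by blast
      \<comment> \<open>Different \<open>k\<close> belong to lists of different lengths.\<close>
      show "\<forall>k\<in>{..<n}. \<forall>l\<in>{..<n}. k \<noteq> l \<longrightarrow>
         Node ` {ts \<in> ?L k. ?sz ts = n - Suc k} \<inter> Node ` {ts \<in> ?L l. ?sz ts = n - Suc l} = {}"
        by (auto simp: child_lists_iff)
    qed auto
    also have "\<dots> = (\<Sum>k<n. \<Sum>ts\<in>{ts \<in> ?L k. ?sz ts = n - Suc k}. g_var (Suc k) * ?w ts)"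
      by (intro sum.cong refl, subst sum.reindex) (auto simp: inj_on_def child_lists_iff intro!: sum.cong)
    also have "\<dots> = (\<Sum>k<n. fps_nth (?c k) (n - Suc k))"
      unfolding paths_walks path_sum_walks gen_fun_child_lists[symmetric]
      by (simp add: gen_fun_def sum_distrib_left)
    finally show ?thesis by (simp add: gen_fun_def)
  qed
  then have "(\<lambda>k. fps_X ^ Suc k * ?c k) sums gen_fun tree_half_degree tree_weight (enriched_trees i)"
    by (rule sums_fps_shift)
  then show "(\<lambda>k. fps_X ^ Suc k * fps_const (g_var (Suc k)) * (\<Sum>p\<in>paths i (Suc k). path_weight ?R p))
      sums (?R i - of_nat i)"
    unfolding gen_fun_enriched[OF i] by (simp add: mult.assoc)
qed

lemma gen_fun_enriched_trees:
  assumes "i \<ge> 1"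
  shows "gen_fun tree_half_degree tree_weight (enriched_trees i) = r_series i - of_nat i"
proof -
  have "r_series = (\<lambda>i. gen_fun tree_half_degree tree_weight (enriched i))"
    using r_system_ex1 r_system_r_series r_system_enriched by blast
  then have "r_series i = gen_fun tree_half_degree tree_weight (enriched i)" by (rule fun_cong)
  then show ?thesis using gen_fun_enriched[OF assms] by simp
qed

lemma finite_enriched_trees: "finite {t \<in> enriched_trees i. tree_half_degree t = n}"
  by (rule finite_subset[OF _ finite_enriched[of i n]]) (auto simp: enriched_trees_alt)

section \<open>Counting matchings of leaf words\<close>

text \<open>Bijections are classified by their value at \<open>d\<close>. Extensionality fixes the
  values outside the domain, so that sets of functions have meaningful cardinalities.\<close>

lemma ext_bij_insert:
  assumes "d \<notin> D"
  shows "{f \<in> extensional (insert d D). bij_betw f (insert d D) A} =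
    (\<Union>y\<in>A. (\<lambda>g. g(d := y)) ` {g \<in> extensional D. bij_betw g D (A - {y})})"
proof (intro set_eqI iffI)
  fix f assume f: "f \<in> {f \<in> extensional (insert d D). bij_betw f (insert d D) A}"
  let ?g = "restrict f D"
  have "bij_betw f D (A - {f d})"
    using f assms bij_betw_subset[of f "insert d D" A D "f ` D"]
    by (auto simp: bij_betw_def inj_on_def)
  then have "bij_betw ?g D (A - {f d})"
    using bij_betw_cong by (metis (mono_tags, lifting) restrict_apply')
  moreover have "f = ?g(d := f d)"
    using f by (auto simp: fun_eq_iff extensional_def)
  moreover have "f d \<in> A" using f by (auto simp: bij_betw_def)
  ultimately show "f \<in> (\<Union>y\<in>A. (\<lambda>g. g(d := y)) ` {g \<in> extensional D. bij_betw g D (A - {y})})"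
    by blast
next
  fix f assume "f \<in> (\<Union>y\<in>A. (\<lambda>g. g(d := y)) ` {g \<in> extensional D. bij_betw g D (A - {y})})"
  then obtain y g where g: "y \<in> A" "g \<in> extensional D" "bij_betw g D (A - {y})" "f = g(d := y)"
    by blast
  then have "\<And>a. a \<in> D \<Longrightarrow> f a = g a" using assms by auto
  then have "bij_betw f D (A - {y})"
    using g(3) bij_betw_cong by metis
  then have "bij_betw f (insert d D) (insert (f d) (A - {y}))"
    using assms g by (intro notIn_Un_bij_betw[of d D f "A - {y}", simplified]) auto
  then show "f \<in> {f \<in> extensional (insert d D). bij_betw f (insert d D) A}"
    using g by (auto simp: extensional_def insert_absorb)
qed

lemma inj_on_fun_upd_extensional: "d \<notin> D \<Longrightarrow> inj_on (\<lambda>g. g(d := y)) (extensional D)"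
  by (rule inj_onI) (metis (no_types, lifting) extensional_arb fun_upd_idem_iff fun_upd_upd)

lemma card_ext_bij:
  assumes "finite D" "finite A" "card D = card A"
  shows "finite {f \<in> extensional D. bij_betw f D A} \<and> card {f \<in> extensional D. bij_betw f D A} = fact (card D)"
  using assms
proof (induction D arbitrary: A)
  case empty
  then have *: "{f \<in> extensional {}. bij_betw f {} A} = {\<lambda>_. undefined}"
    by (auto simp: bij_betw_def)
  show ?case unfolding * by simp
next
  case (insert d D)
  let ?F = "\<lambda>y. (\<lambda>g. g(d := y)) ` {g \<in> extensional D. bij_betw g D (A - {y})}"
  have IH: "finite {g \<in> extensional D. bij_betw g D (A - {y})} \<and>
      card {g \<in> extensional D. bij_betw g D (A - {y})} = fact (card D)" if "y \<in> A" for y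
    using insert that by (intro insert.IH) auto
  have "card (?F y) = fact (card D)" if "y \<in> A" for y
    using IH[OF that] inj_on_fun_upd_extensional[OF insert.hyps(2), of y]
    by (subst card_image) (auto intro: inj_on_subset)
  moreover have "card (\<Union>y\<in>A. ?F y) = (\<Sum>y\<in>A. card (?F y))"
    using insert IH by (intro card_UN_disjoint) (auto simp: fun_upd_eqD dest: fun_upd_eqD)
  ultimately show ?case
    unfolding ext_bij_insert[OF insert.hyps(2)] using IH insert.hyps insert.prems(1)
    by (simp flip: insert.prems(2))
qed

lemma ext_pos_insert:
  assumes "d \<notin> D" "finite D"
  shows "{\<mu> \<in> extensional (insert d D). (\<forall>c\<in>insert d D. 0 < \<mu> c) \<and> sum \<mu> (insert d D) < n} =
    (\<Union>m\<in>{1..<n}. (\<lambda>\<mu>. \<mu>(d := m)) ` {\<mu> \<in> extensional D. (\<forall>c\<in>D. 0 < \<mu> c) \<and> sum \<mu> D < n - (m :: nat)})"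
proof (intro set_eqI iffI)
  fix \<mu> :: "'a \<Rightarrow> nat"
  assume \<mu>: "\<mu> \<in> {\<mu> \<in> extensional (insert d D). (\<forall>c\<in>insert d D. 0 < \<mu> c) \<and> sum \<mu> (insert d D) < n}"
  have "sum (restrict \<mu> D) D = sum \<mu> D" by simp
  moreover have "\<mu> = (restrict \<mu> D)(d := \<mu> d)"
    using \<mu> by (auto simp: fun_eq_iff extensional_def)
  ultimately show "\<mu> \<in> (\<Union>m\<in>{1..<n}. (\<lambda>\<mu>. \<mu>(d := m)) ` {\<mu> \<in> extensional D. (\<forall>c\<in>D. 0 < \<mu> c) \<and> sum \<mu> D < n - m})"
    using \<mu> assms by (intro UN_I[of "\<mu> d"] image_eqI[of _ _ "restrict \<mu> D"]) auto
next
  fix \<mu> :: "'a \<Rightarrow> nat"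
  assume "\<mu> \<in> (\<Union>m\<in>{1..<n}. (\<lambda>\<mu>. \<mu>(d := m)) ` {\<mu> \<in> extensional D. (\<forall>c\<in>D. 0 < \<mu> c) \<and> sum \<mu> D < n - m})"
  then obtain m \<nu> where *: "m \<in> {1..<n}" "\<nu> \<in> extensional D" "\<forall>c\<in>D. 0 < \<nu> c" "sum \<nu> D < n - m" "\<mu> = \<nu>(d := m)"
    by blast
  have "sum \<mu> D = sum \<nu> D" using * assms by (intro sum.cong) auto
  then show "\<mu> \<in> {\<mu> \<in> extensional (insert d D). (\<forall>c\<in>insert d D. 0 < \<mu> c) \<and> sum \<mu> (insert d D) < n}"
    using * assms by (auto simp: extensional_def)
qed

text \<open>Fixing the value at one point turns the count into the hockey-stick sum of
  \<open>k choose card D\<close> over \<open>k < n\<close>.\<close>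

lemma card_ext_pos:
  assumes "finite D"
  shows "finite {\<mu> \<in> extensional D. (\<forall>c\<in>D. 0 < \<mu> c) \<and> sum \<mu> D < Suc n} \<and>
    card {\<mu> \<in> extensional D. (\<forall>c\<in>D. 0 < \<mu> c) \<and> sum \<mu> D < Suc n} = n choose card D"
  using assms
proof (induction D arbitrary: n)
  case empty
  have "{\<mu> \<in> extensional {}. (\<forall>c\<in>{}. 0 < \<mu> c) \<and> sum \<mu> {} < Suc n} = {\<lambda>_. undefined}"
    by auto
  then show ?case by simp
next
  case (insert d D)
  let ?P = "\<lambda>m. {\<mu> \<in> extensional D. (\<forall>c\<in>D. 0 < \<mu> c) \<and> sum \<mu> D < Suc n - m}"
  let ?F = "\<lambda>m. (\<lambda>\<mu>. \<mu>(d := m)) ` ?P m"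
  have IH: "finite (?P m) \<and> card (?P m) = (n - m) choose card D" if "m \<in> {1..<Suc n}" for m
    using insert.IH[of "n - m"] that by (simp add: Suc_diff_le)
  have "card (?F m) = (n - m) choose card D" if "m \<in> {1..<Suc n}" for m
    using IH[OF that] inj_on_fun_upd_extensional[OF insert.hyps(2), of m]
    by (subst card_image) (auto intro: inj_on_subset)
  then have "(\<Sum>m\<in>{1..<Suc n}. card (?F m)) = (\<Sum>m\<in>{1..<Suc n}. (n - m) choose card D)"
    by simp
  also have "\<dots> = (\<Sum>k<n. k choose card D)"
    by (rule sum.reindex_bij_witness[of _ "\<lambda>k. n - k" "\<lambda>m. n - m"]) auto
  also have "\<dots> = n choose card (insert d D)"
    using insert.hyps sum_choose_upper[of "card D" "n - 1"] by (cases n) (simp_all add: lessThan_Suc_atMost)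
  finally have "(\<Sum>m\<in>{1..<Suc n}. card (?F m)) = n choose card (insert d D)" .
  moreover have "card (\<Union>m\<in>{1..<Suc n}. ?F m) = (\<Sum>m\<in>{1..<Suc n}. card (?F m))"
    using IH by (intro card_UN_disjoint) (auto dest: fun_upd_eqD)
  ultimately show ?case
    unfolding ext_pos_insert[OF insert.hyps(2,1)] using IH by simp
qed

text \<open>The falling factorial. Over the integers it has a factor 0 for \<open>d > n\<close>, in
  accordance with the vanishing binomial coefficient.\<close>

lemma fact_binomial_prod: "int (fact d * (n choose d)) = (\<Prod>j<d. int n - int j)"
proof -
  have "real (fact d * (n choose d)) = (\<Prod>j<d. real n - real j)"
    using gbinomial_mult_fact[of d "real n"] by (simp add: binomial_gbinomial atLeast0LessThan)
  also have "\<dots> = real_of_int (\<Prod>j<d. int n - int j)" by simp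
  finally show ?thesis by (metis of_int_eq_iff of_int_of_nat_eq)
qed

text \<open>Words are lists of booleans from here on, with \<open>True\<close> for an opening leaf.\<close>

fun height_product :: "int \<Rightarrow> bool list \<Rightarrow> int" where
  "height_product h [] = 1"
| "height_product h (True # w) = height_product (h + 1) w"
| "height_product h (False # w) = h * height_product (h - 1) w"

definition positions :: "bool \<Rightarrow> nat \<Rightarrow> bool list \<Rightarrow> nat set" where
  "positions b n w = {n + j | j. j < length w \<and> w ! j = b}"

lemma positions_simps [simp]:
  "positions b n [] = {}"
  "positions b n (c # w) = (if b = c then {n} else {}) \<union> positions b (Suc n) w"
proof -
  show "positions b n (c # w) = (if b = c then {n} else {}) \<union> positions b (Suc n) w"
    unfolding positions_def by (auto simp: less_Suc_eq_0_disj)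
qed (simp add: positions_def)

lemma positions_ge: "c \<in> positions b n w \<Longrightarrow> n \<le> c"
  by (auto simp: positions_def)

lemma finite_positions [simp]: "finite (positions b n w)"
  by (induction w arbitrary: n) auto

text \<open>Partial decorations: \<open>A\<close> are the opening leaves read so far that are still free, \<open>D\<close> the
  closing leaves read so far that belong to marked edges.\<close>

definition decorations_from ::
    "nat \<Rightarrow> nat \<Rightarrow> bool list \<Rightarrow> nat set \<Rightarrow> nat set \<Rightarrow> ((nat \<Rightarrow> nat) \<times> (nat \<Rightarrow> nat)) set" where
  "decorations_from i n w A D = {(f, \<mu>).
     (f \<in> extensional (D \<union> positions False n w) \<and>
      bij_betw f (D \<union> positions False n w) (A \<union> positions True n w)) \<and>
     \<mu> \<in> extensional (D \<union> positions False n w) \<and> (\<forall>c\<in>D. 0 < \<mu> c) \<and>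
     (\<forall>c\<in>positions False n w. \<mu> c = 0 \<longrightarrow> f c < c) \<and> sum \<mu> (D \<union> positions False n w) < i}"

lemma decorations_from_Nil:
  "decorations_from i n [] A D =
     {f \<in> extensional D. bij_betw f D A} \<times> {\<mu> \<in> extensional D. (\<forall>c\<in>D. 0 < \<mu> c) \<and> sum \<mu> D < i}"
  by (auto simp: decorations_from_def)

lemma decorations_from_True:
  "decorations_from i n (True # w) A D = decorations_from i (Suc n) w (insert n A) D"
  by (simp add: decorations_from_def)

text \<open>The closing leaf at \<open>n\<close> either belongs to a marked edge and joins
  \<open>D\<close>, or belongs to an unmarked edge and uses up a free opening leaf \<open>y\<close>.
  Whether \<mu> vanishes at \<open>n\<close> tells the two cases apart.\<close>

lemma decorations_from_False:
  assumes "A \<subseteq> {..<n}" "D \<subseteq> {..<n}"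
  shows "decorations_from i n (False # w) A D =
    decorations_from i (Suc n) w A (insert n D) \<union>
    (\<Union>y\<in>A. (\<lambda>(f, \<mu>). (f(n := y), \<mu>(n := 0))) ` decorations_from i (Suc n) w (A - {y}) D)"
    (is "?L = ?R1 \<union> ?R2")
proof -
  let ?C = "D \<union> positions False (Suc n) w" and ?O = "A \<union> positions True (Suc n) w"
  have n: "n \<notin> ?C" "n \<notin> ?O"
    using assms positions_ge[of n False "Suc n" w] positions_ge[of n True "Suc n" w] by auto
  have fin: "finite ?C" using assms finite_subset by auto
  have C: "D \<union> positions False n (False # w) = insert n ?C"
    "A \<union> positions True n (False # w) = ?O" by auto
  have upd: "sum (\<mu>(n := 0)) (insert n ?C) = sum \<mu> ?C" for \<mu> :: "nat \<Rightarrow> nat"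
  proof -
    have "sum (\<mu>(n := 0)) ?C = sum \<mu> ?C"
      by (rule sum.cong[OF refl]) (use n(1) in \<open>simp add: fun_upd_apply split: if_splits\<close>, blast)
    then show ?thesis
      unfolding sum.insert[OF fin n(1)] by simp
  qed
  show ?thesis
  proof (intro set_eqI iffI)
    fix p assume p: "p \<in> ?L"
    obtain f \<mu> where [simp]: "p = (f, \<mu>)" by fastforce
    note p = p[unfolded decorations_from_def C, simplified]
    show "p \<in> ?R1 \<union> ?R2"
    proof (cases "\<mu> n = 0")
      case True
      \<comment> \<open>An unmarked pair has its opening leaf first, and the available opening
        leaves before \<open>n\<close> are those in \<open>A\<close>.\<close>
      with p have "f n < n" by simp
      moreover from p have "f n \<in> ?O" by (auto simp: bij_betw_def)
      ultimately have A: "f n \<in> A"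
        using positions_ge[of "f n" True "Suc n" w] by auto
      have "f \<in> (\<Union>y\<in>?O. (\<lambda>g. g(n := y)) ` {g \<in> extensional ?C. bij_betw g ?C (?O - {y})})"
        unfolding ext_bij_insert[OF n(1), symmetric] using p by simp
      then obtain y g where g: "g \<in> extensional ?C" "bij_betw g ?C (?O - {y})" "f = g(n := y)"
        by blast
      then have y: "y = f n" by simp
      have "?O - {f n} = (A - {f n}) \<union> positions True (Suc n) w"
        using A assms positions_ge[of "f n" True "Suc n" w] by auto
      moreover define \<nu> where "\<nu> = restrict \<mu> ?C"
      have \<mu>: "\<mu> = \<nu>(n := 0)"
        using p True by (auto simp: fun_eq_iff extensional_def \<nu>_def)
      then have "sum \<nu> ?C < i" using p upd[of \<nu>] by simp
      moreover have "\<nu> \<in> extensional ?C" by (simp add: \<nu>_def)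
      moreover have "\<forall>c\<in>D. 0 < \<nu> c" "\<forall>c\<in>positions False (Suc n) w. \<nu> c = 0 \<longrightarrow> g c < c"
        using p n g(3) \<mu> by (auto split: if_splits)
      ultimately have "(g, \<nu>) \<in> decorations_from i (Suc n) w (A - {f n}) D"
        using g(1,2) y by (simp add: decorations_from_def)
      moreover have "p = (\<lambda>(f, \<mu>). (f(n := y), \<mu>(n := 0))) (g, \<nu>)"
        by (simp only: \<open>p = (f, \<mu>)\<close> g(3)[symmetric] \<mu>[symmetric] prod.case)
      ultimately have "p \<in> ?R2"
        unfolding y[symmetric] using A[folded y] by blast
      then show ?thesis by blast
    next
      case False
      then have "p \<in> ?R1"
        using p n by (auto simp: decorations_from_def)
      then show ?thesis by blast
    qed
  next
    fix p assume "p \<in> ?R1 \<union> ?R2"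
    then show "p \<in> ?L"
    proof
      assume p: "p \<in> ?R1"
      then show ?thesis by (auto simp: decorations_from_def)
    next
      assume "p \<in> ?R2"
      then obtain y g \<nu> where y: "y \<in> A" and g: "(g, \<nu>) \<in> decorations_from i (Suc n) w (A - {y}) D"
        and p: "p = (g(n := y), \<nu>(n := 0))" by auto
      have "?O - {y} = (A - {y}) \<union> positions True (Suc n) w"
        using y assms positions_ge[of y True "Suc n" w] by auto
      with g have "g \<in> extensional ?C \<and> bij_betw g ?C (?O - {y})"
        by (simp add: decorations_from_def)
      then have "g(n := y) \<in> {f \<in> extensional (insert n ?C). bij_betw f (insert n ?C) ?O}"
        unfolding ext_bij_insert[OF n(1)] using y by blast
      moreover have "\<nu>(n := 0) \<in> extensional (insert n ?C)"
        using g by (auto simp: decorations_from_def extensional_def)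
      moreover have "sum (\<nu>(n := 0)) (insert n ?C) < i"
        unfolding upd using g by (simp add: decorations_from_def)
      moreover have "y < n" using y assms by auto
      ultimately show "p \<in> ?L"
        unfolding p decorations_from_def C using g n by (auto simp: decorations_from_def)
    qed
  qed
qed

text \<open>With a free opening leaves and d leaves set aside, the next closing leaf has a possible
  matches, and setting it aside extends the product by the factor i - 1 - d. Both alternatives
  continue one level lower, and a + (i - 1 - d) is the current height. If this height is negative,
  then d exceeds i - 1 and the product already contains the factor 0, so the identity holds in the
  integers without a condition on heights.\<close>

lemma card_decorations_from:
  assumes "i \<ge> 1" "A \<subseteq> {..<n}" "D \<subseteq> {..<n}"
    and "card A + count_list w True = card D + count_list w False"
  shows "finite (decorations_from i n w A D) \<and>
    int (card (decorations_from i n w A D)) =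
      (\<Prod>j<card D. int (i - 1) - int j) * height_product (int (card A) + int (i - 1) - int (card D)) w"
  using assms(2-)
proof (induction w arbitrary: n A D)
  case Nil
  then have fin: "finite A" "finite D" using finite_subset by auto
  obtain i' where i': "i = Suc i'" using assms(1) by (cases i) auto
  \<comment> \<open>At the end of the word the balance assumption reads
    \<open>card A = card D\<close>, so that the leaves set aside can be matched with the leftover
    opening leaves in \<open>fact (card D)\<close> ways.\<close>
  show ?case
    using card_ext_bij[OF fin(2,1)] card_ext_pos[OF fin(2), of i'] Nil.prems(3) fact_binomial_prod[of "card D" i']
    by (simp add: decorations_from_Nil i' card_cartesian_product)
next
  case (Cons b w)
  have fin: "finite A" "finite D" using Cons.prems finite_subset by auto
  have n: "n \<notin> A" "n \<notin> D" using Cons.prems by auto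
  show ?case
  proof (cases b)
    case True
    have "finite (decorations_from i (Suc n) w (insert n A) D) \<and>
      int (card (decorations_from i (Suc n) w (insert n A) D)) =
      (\<Prod>j<card D. int (i - 1) - int j) *
      height_product (int (card (insert n A)) + int (i - 1) - int (card D)) w"
      using Cons.prems fin n True by (intro Cons.IH) auto
    then show ?thesis
      using True fin n by (simp add: decorations_from_True algebra_simps)
  next
    case False
    let ?h = "int (card A) + int (i - 1) - int (card D)"
    let ?P = "\<Prod>j<card D. int (i - 1) - int j"
    let ?R = "\<lambda>y. (\<lambda>(f, \<mu>). (f(n := y), \<mu>(n := 0))) ` decorations_from i (Suc n) w (A - {y}) D"
    have 1: "finite (decorations_from i (Suc n) w A (insert n D)) \<and>
      int (card (decorations_from i (Suc n) w A (insert n D))) =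
      (\<Prod>j<card (insert n D). int (i - 1) - int j) *
      height_product (int (card A) + int (i - 1) - int (card (insert n D))) w"
      using Cons.prems fin n False by (intro Cons.IH) auto
    then have 1: "finite (decorations_from i (Suc n) w A (insert n D))"
      "int (card (decorations_from i (Suc n) w A (insert n D))) =
        ?P * (int (i - 1) - int (card D)) * height_product (?h - 1) w"
      using fin n by (simp_all add: algebra_simps)
    have 2: "finite (decorations_from i (Suc n) w (A - {y}) D) \<and>
        int (card (decorations_from i (Suc n) w (A - {y}) D)) =
        ?P * height_product (int (card (A - {y})) + int (i - 1) - int (card D)) w" if "y \<in> A" for y
      using Cons.prems fin False that card_Suc_Diff1[OF fin(1) that]
      by (intro Cons.IH) auto
    have 2: "finite (?R y)" "int (card (?R y)) = ?P * height_product (?h - 1) w" if "y \<in> A" for y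
    proof -
      have "inj_on (\<lambda>(f, \<mu>). (f(n := y), \<mu>(n := 0 :: nat))) (decorations_from i (Suc n) w (A - {y}) D)"
      proof (rule inj_onI, clarify)
        fix f \<mu> f' \<mu>'
        assume *: "(f, \<mu>) \<in> decorations_from i (Suc n) w (A - {y}) D"
          "(f', \<mu>') \<in> decorations_from i (Suc n) w (A - {y}) D"
          "f(n := y) = f'(n := y)" "\<mu>(n := 0) = \<mu>'(n := 0)"
        let ?C = "D \<union> positions False (Suc n) w"
        have "n \<notin> ?C" using n positions_ge[of n False "Suc n" w] by auto
        moreover have "f \<in> extensional ?C" "f' \<in> extensional ?C" "\<mu> \<in> extensional ?C" "\<mu>' \<in> extensional ?C"
          using *(1,2) by (auto simp: decorations_from_def)
        ultimately show "f = f' \<and> \<mu> = \<mu>'"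
          using *(3,4) inj_onD[OF inj_on_fun_upd_extensional] by metis
      qed
      moreover have "int (card (A - {y})) + int (i - 1) - int (card D) = ?h - 1"
        using that fin card_Suc_Diff1[OF fin(1) that] by linarith
      ultimately show "finite (?R y)" "int (card (?R y)) = ?P * height_product (?h - 1) w"
        using 2[OF that] by (simp_all only: card_image finite_imageI)
    qed
    have "card (\<Union>y\<in>A. ?R y) = (\<Sum>y\<in>A. card (?R y))"
      using fin 2 by (intro card_UN_disjoint) (auto dest: fun_upd_eqD)
    then have 3: "int (card (\<Union>y\<in>A. ?R y)) = int (card A) * (?P * height_product (?h - 1) w)"
      using 2(2) by (simp del: UN_simps)
    have "\<mu> n = 0" if "(f, \<mu>) \<in> (\<Union>y\<in>A. ?R y)" for f \<mu>
      using that by auto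
    moreover have "\<mu> n > 0" if "(f, \<mu>) \<in> decorations_from i (Suc n) w A (insert n D)" for f \<mu>
      using that by (simp add: decorations_from_def)
    ultimately have "decorations_from i (Suc n) w A (insert n D) \<inter> (\<Union>y\<in>A. ?R y) = {}"
      by fastforce
    moreover have "finite (\<Union>y\<in>A. ?R y)" using fin 2 by blast
    ultimately have "card (decorations_from i (Suc n) w A (insert n D) \<union> (\<Union>y\<in>A. ?R y)) =
        card (decorations_from i (Suc n) w A (insert n D)) + card (\<Union>y\<in>A. ?R y)"
      using 1 by (intro card_Un_disjoint)
    then have "int (card (decorations_from i n (False # w) A D)) = ?P * (?h * height_product (?h - 1) w)"
      unfolding decorations_from_False[OF Cons.prems(1,2)] by (simp only: of_nat_add 1 3) (simp add: algebra_simps)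
    then show ?thesis
      using False 1 2 fin by (simp add: decorations_from_False[OF Cons.prems(1,2)])
  qed
qed

text \<open>In a decoration \<open>(f, \<mu>)\<close>, the closing leaf at position \<open>c\<close> is matched with the opening leaf
  at position \<open>f c\<close>; \<open>\<mu> c\<close> is the multiplicity of this edge, with \<open>0\<close> for an unmarked one.\<close>

definition decorations :: "nat \<Rightarrow> bool list \<Rightarrow> ((nat \<Rightarrow> nat) \<times> (nat \<Rightarrow> nat)) set" where
  "decorations i w = {(f, \<mu>).
     f \<in> extensional {c. c < length w \<and> \<not> w ! c} \<and>
     bij_betw f {c. c < length w \<and> \<not> w ! c} {c. c < length w \<and> w ! c} \<and>
     \<mu> \<in> extensional {c. c < length w \<and> \<not> w ! c} \<and>
     (\<forall>c. c < length w \<and> \<not> w ! c \<and> \<mu> c = 0 \<longrightarrow> f c < c) \<and> sum \<mu> {c. c < length w \<and> \<not> w ! c} < i}"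

lemma card_decorations:
  assumes "i \<ge> 1" "count_list w True = count_list w False"
  shows "finite (decorations i w)" "int (card (decorations i w)) = height_product (int (i - 1)) w"
proof -
  have "positions b 0 w = {c. c < length w \<and> w ! c = b}" for b
    by (auto simp: positions_def)
  then have "decorations i w = decorations_from i 0 w {} {}"
    by (auto simp: decorations_from_def decorations_def)
  then show "finite (decorations i w)" "int (card (decorations i w)) = height_product (int (i - 1)) w"
    using card_decorations_from[of i "{}" 0 "{}" w] assms by auto
qed

section \<open>Fibres over a tree shape\<close>

definition shape :: "'a blossom \<Rightarrow> unit blossom" where
  "shape = map_blossom (\<lambda>_. ())"

lemma shape_simps [simp]:
  "shape Opening = Opening" "shape (Closing a) = Closing ()" "shape (Node ts) = Node (map shape ts)"
  by (simp_all add: shape_def)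

lemma shape_Opening [simp]: "shape t = Opening \<longleftrightarrow> t = Opening"
  by (cases t) auto

lemma leaf_word_shape: "leaf_word (shape t) = map (map_option (\<lambda>_. ())) (leaf_word t)"
  by (induction t) (auto simp: map_concat intro!: arg_cong[of _ _ concat])

lemma eulerian_nodes_shape: "eulerian_nodes (shape t) \<longleftrightarrow> eulerian_nodes t"
proof (induction t)
  case (Node ts)
  have "count_list (map shape ts) Opening = count_list ts Opening"
    by (induction ts) auto
  then show ?case using Node by auto
qed auto

lemma node_degrees_shape: "node_degrees (shape t) = node_degrees t"
  by (induction t) (auto intro!: arg_cong[of _ _ concat])

text \<open>The shape fixes the lengths of the leaf words of the children, so the common word can be
  cut back into theirs.\<close>

lemma shape_leaf_word_inject:
  "shape t = shape t' \<Longrightarrow> leaf_word t = leaf_word t' \<Longrightarrow> t = t'"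
proof (induction t arbitrary: t')
  case (Node ts)
  then obtain ts' where t': "t' = Node ts'" by (cases t') auto
  have "ts = ts'" if "\<And>t t'. t \<in> set ts \<Longrightarrow> shape t = shape t' \<Longrightarrow> leaf_word t = leaf_word t' \<Longrightarrow> t = t'"
    "map shape ts = map shape ts'" "concat (map leaf_word ts) = concat (map leaf_word ts')"
    for ts ts' :: "'a blossom list"
    using that
  proof (induction ts arbitrary: ts')
    case (Cons t ts)
    then obtain u us where ts': "ts' = u # us" by (cases ts') auto
    with Cons.prems have sh: "shape t = shape u" by simp
    then have "length (leaf_word t) = length (leaf_word u)"
      by (metis leaf_word_shape length_map)
    then show ?case using Cons ts' sh by auto
  qed auto
  then show ?case using Node t' by auto
next
  case Opening
  then show ?case by (cases t') auto
next
  case (Closing a)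
  then show ?case by (cases t') auto
qed

lemma shape_leaf_word_exists:
  fixes w :: "'a option list"
  shows "map (map_option (\<lambda>_. ())) w = leaf_word t \<Longrightarrow> \<exists>t'. shape t' = t \<and> leaf_word t' = w"
proof (induction t arbitrary: w)
  case Opening
  then show ?case by (intro exI[of _ Opening]) auto
next
  case (Closing a)
  then obtain b where "w = [Some b]" by auto
  then show ?case by (intro exI[of _ "Closing b"]) auto
next
  case (Node ts)
  have "\<exists>ts'. map shape ts' = ts \<and> concat (map leaf_word ts') = w"
    if "\<And>t (w :: 'a option list). t \<in> set ts \<Longrightarrow> map (map_option (\<lambda>_. ())) w = leaf_word t \<Longrightarrow> \<exists>t'. shape t' = t \<and> leaf_word t' = w"
      "map (map_option (\<lambda>_. ())) w = concat (map leaf_word ts)"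
    for ts and w :: "'a option list"
    using that
  proof (induction ts arbitrary: w)
    case (Cons t ts)
    from Cons.prems(2) obtain u v where w: "w = u @ v"
      "map (map_option (\<lambda>_. ())) u = leaf_word t" "map (map_option (\<lambda>_. ())) v = concat (map leaf_word ts)"
      by (auto simp: map_eq_append_conv)
    obtain t' where "shape t' = t" "leaf_word t' = u" using Cons.prems(1)[of t u] w by auto
    moreover obtain ts' where "map shape ts' = ts" "concat (map leaf_word ts') = v"
      using Cons.IH[OF Cons.prems(1), of v] w by auto
    ultimately show ?case using w by (intro exI[of _ "t' # ts'"]) auto
  qed auto
  from this[of ts w] Node obtain ts' where "map shape ts' = ts" "concat (map leaf_word ts') = w" by auto
  then show ?case by (intro exI[of _ "Node ts'"]) auto
qed

text \<open>A closing leaf at height \<open>h\<close> has \<open>h\<close> labels. For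
  \<open>h = 0\<close> both sides vanish, so the induction never has to continue at a negative
  height.\<close>

lemma card_labelled_words:
  assumes "0 \<le> h"
  shows "finite {w. map (map_option (\<lambda>_. ())) w = w0 \<and> labelled h w} \<and>
    int (card {w. map (map_option (\<lambda>_. ())) w = w0 \<and> labelled h w}) =
      height_product h (map (\<lambda>l. l = None) w0)"
  using assms
proof (induction w0 arbitrary: h)
  case Nil
  have "{w. map (map_option (\<lambda>_. ())) w = [] \<and> labelled h w} = {[]}" by auto
  then show ?case by simp
next
  case (Cons l w0)
  let ?W = "\<lambda>h. {w. map (map_option (\<lambda>_. ())) w = w0 \<and> labelled h w}"
  show ?case
  proof (cases l)
    case None
    then have "{w. map (map_option (\<lambda>_. ())) w = l # w0 \<and> labelled h w} = (#) None ` ?W (h + 1)"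
      by (auto simp: map_eq_Cons_conv image_iff)
    then show ?thesis using Cons.IH[of "h + 1"] Cons.prems None by (simp add: card_image)
  next
    case (Some a)
    then have eq: "{w. map (map_option (\<lambda>_. ())) w = l # w0 \<and> labelled h w} =
        (\<lambda>(a, w). Some a # w) ` ({0..<h} \<times> ?W (h - 1))"
      by (auto simp: map_eq_Cons_conv image_iff)
    have "inj_on (\<lambda>(a, w). Some a # w) ({0..<h} \<times> ?W (h - 1))"
      by (auto simp: inj_on_def)
    then show ?thesis
      unfolding eq using Cons.IH[of "h - 1"] Cons.prems Some
      by (cases "h = 0") (auto simp: card_image card_cartesian_product)
  qed
qed

text \<open>The excess -1 of the tree is compensated by the root half-edge, prepended as
  \<open>True\<close>.\<close>

lemma balanced_leaf_word:
  assumes "t \<in> range Node" "eulerian_nodes t"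
  shows "count_list (True # map (\<lambda>l. l = None) (leaf_word t)) True =
    count_list (True # map (\<lambda>l. l = None) (leaf_word t)) False"
proof -
  have "int (count_list (map (\<lambda>l. l = None) w) True) - int (count_list (map (\<lambda>l. l = None) w) False) = excess w"
    for w :: "'a option list"
    by (induction w) (auto simp: excess_def)
  from this[of "leaf_word t"] show ?thesis
    using excess_eulerian[of t] assms by auto
qed

text \<open>The first component of a code is the shape of the exploration tree of a map, the others describe
  the edges outside this tree; the root half-edge is the opening leaf at position \<open>0\<close>.\<close>

definition codes :: "nat \<Rightarrow> (unit blossom \<times> (nat \<Rightarrow> nat) \<times> (nat \<Rightarrow> nat)) set" where
  "codes i = (SIGMA t:{t \<in> range Node. eulerian_nodes t}. decorations i (True # map (\<lambda>l. l = None) (leaf_word t)))"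

text \<open>Both sets are counted by \<open>height_product\<close>; reading the prepended
  \<open>True\<close> raises the start height from \<open>i - 1\<close> to \<open>i\<close>.\<close>

lemma card_enriched_shape:
  assumes "i \<ge> 1" "t \<in> range Node" "eulerian_nodes t"
  shows "finite {u \<in> enriched_trees i. shape u = t}"
    and "card {u \<in> enriched_trees i. shape u = t} = card (decorations i (True # map (\<lambda>l. l = None) (leaf_word t)))"
proof -
  let ?W = "{w. map (map_option (\<lambda>_. ())) w = leaf_word t \<and> labelled (int i) w}"
  have "bij_betw leaf_word {u \<in> enriched_trees i. shape u = t} ?W"
    unfolding bij_betw_def
  proof
    show "inj_on leaf_word {u \<in> enriched_trees i. shape u = t}"
      by (rule inj_onI) (metis (mono_tags, lifting) mem_Collect_eq shape_leaf_word_inject)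
    have enr: "u \<in> enriched_trees i \<longleftrightarrow> labelled (int i) (leaf_word u)" if "shape u = t" for u
      using assms(2,3) that eulerian_nodes_shape[of u]
      by (cases u) (auto simp: enriched_trees_alt enriched_def enriched_iff)
    show "leaf_word ` {u \<in> enriched_trees i. shape u = t} = ?W"
    proof (intro set_eqI iffI)
      fix w assume w: "w \<in> ?W"
      then obtain u where "shape u = t" "leaf_word u = w"
        using shape_leaf_word_exists by blast
      then show "w \<in> leaf_word ` {u \<in> enriched_trees i. shape u = t}"
        using enr w by auto
    qed (auto simp: enr leaf_word_shape[symmetric])
  qed
  then have "finite {u \<in> enriched_trees i. shape u = t}"
    "int (card {u \<in> enriched_trees i. shape u = t}) = height_product (int i) (map (\<lambda>l. l = None) (leaf_word t))"
    using card_labelled_words[of "int i" "leaf_word t"] bij_betw_finite bij_betw_same_card by fastforce+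
  moreover have "int (card (decorations i (True # map (\<lambda>l. l = None) (leaf_word t)))) =
      height_product (int (i - 1)) (True # map (\<lambda>l. l = None) (leaf_word t))"
    using assms by (intro card_decorations balanced_leaf_word) auto
  moreover have "int (i - 1) + 1 = int i" using assms(1) by simp
  ultimately have "finite {u \<in> enriched_trees i. shape u = t}"
    "int (card {u \<in> enriched_trees i. shape u = t}) =
      int (card (decorations i (True # map (\<lambda>l. l = None) (leaf_word t))))"
    by simp_all
  then show "finite {u \<in> enriched_trees i. shape u = t}"
    "card {u \<in> enriched_trees i. shape u = t} = card (decorations i (True # map (\<lambda>l. l = None) (leaf_word t)))"
    by (simp_all only: of_nat_eq_iff)
qed

text \<open>Over each shape, two finite sets of equal size admit a bijection, and choice glues these
  together. Keeping the shape as first component is what preserves the degree statistics.\<close>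

lemma enriched_trees_codes:
  assumes "i \<ge> 1"
  obtains g where "bij_betw g (enriched_trees i) (codes i)" "\<And>u. u \<in> enriched_trees i \<Longrightarrow> fst (g u) = shape u"
proof -
  let ?T = "{t \<in> range Node. eulerian_nodes t} :: unit blossom set"
  let ?U = "\<lambda>t. {u \<in> enriched_trees i. shape u = t}"
  let ?D = "\<lambda>t. decorations i (True # map (\<lambda>l. l = None) (leaf_word t))"
  have "\<exists>g. bij_betw g (?U t) (?D t)" if "t \<in> ?T" for t :: "unit blossom"
  proof (rule finite_same_card_bij)
    have "card (?U t) = card (?D t)" "finite (?U t)"
      using card_enriched_shape assms that by auto
    then show "finite (?U t)" "card (?U t) = card (?D t)" by auto
    show "finite (?D t)"
      using that by (intro card_decorations(1)[OF assms] balanced_leaf_word) auto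
  qed
  then have "\<forall>t\<in>?T. \<exists>g. bij_betw g (?U t) (?D t)" by blast
  from bchoice[OF this] obtain g where "\<forall>t\<in>?T. bij_betw (g t) (?U t) (?D t)" ..
  then have g: "\<And>t. t \<in> ?T \<Longrightarrow> bij_betw (g t) (?U t) (?D t)" by (rule bspec)
  have shape: "shape u \<in> ?T" if "u \<in> enriched_trees i" for u
  proof -
    have "u \<in> range Node" "eulerian_nodes u"
      using that by (auto simp: enriched_trees_alt enriched_def enriched_iff)
    moreover from this have "shape u \<in> range Node" by auto
    ultimately show ?thesis by (simp only: mem_Collect_eq eulerian_nodes_shape)
  qed
  define G where "G u = (shape u, g (shape u) u)" for u
  have "bij_betw G (enriched_trees i) (codes i)"
    unfolding bij_betw_def
  proof
    show "inj_on G (enriched_trees i)"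
    proof (rule inj_onI)
      fix u v assume *: "u \<in> enriched_trees i" "v \<in> enriched_trees i" "G u = G v"
      then have "inj_on (g (shape u)) (?U (shape u))"
        using g[OF shape[OF *(1)]] bij_betw_imp_inj_on by blast
      moreover have 1: "shape u = shape v \<and> g (shape u) u = g (shape v) v"
        using *(3) unfolding G_def prod.inject .
      then have "g (shape u) u = g (shape u) v" by metis
      ultimately show "u = v"
        by (intro inj_onD[of "g (shape u)" "?U (shape u)"]) (use * 1 in simp_all)
    qed
    show "G ` enriched_trees i = codes i"
    proof (intro set_eqI iffI)
      fix x assume "x \<in> codes i"
      then obtain t d where x: "x = (t, d)" "t \<in> ?T" "d \<in> ?D t" by (auto simp: codes_def)
      then have "d \<in> g t ` ?U t"
        using bij_betw_imp_surj_on[OF g[OF x(2)]] by blast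
      then obtain u where "u \<in> ?U t" "d = g t u" by blast
      then show "x \<in> G ` enriched_trees i" using x by (auto simp: G_def)
    next
      fix x assume "x \<in> G ` enriched_trees i"
      then obtain u where u: "u \<in> enriched_trees i" "x = G u" by auto
      then have "g (shape u) u \<in> ?D (shape u)"
        using bij_betwE[OF g[OF shape[OF u(1)]]] by simp
      then show "x \<in> codes i" using shape[OF u(1)] u by (auto simp: G_def codes_def)
    qed
  qed
  then show thesis by (rule that) (simp add: G_def)
qed

section \<open>Exploration of a map\<close>

text \<open>For a vertex of degree \<open>n + 1\<close> entered through \<open>x\<close>, these are
  its other half-edges, in the order of the children of a node.\<close>

definition turn :: "('h, 'm) rooted_map_scheme \<Rightarrow> nat \<Rightarrow> 'h \<Rightarrow> 'h list" where
  "turn M n x = map (\<lambda>j. (rot M ^^ Suc j) x) [0..<n]"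

lemma length_turn [simp]: "length (turn M n x) = n"
  by (simp add: turn_def)

lemma nth_turn [simp]: "j < n \<Longrightarrow> turn M n x ! j = (rot M ^^ Suc j) x"
  by (simp add: turn_def)

lemma Cons_turn: "x # turn M n x = map (\<lambda>k. (rot M ^^ k) x) [0..<Suc n]"
  unfolding turn_def map_upt_Suc by simp

text \<open>The half-edges met when the forest \<open>ts\<close> is unfolded in \<open>M\<close> from the half-edges \<open>s\<close>.\<close>

fun visited :: "('h, 'm) rooted_map_scheme \<Rightarrow> 'h list \<Rightarrow> 'a blossom list \<Rightarrow> 'h list" where
  "visited M (h # s) (Node us # ts) =
     h # opp M h # visited M (turn M (length us) (opp M h)) us @ visited M s ts"
| "visited M (h # s) (t # ts) = h # visited M s ts"
| "visited M s ts = []"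

text \<open>Depth-first exploration of \<open>M\<close> with orientation \<open>A\<close>: \<open>s\<close> is the stack of pending half-edges,
  \<open>F\<close> the set of the half-edges whose edge is marked or has been met before. An edge that is first met
  at its tail becomes an opening leaf, one that is first met at its head leads to a new node.\<close>

inductive explores ::
    "('h, 'm) rooted_map_scheme \<Rightarrow> 'h set \<Rightarrow> 'h set \<Rightarrow> 'h list \<Rightarrow> unit blossom list \<Rightarrow> bool"
  for M A where
  Nil: "explores M A F [] []"
| Opening: "h \<in> A \<Longrightarrow> explores M A (F \<union> {h, opp M h}) s ts \<Longrightarrow> explores M A F (h # s) (Opening # ts)"
| Closing: "h \<notin> A \<Longrightarrow> h \<in> F \<Longrightarrow> explores M A (F \<union> {h, opp M h}) s ts \<Longrightarrow>
    explores M A F (h # s) (Closing () # ts)"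
| Node: "h \<notin> A \<Longrightarrow> h \<notin> F \<Longrightarrow> (rot M ^^ Suc (length us)) (opp M h) = opp M h \<Longrightarrow>
    explores M A (F \<union> {h, opp M h}) (turn M (length us) (opp M h) @ s) (us @ ts) \<Longrightarrow>
    explores M A F (h # s) (Node us # ts)"

lemma visited_append:
  "length s = length ts \<Longrightarrow> visited M (s @ s') (ts @ ts') = visited M s ts @ visited M s' ts'"
  by (induction M s ts rule: visited.induct) auto

lemma set_visited: "length s = length ts \<Longrightarrow> set s \<subseteq> set (visited M s ts)"
  by (induction M s ts rule: visited.induct) auto

lemma distinct_visited: "length s = length ts \<Longrightarrow> distinct (visited M s ts) \<Longrightarrow> distinct s"
proof (induction M s ts rule: visited.induct)
  case (1 M h s us ts)
  then show ?case using set_visited[of s ts M] by auto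
next
  case ("2_1" M h s ts)
  then show ?case using set_visited[of s ts M] by auto
next
  case ("2_2" M h s a ts)
  then show ?case using set_visited[of s ts M] by auto
qed auto

lemma explores_length: "explores M A F s ts \<Longrightarrow> length s = length ts"
  by (induction rule: explores.induct) auto

locale rmap =
  fixes M :: "('h, 'm) rooted_map_scheme"
  assumes rm: "rooted_map M"
begin

lemma finite_half_edges: "finite (half_edges M)"
  and rot_permutes: "rot M permutes half_edges M"
  and opp_permutes: "opp M permutes half_edges M"
  and root_in: "root_half_edge M \<in> half_edges M"
  and opp_neq: "h \<in> half_edges M \<Longrightarrow> opp M h \<noteq> h"
  using rm by (auto simp: rooted_map_def)

lemma opp_opp [simp]: "opp M (opp M h) = h"
proof (cases "h \<in> half_edges M")
  case False
  then show ?thesis using permutes_not_in[OF opp_permutes] by simp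
qed (use rm in \<open>auto simp: rooted_map_def\<close>)

lemma opp_in [simp]: "opp M h \<in> half_edges M \<longleftrightarrow> h \<in> half_edges M"
  by (rule permutes_in_image[OF opp_permutes])

lemma opp_eq_iff [simp]: "opp M g = opp M h \<longleftrightarrow> g = h"
  by (metis opp_opp)

lemma rot_permutation: "permutation (rot M)"
  using rot_permutes finite_half_edges by (auto simp: permutation_permutes)

lemma self_in_vertex [simp]: "h \<in> vertex_of M h"
  unfolding vertex_of_def by (rule permutation_self_in_orbit[OF rot_permutation])

lemma vertex_of_subset: "h \<in> half_edges M \<Longrightarrow> vertex_of M h \<subseteq> half_edges M"
  unfolding vertex_of_def by (rule permutes_orbit_subset[OF rot_permutes])

lemma vertex_of_eq: "g \<in> vertex_of M h \<Longrightarrow> vertex_of M g = vertex_of M h"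
  unfolding vertex_of_def
  by (rule orbit_cyclic_eq3[OF cyclic_on_orbit[OF rot_permutes finite_half_edges]])

text \<open>\<open>Suc n\<close> may be any period of \<open>x\<close>: running through a multiple
  of the degree only repeats half-edges. Minimality is obtained later from the distinctness of the
  visits.\<close>

lemma vertex_of_turn:
  assumes "(rot M ^^ Suc n) x = x"
  shows "vertex_of M x = set (x # turn M n x)"
proof -
  have "vertex_of M x = {(rot M ^^ m) x |m. m < Suc n}"
    unfolding vertex_of_def by (rule orbit_altdef_bounded[OF assms]) (rule zero_less_Suc)
  also have "\<dots> = (\<lambda>m. (rot M ^^ m) x) ` {0..<Suc n}"
    unfolding image_def by (rule Collect_cong) (simp only: Bex_def atLeastLessThan_iff, blast)
  also have "\<dots> = set (x # turn M n x)"
    unfolding Cons_turn set_map set_upt ..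
  finally show ?thesis .
qed

lemma turn_exists:
  assumes "n = card (vertex_of M x) - 1"
  shows "(rot M ^^ Suc n) x = x" "distinct (x # turn M n x)"
proof -
  let ?d = "funpow_dist1 (rot M) x x"
  have self: "x \<in> orbit (rot M) x"
    unfolding vertex_of_def[symmetric] by (rule self_in_vertex)
  have inj: "inj_on (\<lambda>k. (rot M ^^ k) x) {0..<?d}"
    by (rule inj_on_funpow_dist1[OF self])
  have "card (vertex_of M x) = ?d"
    
  proof -
    have "vertex_of M x = (\<lambda>k. (rot M ^^ k) x) ` {0..<?d}"
      using orbit_conv_funpow_dist1[OF self] by (simp only: vertex_of_def)
    then show ?thesis using card_image[OF inj] by simp
  qed
  then have d: "?d = Suc n" using assms by simp
  show "(rot M ^^ Suc n) x = x"
    using funpow_dist1_prop[OF self] unfolding d .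
  then show "distinct (x # turn M n x)"
    using inj[unfolded d] by (simp only: Cons_turn distinct_map set_upt distinct_upt simp_thms)
qed

section \<open>Cuts and their boundaries\<close>

text \<open>Vertex sets, each given by the half-edges incident to it.\<close>

definition rot_closed :: "'h set \<Rightarrow> bool" where
  "rot_closed Y \<longleftrightarrow> Y \<subseteq> half_edges M \<and> (\<forall>g\<in>Y. vertex_of M g \<subseteq> Y)"

text \<open>A cut is seen from the side of \<open>Y\<close>: a boundary half-edge in
  \<open>A\<close> is an edge that leaves \<open>Y\<close>.\<close>

definition boundary :: "'h set \<Rightarrow> 'h set" where
  "boundary Y = {g \<in> Y. opp M g \<notin> Y}"

lemma rot_closed_vertex: "h \<in> half_edges M \<Longrightarrow> rot_closed (vertex_of M h)"
  unfolding rot_closed_def by (intro conjI ballI vertex_of_subset equalityD1 vertex_of_eq)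

lemma rot_closed_Diff: "rot_closed Y \<Longrightarrow> rot_closed Z \<Longrightarrow> rot_closed (Y - Z)"
  unfolding rot_closed_def
proof (intro conjI ballI subsetI)
  fix g x
  assume *: "Y \<subseteq> half_edges M \<and> (\<forall>g\<in>Y. vertex_of M g \<subseteq> Y)"
    "Z \<subseteq> half_edges M \<and> (\<forall>g\<in>Z. vertex_of M g \<subseteq> Z)" and g: "g \<in> Y - Z" and x: "x \<in> vertex_of M g"
  have "g \<in> vertex_of M x" using vertex_of_eq[OF x] self_in_vertex[of g] by simp
  then show "x \<in> Y - Z" using * g x by blast
qed auto

lemma orientationD:
  assumes "eulerian_orientation M A"
  shows "A \<subseteq> half_edges M" "h \<in> half_edges M \<Longrightarrow> opp M h \<in> A \<longleftrightarrow> h \<notin> A"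
  using assms unfolding eulerian_orientation_def orientation_def by blast+

lemma finite_boundary: "rot_closed Y \<Longrightarrow> finite (boundary Y)"
  by (rule finite_subset[OF _ finite_half_edges]) (auto simp: rot_closed_def boundary_def)

lemma card_rot_closed:
  assumes A: "eulerian_orientation M A" and Y: "rot_closed Y"
  shows "2 * card (Y \<inter> A) = card Y"
proof -
  let ?V = "vertex_of M ` Y"
  have fin: "finite Y" using Y finite_half_edges finite_subset by (auto simp: rot_closed_def)
  have un: "Y = \<Union>?V" using Y by (auto simp: rot_closed_def)
  have disj: "pairwise disjnt ?V"
  proof (rule pairwiseI, elim imageE, hypsubst)
    fix g h assume "vertex_of M g \<noteq> vertex_of M h"
    then show "disjnt (vertex_of M g) (vertex_of M h)"
      using vertex_of_eq[of _ g] vertex_of_eq[of _ h] unfolding disjnt_iff by metis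
  qed
  have fin': "finite v" if "v \<in> ?V" for v
    using that fin Y finite_subset by (auto simp: rot_closed_def)
  have "card Y = (\<Sum>v\<in>?V. card v)"
    by (subst un, rule card_Union_disjoint) (use disj fin' in auto)
  also have "\<dots> = (\<Sum>v\<in>?V. 2 * card (v \<inter> A))"
    using A Y by (intro sum.cong) (auto simp: eulerian_orientation_def vertices_def rot_closed_def)
  also have "\<dots> = 2 * (\<Sum>v\<in>?V. card (v \<inter> A))" by (simp add: sum_distrib_left)
  also have "(\<Sum>v\<in>?V. card (v \<inter> A)) = card (\<Union>v\<in>?V. v \<inter> A)"
  proof (rule card_UN_disjoint[symmetric])
    show "\<forall>v\<in>?V. \<forall>w\<in>?V. v \<noteq> w \<longrightarrow> v \<inter> A \<inter> (w \<inter> A) = {}"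
      using disj by (auto simp: pairwise_def disjnt_def)
  qed (use fin fin' in auto)
  also have "(\<Union>v\<in>?V. v \<inter> A) = Y \<inter> A" using un by auto
  finally show ?thesis by simp
qed

text \<open>An inner edge of \<open>Y\<close> has exactly one tail in \<open>Y\<close>; subtracting
  the inner edges from the degree balance of \<open>Y\<close> leaves a balanced boundary.\<close>

lemma card_boundary:
  assumes A: "eulerian_orientation M A" and Y: "rot_closed Y"
  shows "2 * card (boundary Y \<inter> A) = card (boundary Y)"
proof -
  have YH: "Y \<subseteq> half_edges M" using Y by (simp add: rot_closed_def)
  then have fin: "finite Y" using finite_half_edges finite_subset by blast
  let ?I = "Y - boundary Y"
  have "bij_betw (opp M) (?I \<inter> A) (?I - A)"
    by (rule bij_betw_byWitness[of _ "opp M"])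
      (use YH orientationD[OF A] in \<open>auto simp: boundary_def subset_iff\<close>)
  then have "card (?I \<inter> A) = card (?I - A)" by (rule bij_betw_same_card)
  moreover have "card ?I = card (?I \<inter> A) + card (?I - A)"
    using fin by (subst card_Un_disjoint[symmetric]) (auto intro: arg_cong[of _ _ card])
  moreover have "card Y = card (boundary Y) + card ?I"
    using fin by (subst card_Un_disjoint[symmetric]) (auto simp: boundary_def intro: arg_cong[of _ _ card])
  moreover have "card (Y \<inter> A) = card (boundary Y \<inter> A) + card (?I \<inter> A)"
    using fin by (subst card_Un_disjoint[symmetric]) (auto simp: boundary_def intro: arg_cong[of _ _ card])
  ultimately show ?thesis using card_rot_closed[OF A Y] by simp
qed

text \<open>Whether a cut is a directed cut only depends on the outdegrees and on the frozen edges.\<close>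

lemma card_free_boundary:
  assumes A: "eulerian_orientation M A" and B: "eulerian_orientation M B"
    and Y: "rot_closed Y" and F: "A \<inter> F = B \<inter> F"
  shows "card ((boundary Y - F) \<inter> A) = card ((boundary Y - F) \<inter> B)"
proof -
  have fin: "finite (boundary Y)"
    by (rule finite_boundary[OF Y])
  have "card (boundary Y \<inter> X) = card (boundary Y \<inter> (X \<inter> F)) + card ((boundary Y - F) \<inter> X)" for X
    using fin by (subst card_Un_disjoint[symmetric]) (auto intro: arg_cong[of _ _ card])
  from this[of A] this[of B] show ?thesis
    using card_boundary[OF A Y] card_boundary[OF B Y] F by simp
qed

text \<open>A free boundary is entirely outgoing if and only if the number of its outgoing
  half-edges is maximal, and this number is the same for \<open>A\<close> and
  \<open>B\<close>.\<close>

lemma directed_cut_transfer: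
  assumes "eulerian_orientation M A" "eulerian_orientation M B" "rot_closed Y" "A \<inter> F = B \<inter> F"
    and "boundary Y - F \<subseteq> A"
  shows "boundary Y - F \<subseteq> B"
proof -
  have fin: "finite (boundary Y - F)"
    using finite_boundary[OF assms(3)] by blast
  have "card ((boundary Y - F) \<inter> B) = card (boundary Y - F)"
    using card_free_boundary[OF assms(1-4)] assms(5) by (simp add: Int_absorb2)
  then have "(boundary Y - F) \<inter> B = boundary Y - F"
    using fin by (intro card_subset_eq) auto
  then show ?thesis by blast
qed

section \<open>Uniqueness of the exploration tree\<close>

text \<open>A head that is not frozen at the start is either crossed, which visits its opposite at
  once, or becomes a closing leaf because its edge was met earlier in the same prefix. The statement
  is about prefixes because the children of a node are pushed onto the pending stack.\<close>

lemma explores_prefix: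
  assumes "explores M A F s ts" "s = s1 @ s2" "ts = ts1 @ ts2" "length s1 = length ts1"
    and "g \<in> set (visited M s1 ts1)" "g \<notin> F" "g \<notin> A"
  shows "opp M g \<in> set (visited M s1 ts1)"
  using assms
proof (induction arbitrary: s1 ts1 rule: explores.induct)
  case (Opening h F s ts)
  then obtain s1' ts1' where *: "s1 = h # s1'" "ts1 = Opening # ts1'" "s = s1' @ s2" "ts = ts1' @ ts2"
    "length s1' = length ts1'"
    by (cases s1; cases ts1) auto
  with Opening show ?case by (cases "g \<in> {h, opp M h}") auto
next
  case (Closing h F s ts)
  then obtain s1' ts1' where *: "s1 = h # s1'" "ts1 = Closing () # ts1'" "s = s1' @ s2" "ts = ts1' @ ts2"
    "length s1' = length ts1'"
    by (cases s1; cases ts1) auto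
  with Closing show ?case by (cases "g \<in> {h, opp M h}") auto
next
  case (Node h F us s ts)
  then obtain s1' ts1' where *: "s1 = h # s1'" "ts1 = Node us # ts1'" "s = s1' @ s2" "ts = ts1' @ ts2"
    "length s1' = length ts1'"
    by (cases s1; cases ts1) auto
  show ?case
  proof (cases "g \<in> {h, opp M h}")
    case False
    then have "opp M g \<in> set (visited M (turn M (length us) (opp M h) @ s1') (us @ ts1'))"
      using Node.prems * by (intro Node.IH) (auto simp: visited_append)
    then show ?thesis using * by (auto simp: visited_append)
  qed (use * in auto)
qed auto

text \<open>Crossing an edge brings in the whole new vertex, its remaining half-edges by
  \<open>turn\<close>. Only half-edges of the initial stack may belong to vertices entered
  before.\<close>

lemma explores_closed:
  assumes "explores M A F s ts" "s = s1 @ s2" "ts = ts1 @ ts2" "length s1 = length ts1"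
    and "distinct (visited M s1 ts1)" "g \<in> set (visited M s1 ts1) - set s1"
  shows "vertex_of M g \<subseteq> set (visited M s1 ts1) - set s1"
  using assms
proof (induction arbitrary: s1 ts1 rule: explores.induct)
  case (Opening h F s ts)
  then obtain s1' ts1' where *: "s1 = h # s1'" "ts1 = Opening # ts1'" "s = s1' @ s2" "ts = ts1' @ ts2"
    "length s1' = length ts1'"
    by (cases s1; cases ts1) auto
  then have "vertex_of M g \<subseteq> set (visited M s1' ts1') - set s1'"
    using Opening.prems by (intro Opening.IH) auto
  then show ?case using * Opening.prems by auto
next
  case (Closing h F s ts)
  then obtain s1' ts1' where *: "s1 = h # s1'" "ts1 = Closing () # ts1'" "s = s1' @ s2" "ts = ts1' @ ts2"
    "length s1' = length ts1'"
    by (cases s1; cases ts1) auto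
  then have "vertex_of M g \<subseteq> set (visited M s1' ts1') - set s1'"
    using Closing.prems by (intro Closing.IH) auto
  then show ?case using * Closing.prems by auto
next
  case (Node h F us s ts)
  then obtain s1' ts1' where *: "s1 = h # s1'" "ts1 = Node us # ts1'" "s = s1' @ s2" "ts = ts1' @ ts2"
    "length s1' = length ts1'"
    by (cases s1; cases ts1) auto
  let ?t = "turn M (length us) (opp M h)"
  have v: "visited M s1 ts1 = h # opp M h # visited M ?t us @ visited M s1' ts1'"
    using * by simp
  have sub: "set ?t \<subseteq> set (visited M ?t us)" "set s1' \<subseteq> set (visited M s1' ts1')"
    using * by (auto intro!: set_visited[THEN subsetD])
  show ?case
  proof (cases "g \<in> set (opp M h # ?t)")
    case True
    have "vertex_of M (opp M h) = set (opp M h # ?t)"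
      by (rule vertex_of_turn[OF Node.hyps(3)])
    then have "vertex_of M g = set (opp M h # ?t)" using True vertex_of_eq by metis
    then show ?thesis
      using Node.prems(4) sub unfolding v * by auto
  next
    case False
    then have "vertex_of M g \<subseteq> set (visited M (?t @ s1') (us @ ts1')) - set (?t @ s1')"
      using Node.prems(4,5) * by (intro Node.IH) (auto simp: visited_append)
    then show ?thesis
      using Node.prems(4) unfolding v * by (auto simp: visited_append)
  qed
qed auto

text \<open>The vertices of the subtree below \<open>h\<close> have an outgoing free boundary: by
  \<open>explores_prefix\<close>, a free head inside would have its opposite inside too. This
  directed cut contains the edge of \<open>h\<close> and is also directed for
  \<open>B\<close>.\<close>

lemma explores_node_cut:
  assumes A: "eulerian_orientation M A" and B: "eulerian_orientation M B" and F: "A \<inter> F = B \<inter> F"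
    and ex: "explores M A F (h # s) (Node us # ts)"
    and dist: "distinct (visited M (h # s) (Node us # ts))"
    and sub: "set (visited M (h # s) (Node us # ts)) \<subseteq> half_edges M"
    and sym: "opp M ` F \<subseteq> F"
  shows "h \<notin> B"
proof -
  let ?t = "turn M (length us) (opp M h)"
  let ?Y = "insert (opp M h) (set (visited M ?t us))"
  from ex have h: "h \<notin> A" "h \<notin> F" "(rot M ^^ Suc (length us)) (opp M h) = opp M h"
    and ex': "explores M A (F \<union> {h, opp M h}) (?t @ s) (us @ ts)"
    by (auto elim: explores.cases)
  have hY: "h \<notin> ?Y" and hH: "h \<in> half_edges M" using dist sub opp_neq by auto
  have t: "set ?t \<subseteq> set (visited M ?t us)" by (rule set_visited) simp
  have vo: "vertex_of M (opp M h) = set (opp M h # ?t)"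
    by (rule vertex_of_turn[OF h(3)])
  have Y: "rot_closed ?Y"
    unfolding rot_closed_def
  proof (intro conjI ballI)
    fix g assume g: "g \<in> ?Y"
    show "vertex_of M g \<subseteq> ?Y"
    proof (cases "g \<in> set (opp M h # ?t)")
      case True
      then have "vertex_of M g = set (opp M h # ?t)" using vo vertex_of_eq by metis
      then show ?thesis using t by auto
    next
      case False
      then have "vertex_of M g \<subseteq> set (visited M ?t us) - set ?t"
        using g dist by (intro explores_closed[OF ex']) auto
      then show ?thesis by auto
    qed
  qed (use sub in auto)
  have "boundary ?Y - F \<subseteq> A"
  proof
    fix g assume g: "g \<in> boundary ?Y - F"
    show "g \<in> A"
    proof (cases "g = opp M h")
      case True
      then show ?thesis using h hH orientationD[OF A] by simp
    next
      case False
      show ?thesis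
      proof (rule ccontr)
        assume "g \<notin> A"
        then have "opp M g \<in> set (visited M ?t us)"
          using g False hY by (intro explores_prefix[OF ex']) (auto simp: boundary_def)
        then show False using g by (auto simp: boundary_def)
      qed
    qed
  qed
  then have "boundary ?Y - F \<subseteq> B"
    by (rule directed_cut_transfer[OF A B Y F])
  moreover have "opp M h \<notin> F" using h(2) sym by force
  ultimately have "opp M h \<in> B" using hY by (auto simp: boundary_def)
  then show ?thesis using orientationD[OF B] hH by simp
qed

text \<open>At the first difference, one exploration would cross \<open>h\<close> as a head where
  the other finds a tail, which \<open>explores_node_cut\<close> forbids for either order of the
  two. The remaining combinations disagree on whether \<open>h\<close> is frozen or on the
  orientation of a frozen edge. Each treated edge joins \<open>F\<close> with a common orientation,
  so the hypothesis on \<open>F\<close> persists.\<close>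

lemma explores_unique:
  assumes "explores M A F s ts" "explores M B F s ts'"
    and "eulerian_orientation M A" "eulerian_orientation M B" "A \<inter> F = B \<inter> F" "opp M ` F \<subseteq> F"
    and "distinct (visited M s ts)" "distinct (visited M s ts')"
    and "set (visited M s ts) \<subseteq> half_edges M" "set (visited M s ts') \<subseteq> half_edges M"
  shows "ts = ts'"
  using assms
proof (induction arbitrary: ts' rule: explores.induct)
  case (Nil F)
  then show ?case using explores_length by fastforce
next
  case (Opening h F s ts)
  have h: "h \<in> half_edges M" using Opening.prems by simp
  from Opening.prems(1) show ?case
  proof cases
    case (Opening us)
    have "A \<inter> (F \<union> {h, opp M h}) = B \<inter> (F \<union> {h, opp M h})"
      using Opening.hyps(1) \<open>h \<in> B\<close> h Opening.prems(4) orientationD[OF Opening.prems(2)]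
        orientationD[OF Opening.prems(3)] by blast
    then have "ts = us"
      using Opening.prems Opening by (intro Opening.IH) auto
    then show ?thesis using Opening by simp
  next
    case (Closing us)
    then show ?thesis using Opening.hyps Opening.prems by blast
  next
    case (Node us us')
    then have "h \<notin> A"
      using explores_node_cut[OF Opening.prems(3,2) Opening.prems(4)[symmetric]] Opening.prems by auto
    then show ?thesis using Opening.hyps by simp
  qed
next
  case (Closing h F s ts)
  have h: "h \<in> half_edges M" using Closing.prems by simp
  from Closing.prems(1) show ?case
  proof cases
    case (Closing us)
    have "A \<inter> (F \<union> {h, opp M h}) = B \<inter> (F \<union> {h, opp M h})"
      using Closing.hyps(1) \<open>h \<notin> B\<close> h Closing.prems(4) orientationD[OF Closing.prems(2)]
        orientationD[OF Closing.prems(3)] by blast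
    then have "ts = us"
      using Closing.prems Closing by (intro Closing.IH) auto
    then show ?thesis using Closing by simp
  next
    case (Opening us)
    then show ?thesis using Closing.hyps Closing.prems by blast
  next
    case (Node us us')
    then show ?thesis using Closing.hyps by simp
  qed
next
  case (Node h F us s ts)
  have h: "h \<in> half_edges M" using Node.prems by simp
  have ex: "explores M A F (h # s) (Node us # ts)"
    using Node.hyps by (rule explores.Node)
  from Node.prems(1) show ?case
  proof cases
    case (Opening us')
    then show ?thesis
      using explores_node_cut[OF Node.prems(2,3,4) ex] Node.prems by auto
  next
    case (Closing us')
    then show ?thesis using Node.hyps by simp
  next
    case (Node us' ts'')
    \<comment> \<open>Distinct visits make the return to \<open>opp M h\<close> the first one, so
      the vertex degree forces the number of children.\<close>
    have len: "Suc (length ws) = card (vertex_of M (opp M h))"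
      if "(rot M ^^ Suc (length ws)) (opp M h) = opp M h" "distinct (visited M (h # s) (Node ws # vs))"
      for ws vs :: "unit blossom list"
    proof -
      let ?t = "turn M (length ws) (opp M h)"
      have "set ?t \<subseteq> set (visited M ?t ws)" "distinct ?t"
        using set_visited[of ?t ws M] distinct_visited[of ?t ws M] that(2) by auto
      then have "distinct (opp M h # ?t)"
        using that(2) by auto
      then have "card (set (opp M h # ?t)) = Suc (length ws)"
        by (simp only: distinct_card) simp
      then show ?thesis using vertex_of_turn[OF that(1)] by simp
    qed
    have "length us = length us'"
      using len[of us ts] len[of us' ts''] Node Node.hyps Node.prems by simp
    moreover have "A \<inter> (F \<union> {h, opp M h}) = B \<inter> (F \<union> {h, opp M h})"
      using Node.hyps(1) \<open>h \<notin> B\<close> h Node.prems(4) orientationD[OF Node.prems(2)]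
        orientationD[OF Node.prems(3)] by blast
    ultimately have "us @ ts = us' @ ts''"
      using Node.prems Node by (intro Node.IH) (auto simp: visited_append)
    with \<open>length us = length us'\<close> show ?thesis using Node by simp
  qed
qed

end

section \<open>Existence of an exploration: reversed cycles and directed cuts\<close>

text \<open>The path is cut at its last departure from \<open>x\<close>.\<close>

lemma rtrancl_leave:
  assumes "(x, v) \<in> r\<^sup>*" "x \<noteq> v"
  shows "\<exists>y. (x, y) \<in> r \<and> (y, v) \<in> {(a, b) \<in> r. a \<noteq> x \<and> b \<noteq> x}\<^sup>*"
  using assms
proof (induction rule: rtrancl_induct)
  case (step z v)
  show ?case
  proof (cases "x = z")
    case False
    with step obtain y where "(x, y) \<in> r" "(y, z) \<in> {(a, b) \<in> r. a \<noteq> x \<and> b \<noteq> x}\<^sup>*" by blast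
    moreover have "(z, v) \<in> {(a, b) \<in> r. a \<noteq> x \<and> b \<noteq> x}" using step False by auto
    ultimately show ?thesis by (meson rtrancl.rtrancl_into_rtrancl)
  qed (use step in blast)
qed simp

context rmap
begin

definition steps :: "'h set \<Rightarrow> 'h set \<Rightarrow> ('h set \<times> 'h set) set" where
  "steps A F = {(vertex_of M a, vertex_of M (opp M a)) |a. a \<in> A \<and> a \<notin> F}"

lemma in_vertex_iff: "w \<in> vertices M \<Longrightarrow> a \<in> w \<longleftrightarrow> w = vertex_of M a"
proof
  assume "w \<in> vertices M" "a \<in> w"
  then obtain h where "w = vertex_of M h" "a \<in> vertex_of M h" by (auto simp: vertices_def)
  then show "w = vertex_of M a" by (simp only: vertex_of_eq[of a h])
qed simp

lemma finite_vertex: "w \<in> vertices M \<Longrightarrow> finite w"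
  by (rule finite_subset[OF _ finite_half_edges]) (use vertex_of_subset in \<open>auto simp: vertices_def\<close>)

lemma rot_closed_same_vertex: "rot_closed Y \<Longrightarrow> g \<in> Y \<Longrightarrow> vertex_of M h = vertex_of M g \<Longrightarrow> h \<in> Y"
  using self_in_vertex[of h] unfolding rot_closed_def by (metis subsetD)

lemma orientation_flip:
  assumes A: "orientation M A" and a: "a \<in> A"
  shows "orientation M (insert (opp M a) (A - {a}))"
    and "w \<in> vertices M \<Longrightarrow> int (card (w \<inter> insert (opp M a) (A - {a}))) =
      int (card (w \<inter> A)) - of_bool (w = vertex_of M a) + of_bool (w = vertex_of M (opp M a))"
proof -
  have oA: "h \<in> A \<longleftrightarrow> opp M h \<notin> A" if "h \<in> half_edges M" for h
    using A that unfolding orientation_def by (elim conjE) (rule bspec)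
  have AH: "A \<subseteq> half_edges M"
    using A unfolding orientation_def by (rule conjunct1)
  have aH: "a \<in> half_edges M" and na: "opp M a \<notin> A" and ne: "opp M a \<noteq> a"
  proof -
    show aH: "a \<in> half_edges M" using AH a by blast
    show "opp M a \<notin> A" using oA[OF aH] a by simp
    show "opp M a \<noteq> a" by (rule opp_neq[OF aH])
  qed
  show "orientation M (insert (opp M a) (A - {a}))"
    unfolding orientation_def
  proof (intro conjI ballI)
    show "insert (opp M a) (A - {a}) \<subseteq> half_edges M"
      using AH aH by auto
    fix h assume h: "h \<in> half_edges M"
    consider "h = a" | "h = opp M a" | "h \<noteq> a" "h \<noteq> opp M a" by blast
    then show "h \<in> insert (opp M a) (A - {a}) \<longleftrightarrow> opp M h \<notin> insert (opp M a) (A - {a})"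
    proof cases
      case 3
      then have "opp M h \<noteq> a" "opp M h \<noteq> opp M a" using opp_opp[of h] by auto
      with 3 show ?thesis using oA[OF h] by simp
    next
      case 1
      then show ?thesis using ne by simp
    next
      case 2
      then show ?thesis using ne by auto
    qed
  qed
  assume w: "w \<in> vertices M"
  have fin: "finite (w \<inter> A)" using finite_vertex[OF w] by blast
  have 1: "int (card (w \<inter> (A - {a}))) = int (card (w \<inter> A)) - of_bool (a \<in> w)"
  proof (cases "a \<in> w")
    case True
    then have "Suc (card (w \<inter> A - {a})) = card (w \<inter> A)"
      using a by (intro card_Suc_Diff1[OF fin]) simp
    moreover have "w \<inter> (A - {a}) = w \<inter> A - {a}" by blast
    ultimately show ?thesis using True by simp
  next
    case False
    then have "w \<inter> (A - {a}) = w \<inter> A" by auto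
    then show ?thesis using False by simp
  qed
  have 2: "int (card (w \<inter> insert (opp M a) (A - {a}))) = int (card (w \<inter> (A - {a}))) + of_bool (opp M a \<in> w)"
    using na finite_vertex[OF w] by (simp add: Int_insert_right)
  show "int (card (w \<inter> insert (opp M a) (A - {a}))) =
      int (card (w \<inter> A)) - of_bool (w = vertex_of M a) + of_bool (w = vertex_of M (opp M a))"
    by (simp only: 1 2 in_vertex_iff[OF w])
qed

text \<open>Reversing a path moves one unit of outdegree from \<open>x\<close> to \<open>v\<close>.
  The induction shrinks the allowed vertex set: after its last departure from \<open>x\<close> the
  path avoids \<open>x\<close>, so the reversal of the rest does not touch the first edge, which can
  still be reversed. The clause on half-edges outside \<open>W\<close> records this.\<close>

lemma path_flip:
  assumes "finite W" "orientation M A" "opp M ` F \<subseteq> F" "(x, v) \<in> (steps A F \<inter> W \<times> W)\<^sup>*"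
  shows "\<exists>B. orientation M B \<and> B \<inter> F = A \<inter> F \<and>
    (\<forall>a. vertex_of M a \<notin> W \<or> vertex_of M (opp M a) \<notin> W \<longrightarrow> (a \<in> B \<longleftrightarrow> a \<in> A)) \<and>
    (\<forall>w\<in>vertices M. int (card (w \<inter> B)) = int (card (w \<inter> A)) - of_bool (w = x) + of_bool (w = v))"
  using assms(1,4)
proof (induction W arbitrary: x rule: finite_psubset_induct)
  case (psubset W)
  show ?case
  proof (cases "x = v")
    case True
    then show ?thesis using assms(2) by (intro exI[of _ A]) auto
  next
    case False
    from rtrancl_leave[OF psubset.prems False] obtain y where
      xy: "(x, y) \<in> steps A F \<inter> W \<times> W"
      and yv: "(y, v) \<in> {(a, b) \<in> steps A F \<inter> W \<times> W. a \<noteq> x \<and> b \<noteq> x}\<^sup>*" by blast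
    then obtain a where a: "a \<in> A" "a \<notin> F" "x = vertex_of M a" "y = vertex_of M (opp M a)" "x \<in> W" "y \<in> W"
      by (auto simp: steps_def)
    have "{(a, b) \<in> steps A F \<inter> W \<times> W. a \<noteq> x \<and> b \<noteq> x} = steps A F \<inter> (W - {x}) \<times> (W - {x})"
      by auto
    then have "(y, v) \<in> (steps A F \<inter> (W - {x}) \<times> (W - {x}))\<^sup>*" using yv by simp
    from psubset.IH[OF _ this] \<open>x \<in> W\<close> obtain B where B: "orientation M B" "B \<inter> F = A \<inter> F"
      "\<And>a. vertex_of M a \<notin> W - {x} \<or> vertex_of M (opp M a) \<notin> W - {x} \<Longrightarrow> a \<in> B \<longleftrightarrow> a \<in> A"
      "\<And>w. w \<in> vertices M \<Longrightarrow> int (card (w \<inter> B)) = int (card (w \<inter> A)) - of_bool (w = y) + of_bool (w = v)"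
      by blast
    have aB: "a \<in> B" using B(3)[of a] a by simp
    let ?B = "insert (opp M a) (B - {a})"
    have "opp M a \<notin> F" using a(2) assms(3) by force
    show ?thesis
    proof (intro exI[of _ ?B] conjI allI impI ballI)
      show "orientation M ?B" by (rule orientation_flip(1)[OF B(1) aB])
      show "?B \<inter> F = A \<inter> F" using B(2) a(2) \<open>opp M a \<notin> F\<close> by blast
      show "b \<in> ?B \<longleftrightarrow> b \<in> A" if "vertex_of M b \<notin> W \<or> vertex_of M (opp M b) \<notin> W" for b
      proof -
        have "b \<noteq> a" "b \<noteq> opp M a" using that a by auto
        then show ?thesis using B(3)[of b] that by auto
      qed
      show "int (card (w \<inter> ?B)) = int (card (w \<inter> A)) - of_bool (w = x) + of_bool (w = v)"
        if "w \<in> vertices M" for w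
        using orientation_flip(2)[OF B(1) aB that] B(4)[OF that] a(3,4) by simp
    qed
  qed
qed

text \<open>In the first case the edge of \<open>h\<close> lies on a directed cycle, which is reversed.\<close>

lemma cycle_or_cut:
  assumes A: "eulerian_orientation M A" and F: "opp M ` F \<subseteq> F"
    and h: "h \<in> half_edges M" "h \<notin> A" "h \<notin> F"
  shows "(\<exists>B. eulerian_orientation M B \<and> B \<inter> F = A \<inter> F \<and> h \<in> B) \<or>
    (\<exists>Y. rot_closed Y \<and> opp M h \<in> Y \<and> h \<notin> Y \<and> boundary Y - F \<subseteq> A)"
proof -
  let ?F = "F \<union> {h, opp M h}"
  let ?r = "steps A ?F" and ?x = "vertex_of M h" and ?v = "vertex_of M (opp M h)"
  have AH: "A \<subseteq> half_edges M" and oA: "orientation M A"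
    using A orientationD(1)[OF A] by (simp_all add: eulerian_orientation_def)
  have oh: "opp M h \<in> A" "opp M h \<notin> F"
    using h F orientationD[OF A] by force+
  show ?thesis
  proof (cases "(?x, ?v) \<in> ?r\<^sup>*")
    case True
    have "?r = ?r \<inter> vertices M \<times> vertices M"
      using AH by (auto simp: steps_def vertices_def)
    then have "(?x, ?v) \<in> (?r \<inter> vertices M \<times> vertices M)\<^sup>*" using True by simp
    moreover have "finite (vertices M)" using finite_half_edges by (simp add: vertices_def)
    moreover have "opp M ` ?F \<subseteq> ?F" using F by auto
    ultimately obtain B where B: "orientation M B" "B \<inter> ?F = A \<inter> ?F"
      "\<And>w. w \<in> vertices M \<Longrightarrow> int (card (w \<inter> B)) = int (card (w \<inter> A)) - of_bool (w = ?x) + of_bool (w = ?v)"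
      using path_flip[of "vertices M" A ?F ?x ?v] oA by blast
    have ohB: "opp M h \<in> B" using oh B(2) by blast
    \<comment> \<open>The edge of \<open>h\<close> closes the path to a cycle; flipping it cancels
      the changes of outdegree at the two ends.\<close>
    let ?B = "insert h (B - {opp M h})"
    have "int (card (w \<inter> ?B)) = int (card (w \<inter> A))" if "w \<in> vertices M" for w
      using orientation_flip(2)[OF B(1) ohB that] B(3)[OF that] by simp
    then have "eulerian_orientation M ?B"
      using orientation_flip(1)[OF B(1) ohB] A by (simp add: eulerian_orientation_def)
    moreover have "?B \<inter> F = A \<inter> F" using B(2) h oh by blast
    ultimately show ?thesis by blast
  next
    case False
    \<comment> \<open>The vertices not reachable from that of \<open>h\<close>: a free edge entering
      this set, other than that of \<open>h\<close>, would make its end reachable.\<close>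
    let ?Y = "{g \<in> half_edges M. (?x, vertex_of M g) \<notin> ?r\<^sup>*}"
    have "rot_closed ?Y"
      unfolding rot_closed_def
    proof (intro conjI ballI subsetI)
      fix g y assume g: "g \<in> ?Y" "y \<in> vertex_of M g"
      then show "y \<in> ?Y" using vertex_of_eq[OF g(2)] vertex_of_subset[of g] by auto
    qed auto
    moreover have "opp M h \<in> ?Y" "h \<notin> ?Y" using False h by auto
    moreover have "boundary ?Y - F \<subseteq> A"
    proof
      fix g assume g: "g \<in> boundary ?Y - F"
      then have gH: "g \<in> half_edges M" and n: "(?x, vertex_of M g) \<notin> ?r\<^sup>*" and r: "(?x, vertex_of M (opp M g)) \<in> ?r\<^sup>*"
        by (auto simp: boundary_def)
      show "g \<in> A"
      proof (rule ccontr)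
        assume gA: "g \<notin> A"
        then have "opp M g \<in> A" using gH orientationD[OF A] by simp
        moreover have "opp M g \<notin> F" using g F by force
        moreover have "opp M g \<noteq> h" using \<open>opp M g \<in> A\<close> h by blast
        moreover have "opp M g \<noteq> opp M h" using n by auto
        ultimately have "(vertex_of M (opp M g), vertex_of M (opp M (opp M g))) \<in> ?r"
          unfolding steps_def by blast
        then have "(vertex_of M (opp M g), vertex_of M g) \<in> ?r" by simp
        with r n show False by (meson rtrancl.rtrancl_into_rtrancl)
      qed
    qed
    ultimately show ?thesis by blast
  qed
qed

definition separated :: "'h set \<Rightarrow> 'h set \<Rightarrow> 'h \<Rightarrow> 'h \<Rightarrow> bool" where
  "separated A F g g' \<longleftrightarrow> vertex_of M g = vertex_of M g' \<or>
     (\<exists>Y. rot_closed Y \<and> g \<in> Y \<and> g' \<notin> Y \<and> boundary Y - F \<subseteq> A)"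

lemma separated_transfer:
  assumes "eulerian_orientation M A" "eulerian_orientation M B" "A \<inter> F = B \<inter> F" "F \<subseteq> F'" "separated A F g g'"
  shows "separated B F' g g'"
  using assms directed_cut_transfer[OF assms(1,2) _ assms(3)] unfolding separated_def by blast

text \<open>\<open>Z\<close> is the union of the unexplored vertices. Accessibility is stated as the existence of a free
  outgoing edge for every set of unexplored vertices. The cuts in \<open>separated\<close> witness that the edges
  from the ancestors of the current vertex to the current vertex, if any, cannot be reversed.\<close>

lemma explores_exists:
  assumes "eulerian_orientation M A" "opp M ` F \<subseteq> F" "distinct s" "set s \<subseteq> half_edges M"
    "rot_closed Z" "set s \<inter> Z = {}" "half_edges M - (set s \<union> Z) \<subseteq> F"
    and "\<And>W. rot_closed W \<Longrightarrow> W \<subseteq> Z \<Longrightarrow> W \<noteq> {} \<Longrightarrow> (boundary W - F) \<inter> A \<noteq> {}"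
    and "sorted_wrt (separated A F) s"
  shows "\<exists>B ts. eulerian_orientation M B \<and> B \<inter> F = A \<inter> F \<and> explores M B F s ts \<and>
    distinct (visited M s ts) \<and> set (visited M s ts) = set s \<union> Z"
  using assms
proof (induction "card (set s \<union> Z)" arbitrary: A F s Z rule: less_induct)
  case less
  have ZH: "Z \<subseteq> half_edges M" using less.prems(5) by (simp add: rot_closed_def)
  have fin: "finite (set s \<union> Z)"
    using ZH finite_half_edges finite_subset by auto
  show ?case
  proof (cases s)
    case Nil
    \<comment> \<open>Accessibility would give a free edge from \<open>Z\<close> to the explored
      part, but with an empty stack all half-edges of that part are frozen.\<close>
    have "Z = {}"
    proof (rule ccontr)
      assume "Z \<noteq> {}"
      from less.prems(8)[OF less.prems(5) order_refl this] obtain g where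
        g: "g \<in> Z" "opp M g \<notin> Z" "g \<notin> F" by (auto simp: boundary_def)
      then have "opp M g \<in> half_edges M - (set s \<union> Z)" using Nil ZH by auto
      then have "opp M g \<in> F" using less.prems(7) by blast
      then have "opp M (opp M g) \<in> F" using less.prems(2) by blast
      then show False using g(3) by simp
    qed
    then show ?thesis
      using less.prems(1) Nil by (intro exI[of _ A] exI[of _ "[]"]) (auto intro: explores.Nil)
  next
    case (Cons h s')
    have hH: "h \<in> half_edges M" and hs': "h \<notin> set s'" and hZ: "h \<notin> Z"
      using Cons less.prems by auto
    let ?F = "F \<union> {h, opp M h}"
    have sym: "opp M ` ?F \<subseteq> ?F" using less.prems(2) by auto
    have card': "card (X - {h}) < card (set s \<union> Z)" if "X \<subseteq> set s \<union> Z" for X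
      using fin that Cons by (intro psubset_card_mono) auto
    \<comment> \<open>Common to both kinds of leaves. Each \<open>W\<close> inside \<open>Z\<close>
      keeps a free outgoing edge: their number is the same for \<open>A'\<close> as for
      \<open>A\<close>, and the edge of \<open>h\<close> is not among them, since \<open>h\<close>
      lies outside \<open>Z\<close> and is either outgoing or already frozen.\<close>
    have leaf: "\<exists>B ts. eulerian_orientation M B \<and> B \<inter> ?F = A' \<inter> ?F \<and> explores M B ?F s' ts \<and>
        distinct (visited M s' ts) \<and> set (visited M s' ts) = set s' \<union> Z"
      if A': "eulerian_orientation M A'" "A' \<inter> F = A \<inter> F" "h \<in> A' \<or> h \<in> F" for A'
    proof (rule less.hyps)
      show "card (set s' \<union> Z) < card (set s \<union> Z)"
        using card'[of "set s' \<union> Z"] hs' hZ Cons by auto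
      show "half_edges M - (set s' \<union> Z) \<subseteq> ?F"
        using less.prems(7) Cons by auto
      show "(boundary W - ?F) \<inter> A' \<noteq> {}" if W: "rot_closed W" "W \<subseteq> Z" "W \<noteq> {}" for W
      proof -
        have "card ((boundary W - F) \<inter> A') = card ((boundary W - F) \<inter> A)"
          by (rule card_free_boundary[OF A'(1) less.prems(1) W(1) A'(2)])
        moreover have "(boundary W - F) \<inter> A \<noteq> {}" by (rule less.prems(8)[OF W])
        moreover have "finite ((boundary W - F) \<inter> A)" using finite_boundary[OF W(1)] by blast
        ultimately have "(boundary W - F) \<inter> A' \<noteq> {}"
          by (metis card.empty card_0_eq)
        then obtain g where g: "g \<in> boundary W" "g \<notin> F" "g \<in> A'" by blast
        moreover have "g \<noteq> h" using g(1) W(2) hZ by (auto simp: boundary_def)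
        moreover have "g \<noteq> opp M h"
        proof
          assume "g = opp M h"
          then have "h \<notin> A'" "h \<notin> F"
            using g(2,3) hH orientationD[OF A'(1)] less.prems(2) by auto
          then show False using A'(3) by blast
        qed
        ultimately show ?thesis by blast
      qed
      show "sorted_wrt (separated A' ?F) s'"
      proof (rule sorted_wrt_mono_rel)
        show "sorted_wrt (separated A F) s'" using less.prems(9) Cons by simp
        show "separated A' ?F g g'" if "separated A F g g'" for g g'
          by (rule separated_transfer[OF less.prems(1) A'(1) A'(2)[symmetric] _ that]) auto
      qed
    qed (use less.prems Cons A' sym in auto)
    \<comment> \<open>The greedy choice: a free half-edge becomes a tail whenever some orientation
      with the same frozen part allows it, and is crossed only otherwise.\<close>
    consider (fixed) "h \<in> F" | (tail) A' where "h \<notin> F" "eulerian_orientation M A'" "A' \<inter> F = A \<inter> F" "h \<in> A'"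
      | (head) "h \<notin> F" "\<nexists>A'. eulerian_orientation M A' \<and> A' \<inter> F = A \<inter> F \<and> h \<in> A'" by blast
    then show ?thesis
    proof cases
      case fixed
      have F': "?F = F" using fixed less.prems(2) by auto
      from leaf[OF less.prems(1)] fixed obtain B ts where B: "eulerian_orientation M B" "B \<inter> F = A \<inter> F"
        "explores M B ?F s' ts" "distinct (visited M s' ts)" "set (visited M s' ts) = set s' \<union> Z"
        unfolding F' by blast
      define t :: "unit blossom" where "t = (if h \<in> B then Opening else Closing ())"
      have "explores M B F (h # s') (t # ts)"
        using B(3) fixed explores.Opening[of h B M F s' ts] explores.Closing[of h B F M s' ts] by (simp add: t_def)
      moreover have "visited M (h # s') (t # ts) = h # visited M s' ts" by (simp add: t_def)
      ultimately show ?thesis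
        using B hs' hZ Cons by (intro exI[of _ B] exI[of _ "t # ts"]) auto
    next
      case tail
      from leaf[OF tail(2,3)] tail(4) obtain B ts where B: "eulerian_orientation M B" "B \<inter> ?F = A' \<inter> ?F"
        "explores M B ?F s' ts" "distinct (visited M s' ts)" "set (visited M s' ts) = set s' \<union> Z" by blast
      then have "h \<in> B" "B \<inter> F = A \<inter> F" using tail(3,4) by blast+
      moreover have "explores M B F (h # s') (Opening # ts)"
        by (rule explores.Opening) (use B \<open>h \<in> B\<close> in auto)
      ultimately show ?thesis
        using B hs' hZ Cons by (intro exI[of _ B] exI[of _ "Opening # ts"]) auto
    next
      case head
      have hA: "h \<notin> A" using head less.prems(1) by blast
      from cycle_or_cut[OF less.prems(1,2) hH hA head(1)] head(2) obtain Y0 where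
        Y0: "rot_closed Y0" "opp M h \<in> Y0" "h \<notin> Y0" "boundary Y0 - F \<subseteq> A" by blast
      let ?x = "opp M h"
      obtain n where cl: "(rot M ^^ Suc n) ?x = ?x" and dt: "distinct (?x # turn M n ?x)"
        using turn_exists[OF refl] by blast
      let ?t = "turn M n ?x"
      have xF: "?x \<notin> F" using head(1) less.prems(2) by force
      have xH: "?x \<in> half_edges M" using hH by simp
      \<comment> \<open>If \<open>?x\<close> were outside \<open>Y\<close>, the head
        \<open>h\<close> would lie in the free boundary, which consists of tails.\<close>
      have forced: "?x \<in> Y" if "rot_closed Y" "h \<in> Y" "boundary Y - F \<subseteq> A" for Y
        using that hA head(1) by (auto simp: boundary_def)
      \<comment> \<open>An unfrozen head cannot come from a pending vertex. If that vertex is the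
        current one, \<open>Y0\<close> would separate the two halves of a loop; otherwise the cut
        between them contradicts \<open>forced\<close>.\<close>
      have xs: "?x \<notin> set s'"
      proof
        assume "?x \<in> set s'"
        then have "separated A F h ?x" using less.prems(9) Cons by simp
        moreover have "vertex_of M h \<noteq> vertex_of M ?x"
          using Y0(2,3) rot_closed_same_vertex[OF Y0(1), of "?x" h] by auto
        ultimately show False using forced unfolding separated_def by blast
      qed
      have "?x \<notin> half_edges M - (set s \<union> Z)" using less.prems(7) xF by blast
      then have xZ: "?x \<in> Z" using xs xH opp_neq[OF hH] Cons by simp
      then have vZ: "vertex_of M ?x \<subseteq> Z" using less.prems(5) unfolding rot_closed_def by blast
      have vt: "vertex_of M ?x = set (?x # ?t)" by (rule vertex_of_turn[OF cl])
      let ?s = "?t @ s'" and ?Z = "Z - vertex_of M ?x"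
      have X: "set ?s \<union> ?Z = (set s \<union> Z) - {h, ?x}"
        using vt vZ Cons dt hs' hZ xs by auto
      have "\<exists>B ts. eulerian_orientation M B \<and> B \<inter> ?F = A \<inter> ?F \<and> explores M B ?F ?s ts \<and>
        distinct (visited M ?s ts) \<and> set (visited M ?s ts) = set ?s \<union> ?Z"
      proof (rule less.hyps)
        show "card (set ?s \<union> ?Z) < card (set s \<union> Z)"
          unfolding X using fin Cons by (intro psubset_card_mono) auto
        show "distinct ?s" using dt less.prems(3,6) Cons vt vZ by auto
        show "set ?s \<subseteq> half_edges M" using less.prems(4) Cons vt vZ ZH by auto
        show "rot_closed ?Z" by (rule rot_closed_Diff[OF less.prems(5) rot_closed_vertex[OF xH]])
        show "set ?s \<inter> ?Z = {}" using less.prems(6) Cons vt by auto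
        show "half_edges M - (set ?s \<union> ?Z) \<subseteq> ?F"
          unfolding X using less.prems(7) by auto
        show "(boundary W - ?F) \<inter> A \<noteq> {}" if W: "rot_closed W" "W \<subseteq> ?Z" "W \<noteq> {}" for W
        proof -
          have "(boundary W - F) \<inter> A \<noteq> {}" using less.prems(8)[of W] W by auto
          moreover have "h \<notin> boundary W" "?x \<notin> boundary W"
            using W(2) hZ by (auto simp: boundary_def)
          ultimately show ?thesis by blast
        qed
        show "sorted_wrt (separated A ?F) ?s"
          unfolding sorted_wrt_append
        proof (intro conjI ballI)
          have mono: "separated A ?F g g'" if "separated A F g g'" for g g'
            by (rule separated_transfer[OF less.prems(1,1) refl _ that]) auto
          show "sorted_wrt (separated A ?F) s'"
            by (rule sorted_wrt_mono_rel[OF mono]) (use less.prems(9) Cons in auto)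
          have sv: "vertex_of M g = vertex_of M ?x" if "g \<in> set ?t" for g
            by (rule vertex_of_eq) (unfold vt, use that in simp)
          show "sorted_wrt (separated A ?F) ?t"
            by (rule sorted_wrt_mono_rel[of _ "\<lambda>_ _. True"]) (auto simp: separated_def sv sorted_wrt_iff_nth_less)
          fix g g' assume g: "g \<in> set ?t" and g': "g' \<in> set s'"
          have gv: "g \<in> vertex_of M ?x" unfolding vt using g by simp
          have "separated A F h g'" using less.prems(9) Cons g' by simp
          then consider "vertex_of M h = vertex_of M g'"
            | Y where "rot_closed Y" "h \<in> Y" "g' \<notin> Y" "boundary Y - F \<subseteq> A"
            unfolding separated_def by blast
          \<comment> \<open>Pending half-edges at the vertex of \<open>h\<close> are cut off from
            the new vertex by \<open>Y0\<close>. For the others, the cut that separates them from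
            \<open>h\<close> contains the new vertex by \<open>forced\<close>.\<close>
          then show "separated A ?F g g'"
          proof cases
            case 1
            have "g \<in> Y0" using Y0(1,2) gv unfolding rot_closed_def by blast
            moreover have "g' \<notin> Y0"
              using Y0(3) 1 rot_closed_same_vertex[OF Y0(1), of g' h] by auto
            ultimately show ?thesis
              by (intro mono) (use Y0 in \<open>auto simp: separated_def\<close>)
          next
            case 2
            then have "g \<in> Y" using forced[OF 2(1,2,4)] gv unfolding rot_closed_def by blast
            with 2 show ?thesis
              by (intro mono) (auto simp: separated_def)
          qed
        qed
      qed (use less.prems sym in auto)
      then obtain B vs where B: "eulerian_orientation M B" "B \<inter> ?F = A \<inter> ?F" "explores M B ?F ?s vs"
        "distinct (visited M ?s vs)" "set (visited M ?s vs) = set ?s \<union> ?Z" by blast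
      define us ts where "us = take n vs" and "ts = drop n vs"
      have len: "length vs = n + length s'" using explores_length[OF B(3)] by simp
      then have us: "vs = us @ ts" "length us = n" by (auto simp: us_def ts_def)
      have "explores M B F (h # s') (Node us # ts)"
      proof (rule explores.Node)
        show "h \<notin> B" using B(2) hA by blast
      qed (use us cl B head(1) in auto)
      moreover have v: "visited M (h # s') (Node us # ts) = h # ?x # visited M ?s vs"
        using us by (simp add: visited_append)
      ultimately show ?thesis
        using B X Cons hs' hZ xZ opp_neq[OF hH]
        by (intro exI[of _ B] exI[of _ "Node us # ts"]) auto
    qed
  qed
qed

end

section \<open>Maps and codes\<close>

fun leaves :: "('h, 'm) rooted_map_scheme \<Rightarrow> 'h list \<Rightarrow> 'a blossom list \<Rightarrow> 'h list" where
  "leaves M (h # s) (Node us # ts) = leaves M (turn M (length us) (opp M h)) us @ leaves M s ts"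
| "leaves M (h # s) (t # ts) = h # leaves M s ts"
| "leaves M s ts = []"

text \<open>A tree edge is represented by the half met first, at the parent; in an exploration this
  is its head.\<close>

fun tree_edges :: "('h, 'm) rooted_map_scheme \<Rightarrow> 'h list \<Rightarrow> 'a blossom list \<Rightarrow> 'h list" where
  "tree_edges M (h # s) (Node us # ts) =
     h # tree_edges M (turn M (length us) (opp M h)) us @ tree_edges M s ts"
| "tree_edges M (h # s) (t # ts) = tree_edges M s ts"
| "tree_edges M s ts = []"

lemma leaves_append:
  "length s = length ts \<Longrightarrow> leaves M (s @ s') (ts @ ts') = leaves M s ts @ leaves M s' ts'"
  by (induction M s ts rule: leaves.induct) auto

lemma tree_edges_append:
  "length s = length ts \<Longrightarrow> tree_edges M (s @ s') (ts @ ts') = tree_edges M s ts @ tree_edges M s' ts'"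
  by (induction M s ts rule: tree_edges.induct) auto

text \<open>Multisets forget how leaves and tree edges interleave; distinct visits then separate the
  two kinds.\<close>

lemma mset_visited:
  "mset (visited M s ts) =
    mset (leaves M s ts) + mset (tree_edges M s ts) + mset (map (opp M) (tree_edges M s ts))"
  by (induction M s ts rule: visited.induct) auto

lemma set_leaves: "set (leaves M s ts) \<subseteq> set (visited M s ts)"
  by (metis mset_visited mset_subset_eq_add_left set_mset_mono set_mset_mset add.assoc)

lemma set_visited_eq:
  "set (visited M s ts) = set (leaves M s ts) \<union> set (tree_edges M s ts) \<union> opp M ` set (tree_edges M s ts)"
  using arg_cong[OF mset_visited, of set_mset M s ts] by simp

lemma distinct_leaves:
  assumes "distinct (visited M s ts)"
  shows "distinct (leaves M s ts)"
    and "set (leaves M s ts) \<inter> (set (tree_edges M s ts) \<union> opp M ` set (tree_edges M s ts)) = {}"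
proof -
  have "mset (visited M s ts) = mset (leaves M s ts @ tree_edges M s ts @ map (opp M) (tree_edges M s ts))"
    by (simp add: mset_visited)
  then have "distinct (leaves M s ts @ tree_edges M s ts @ map (opp M) (tree_edges M s ts))"
    using assms mset_eq_imp_distinct_iff by blast
  then show "distinct (leaves M s ts)"
    "set (leaves M s ts) \<inter> (set (tree_edges M s ts) \<union> opp M ` set (tree_edges M s ts)) = {}"
    by auto
qed

lemma explores_leaf_word:
  "explores M A F s ts \<Longrightarrow> map (\<lambda>h. h \<in> A) (leaves M s ts) = map (\<lambda>l. l = None) (concat (map leaf_word ts))"
  by (induction rule: explores.induct) (auto simp: leaves_append)

lemma explores_opening:
  "explores M A F s ts \<Longrightarrow> list_all2 (\<lambda>h t. t = Opening \<longleftrightarrow> h \<in> A) s ts"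
proof (induction rule: explores.induct)
  case (Node h F us s ts)
  then have "list_all2 (\<lambda>h t. t = Opening \<longleftrightarrow> h \<in> A) s ts"
    by (auto simp: list_all2_append)
  then show ?case using Node by simp
qed auto

lemma explores_tree_edges:
  "explores M A F s ts \<Longrightarrow> h \<in> set (tree_edges M s ts) \<Longrightarrow> h \<notin> F"
  by (induction rule: explores.induct) (auto simp: tree_edges_append)

text \<open>A closing leaf is frozen when it is met, from the start or because one half of its edge
  was met before; distinctness rules out tree edges, so that half is a leaf in \<open>a\<close>.
  Both ways of being opposite are listed because \<open>opp M\<close> is not assumed to be an
  involution here.\<close>

lemma explores_closing:
  assumes "explores M A F s ts" "distinct (visited M s ts)" "leaves M s ts = a @ h # b" "h \<notin> A"
  shows "h \<in> F \<or> h \<in> set a \<or> opp M h \<in> set a \<or> (\<exists>g\<in>set a. h = opp M g)"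
  using assms
proof (induction arbitrary: a rule: explores.induct)
  case (Opening h' F s ts)
  then show ?case by (cases a) auto
next
  case (Closing h' F s ts)
  then show ?case by (cases a) auto
next
  case (Node h' F us s ts)
  have "h \<in> F \<union> {h', opp M h'} \<or> h \<in> set a \<or> opp M h \<in> set a \<or> (\<exists>g\<in>set a. h = opp M g)"
    using Node.prems by (intro Node.IH) (auto simp: leaves_append visited_append)
  moreover have "h \<in> set (visited M (turn M (length us) (opp M h') @ s) (us @ ts))"
    using Node.prems(2) set_leaves[of M "turn M (length us) (opp M h') @ s" "us @ ts"]
    by (auto simp: leaves_append)
  then have "h \<notin> {h', opp M h'}"
    using Node.prems(1) by (auto simp: visited_append)
  ultimately show ?case by blast
qed auto

lemma card_opening:
  "list_all2 (\<lambda>h t. t = Opening \<longleftrightarrow> h \<in> A) s ts \<Longrightarrow> distinct s \<Longrightarrow> card (set s \<inter> A) = count_list ts Opening"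
  by (induction rule: list_all2_induct) auto

section \<open>Degrees of the explored vertices and codes of maps\<close>

context rmap
begin

text \<open>The half-edge \<open>x\<close> through which the vertex is entered is outgoing but is
  not a child, so only \<open>k - 1\<close> of the \<open>k\<close> outgoing half-edges at a vertex
  of degree \<open>2 * k\<close> are opening children. At the root vertex the root half-edge plays
  this part.\<close>

lemma eulerian_turn:
  assumes A: "eulerian_orientation M A" and x: "x \<in> half_edges M" "x \<in> A"
    and cl: "(rot M ^^ Suc (length us)) x = x" and dist: "distinct (x # turn M (length us) x)"
    and us: "list_all2 (\<lambda>h t. t = Opening \<longleftrightarrow> h \<in> A) (turn M (length us) x) us"
  shows "\<exists>k. length us + 1 = 2 * k \<and> count_list us Opening = k - 1"
proof -
  let ?t = "turn M (length us) x"
  have v: "vertex_of M x = set (x # ?t)" by (rule vertex_of_turn[OF cl])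
  have "card (vertex_of M x) = Suc (length us)"
    unfolding v distinct_card[OF dist] by simp
  moreover have "2 * card (vertex_of M x \<inter> A) = card (vertex_of M x)"
    using A x by (auto simp: eulerian_orientation_def vertices_def)
  moreover have "card (vertex_of M x \<inter> A) = Suc (card (set ?t \<inter> A))"
    unfolding v using x dist by simp
  moreover have "card (set ?t \<inter> A) = count_list us Opening"
    by (rule card_opening[OF us]) (use dist in simp)
  ultimately show ?thesis
    by (intro exI[of _ "Suc (count_list us Opening)"]) auto
qed

lemma explores_eulerian:
  assumes "explores M A F s ts" "eulerian_orientation M A" "distinct (visited M s ts)"
    "set (visited M s ts) \<subseteq> half_edges M"
  shows "\<forall>t\<in>set ts. eulerian_nodes t"
  using assms
proof (induction rule: explores.induct)
  case (Node h F us s ts)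
  let ?t = "turn M (length us) (opp M h)"
  have IH: "\<forall>t\<in>set (us @ ts). eulerian_nodes t"
    using Node.prems by (intro Node.IH) (auto simp: visited_append)
  have h: "h \<in> half_edges M" using Node.prems by simp
  have "\<exists>k. length us + 1 = 2 * k \<and> count_list us Opening = k - 1"
  proof (rule eulerian_turn[OF Node.prems(1)])
    show "opp M h \<in> A" using Node.hyps(1) orientationD[OF Node.prems(1)] h by simp
    have "set ?t \<subseteq> set (visited M ?t us)" "distinct ?t"
      using set_visited[of ?t us M] distinct_visited[of ?t us M] Node.prems(2) by auto
    then show "distinct (opp M h # ?t)" using Node.prems(2) by auto
    show "list_all2 (\<lambda>h t. t = Opening \<longleftrightarrow> h \<in> A) ?t us"
      using explores_opening[OF Node.hyps(4)] by (simp add: list_all2_append)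
  qed (use h Node.hyps in auto)
  then show ?case using IH by simp
qed auto

text \<open>A distinct list of vertices, matched entry by entry with \<open>node_degrees\<close>,
  transfers all degree statistics at once.\<close>

lemma explores_vertices:
  assumes "explores M A F s ts" "distinct (visited M s ts)" "set (visited M s ts) \<subseteq> half_edges M"
  shows "\<exists>vs. map card vs = concat (map node_degrees ts) \<and> distinct vs \<and> set vs \<subseteq> vertices M \<and>
    \<Union>(set vs) = set (visited M s ts) - set s"
  using assms
proof (induction rule: explores.induct)
  case (Nil F)
  then show ?case by (intro exI[of _ "[]"]) auto
next
  case (Opening h F s ts)
  then show ?case by auto
next
  case (Closing h F s ts)
  then show ?case by auto
next
  case (Node h F us s ts)
  let ?t = "turn M (length us) (opp M h)"
  have "\<exists>vs. map card vs = concat (map node_degrees (us @ ts)) \<and> distinct vs \<and> set vs \<subseteq> vertices M \<and>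
    \<Union>(set vs) = set (visited M (?t @ s) (us @ ts)) - set (?t @ s)"
    using Node.prems by (intro Node.IH) (auto simp: visited_append)
  then obtain vs where vs: "map card vs = concat (map node_degrees (us @ ts))" "distinct vs"
    "set vs \<subseteq> vertices M" "\<Union>(set vs) = set (visited M (?t @ s) (us @ ts)) - set (?t @ s)" by blast
  have len: "length s = length ts" using explores_length[OF Node.hyps(4)] by simp
  have v: "visited M (h # s) (Node us # ts) = h # opp M h # visited M (?t @ s) (us @ ts)"
    by (simp add: visited_append)
  have sub: "set ?t \<subseteq> set (visited M ?t us)" "set s \<subseteq> set (visited M s ts)" "distinct ?t"
    using set_visited[of ?t us M] set_visited[of s ts M] distinct_visited[of ?t us M] Node.prems(1) len by auto
  have vt: "vertex_of M (opp M h) = set (opp M h # ?t)" by (rule vertex_of_turn[OF Node.hyps(3)])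
  have "distinct (opp M h # ?t)" using sub Node.prems(1) by auto
  then have "card (vertex_of M (opp M h)) = Suc (length us)"
    unfolding vt distinct_card[OF \<open>distinct (opp M h # ?t)\<close>] by simp
  moreover have "opp M h \<notin> set (visited M (?t @ s) (us @ ts))" using Node.prems(1) unfolding v by simp
  then have "opp M h \<notin> \<Union>(set vs)" unfolding vs(4) by blast
  then have "vertex_of M (opp M h) \<notin> set vs" using self_in_vertex by blast
  moreover have "vertex_of M (opp M h) \<in> vertices M"
    using Node.prems(2) by (auto simp: vertices_def)
  moreover have "vertex_of M (opp M h) \<union> \<Union>(set vs) = set (visited M (h # s) (Node us # ts)) - set (h # s)"
    unfolding vs(4) vt v using Node.prems(1) sub by (auto simp: visited_append)
  ultimately show ?case
    using vs by (intro exI[of _ "vertex_of M (opp M h) # vs"]) auto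
qed

end

text \<open>The edges that are excluded from the exploration tree: the marked ones and the root edge.\<close>

definition frozen :: "'h marked_map \<Rightarrow> 'h set" where
  "frozen M = marked M \<union> opp M ` marked M \<union> {root_half_edge M, opp M (root_half_edge M)}"

definition root_leaves :: "'h marked_map \<Rightarrow> unit blossom list \<Rightarrow> 'h list" where
  "root_leaves M ts = root_half_edge M # leaves M (turn M (length ts) (root_half_edge M)) ts"

definition root_visited :: "'h marked_map \<Rightarrow> unit blossom list \<Rightarrow> 'h list" where
  "root_visited M ts = root_half_edge M # visited M (turn M (length ts) (root_half_edge M)) ts"

definition spanned :: "'h marked_map \<Rightarrow> 'h set \<Rightarrow> unit blossom list \<Rightarrow> bool" where
  "spanned M A ts \<longleftrightarrow> marked_map M \<and> eulerian_orientation M A \<and> marked M \<subseteq> A \<and> root_half_edge M \<in> A \<and>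
     (rot M ^^ Suc (length ts)) (root_half_edge M) = root_half_edge M \<and>
     explores M A (frozen M) (turn M (length ts) (root_half_edge M)) ts \<and>
     distinct (root_visited M ts) \<and> set (root_visited M ts) = half_edges M"

text \<open>Leaves are addressed by positions, so a code does not mention half-edges and survives
  isomorphisms. Extensionality makes \<open>f\<close> and \<mu> unique as functions, and 0 can stand
  for unmarked because multiplicities are positive.\<close>

definition represents :: "'h marked_map \<Rightarrow> 'h set \<Rightarrow> unit blossom list \<Rightarrow> (nat \<Rightarrow> nat) \<Rightarrow> (nat \<Rightarrow> nat) \<Rightarrow> bool" where
  "represents M A ts f \<mu> \<longleftrightarrow> spanned M A ts \<and>
     f \<in> extensional {c. c < length (root_leaves M ts) \<and> root_leaves M ts ! c \<notin> A} \<and>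
     \<mu> \<in> extensional {c. c < length (root_leaves M ts) \<and> root_leaves M ts ! c \<notin> A} \<and>
     (\<forall>c<length (root_leaves M ts). root_leaves M ts ! c \<notin> A \<longrightarrow>
        f c < length (root_leaves M ts) \<and>
        opp M (root_leaves M ts ! c) = root_leaves M ts ! f c \<and>
        \<mu> c = (if root_leaves M ts ! f c \<in> marked M then edge_mult M (root_leaves M ts ! f c) else 0))"

lemma rmap_of_marked: "marked_map M \<Longrightarrow> rmap M"
  by (simp add: rmap_def marked_map_def)

lemma frozen_orientation:
  assumes "marked_map M" "eulerian_orientation M A" "marked M \<subseteq> A" "root_half_edge M \<in> A"
  shows "A \<inter> frozen M = marked M \<union> {root_half_edge M}" "opp M ` frozen M \<subseteq> frozen M"
proof -
  interpret rmap M using assms(1) by (rule rmap_of_marked)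
  have "marked M \<subseteq> half_edges M" using assms(1) by (simp add: marked_map_def)
  then have "opp M h \<notin> A" if "h \<in> marked M \<union> {root_half_edge M}" for h
    using that assms(3,4) root_in orientationD(2)[OF assms(2)] by blast
  then show "A \<inter> frozen M = marked M \<union> {root_half_edge M}"
    using assms(3,4) by (auto simp: frozen_def)
  show "opp M ` frozen M \<subseteq> frozen M" by (auto simp: frozen_def)
qed

lemma spanned_leaf_word:
  assumes "spanned M A ts"
  shows "map (\<lambda>h. h \<in> A) (root_leaves M ts) = True # map (\<lambda>l. l = None) (leaf_word (Node ts))"
  using assms explores_leaf_word by (auto simp: spanned_def root_leaves_def)

lemma spanned_closing_iff:
  assumes "spanned M A ts"
  shows "c < length (root_leaves M ts) \<and> root_leaves M ts ! c \<notin> A \<longleftrightarrow>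
    c < length (True # map (\<lambda>l. l = None) (leaf_word (Node ts))) \<and>
    \<not> (True # map (\<lambda>l. l = None) (leaf_word (Node ts))) ! c"
  unfolding spanned_leaf_word[OF assms, symmetric] by auto

lemma spanned_root:
  assumes "spanned M A ts"
  shows "length ts = card (vertex_of M (root_half_edge M)) - 1"
    and "distinct (root_half_edge M # turn M (length ts) (root_half_edge M))"
proof -
  let ?r = "root_half_edge M"
  let ?t = "turn M (length ts) ?r"
  interpret rmap M using assms by (intro rmap_of_marked) (simp add: spanned_def)
  have "(rot M ^^ Suc (length ts)) ?r = ?r" using assms by (simp add: spanned_def)
  then have v: "vertex_of M ?r = set (?r # ?t)" by (rule vertex_of_turn)
  have "distinct (?r # visited M ?t ts)" using assms by (simp add: spanned_def root_visited_def)
  then show dist: "distinct (?r # ?t)"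
    using set_visited[of ?t ts M] distinct_visited[of ?t ts M] by auto
  show "length ts = card (vertex_of M ?r) - 1"
    unfolding v distinct_card[OF dist] by simp
qed

text \<open>Leaves are the complement of the tree edges, which is closed under \<open>opp M\<close>.
  Marked edges are frozen from the start and hence never crossed.\<close>

lemma spanned_leaves:
  assumes "spanned M A ts"
  shows "distinct (root_leaves M ts)" "set (root_leaves M ts) \<subseteq> half_edges M"
    "opp M ` set (root_leaves M ts) \<subseteq> set (root_leaves M ts)" "marked M \<subseteq> set (root_leaves M ts)"
proof -
  let ?r = "root_half_edge M"
  let ?t = "turn M (length ts) ?r"
  let ?T = "set (tree_edges M ?t ts)"
  interpret rmap M using assms by (intro rmap_of_marked) (simp add: spanned_def)
  have dist: "distinct (?r # visited M ?t ts)" and H: "half_edges M = set (?r # visited M ?t ts)"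
    using assms by (auto simp: spanned_def root_visited_def)
  have L: "set (root_leaves M ts) = insert ?r (set (leaves M ?t ts))" by (simp add: root_leaves_def)
  show "distinct (root_leaves M ts)"
    using distinct_leaves(1)[of M ?t ts] set_leaves[of M ?t ts] dist by (auto simp: root_leaves_def)
  show sub: "set (root_leaves M ts) \<subseteq> half_edges M"
    using set_leaves[of M ?t ts] by (auto simp: root_leaves_def H)
  have part: "set (root_leaves M ts) = half_edges M - (?T \<union> opp M ` ?T)"
  proof -
    have "?r \<notin> ?T \<union> opp M ` ?T" using dist set_visited_eq[of M ?t ts] by auto
    moreover have "set (leaves M ?t ts) \<inter> (?T \<union> opp M ` ?T) = {}"
      by (rule distinct_leaves(2)) (use dist in simp)
    ultimately show ?thesis unfolding L H using set_visited_eq[of M ?t ts] by auto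
  qed
  show "opp M ` set (root_leaves M ts) \<subseteq> set (root_leaves M ts)"
  proof
    fix x assume "x \<in> opp M ` set (root_leaves M ts)"
    then obtain y where y: "x = opp M y" "y \<in> half_edges M" "y \<notin> ?T" "y \<notin> opp M ` ?T"
      unfolding part by blast
    have "opp M y \<notin> ?T" using y(4) opp_opp[of y] by (metis imageI)
    moreover have "opp M y \<notin> opp M ` ?T" using y(3) by auto
    ultimately show "x \<in> set (root_leaves M ts)" unfolding part using y by simp
  qed
  show "marked M \<subseteq> set (root_leaves M ts)"
  proof
    fix h assume h: "h \<in> marked M"
    have ex: "explores M A (frozen M) ?t ts" using assms by (simp add: spanned_def)
    have "h \<in> half_edges M" using assms h by (auto simp: spanned_def marked_map_def)
    moreover have "h \<notin> ?T" using explores_tree_edges[OF ex, of h] h by (auto simp: frozen_def)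
    moreover have "h \<notin> opp M ` ?T"
    proof
      assume "h \<in> opp M ` ?T"
      then have "opp M h \<in> ?T" by auto
      then show False using explores_tree_edges[OF ex, of "opp M h"] h by (auto simp: frozen_def)
    qed
    ultimately show "h \<in> set (root_leaves M ts)" unfolding part by blast
  qed
qed

text \<open>\<open>f\<close> is only prescribed at closing leaves; the opposite of an opening leaf
  inverts it.\<close>

lemma represents_opening:
  assumes R: "represents M A ts f \<mu>" and c: "c < length (root_leaves M ts)" "root_leaves M ts ! c \<in> A"
  obtains c' where "c' < length (root_leaves M ts)" "root_leaves M ts ! c' \<notin> A" "f c' = c"
    "opp M (root_leaves M ts ! c) = root_leaves M ts ! c'"
proof -
  have S: "spanned M A ts" using R by (simp add: represents_def)
  interpret rmap M using S by (intro rmap_of_marked) (simp add: spanned_def)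
  let ?L = "root_leaves M ts"
  have "opp M (?L ! c) \<in> set ?L" using spanned_leaves(3)[OF S] c by force
  then obtain c' where c': "c' < length ?L" "?L ! c' = opp M (?L ! c)" by (auto simp: in_set_conv_nth)
  have "?L ! c \<in> half_edges M" using spanned_leaves(2)[OF S] c by (meson nth_mem subsetD)
  then have n: "?L ! c' \<notin> A"
    using c c' S orientationD(2)[of A "?L ! c"] by (simp add: spanned_def)
  then have "f c' < length ?L" "opp M (?L ! c') = ?L ! f c'"
    using R c' by (auto simp: represents_def)
  then have "?L ! c = ?L ! f c'" using c' by simp
  then have "f c' = c" using spanned_leaves(1)[OF S] c \<open>f c' < length ?L\<close> by (simp add: nth_eq_iff_index_eq)
  then show thesis using that c' n by simp
qed

lemma represents_unique:
  assumes R: "represents M A ts f \<mu>" and R': "represents M B ts' f' \<mu>'"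
  shows "ts = ts' \<and> f = f' \<and> \<mu> = \<mu>'"
proof -
  have S: "spanned M A ts" "spanned M B ts'" using R R' by (auto simp: represents_def)
  have MM: "marked_map M" using S by (simp add: spanned_def)
  interpret rmap M using MM by (rule rmap_of_marked)
  have len: "length ts = length ts'"
    using spanned_root(1)[OF S(1)] spanned_root(1)[OF S(2)] by simp
  have ts: "ts = ts'"
  proof (rule explores_unique)
    show "explores M A (frozen M) (turn M (length ts) (root_half_edge M)) ts"
      "explores M B (frozen M) (turn M (length ts) (root_half_edge M)) ts'"
      using S len by (auto simp: spanned_def)
    show "A \<inter> frozen M = B \<inter> frozen M"
      using frozen_orientation(1)[OF MM, of A] frozen_orientation(1)[OF MM, of B] S by (simp add: spanned_def)
    show "opp M ` frozen M \<subseteq> frozen M"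
      using frozen_orientation(2)[OF MM, of A] S by (simp add: spanned_def)
  qed (use S len in \<open>auto simp: spanned_def root_visited_def\<close>)
  let ?L = "root_leaves M ts"
  have AB: "c < length ?L \<and> ?L ! c \<notin> A \<longleftrightarrow> c < length ?L \<and> ?L ! c \<notin> B" for c
    using spanned_closing_iff[OF S(1), of c] spanned_closing_iff[OF S(2), of c] ts by simp
  have "f c = f' c \<and> \<mu> c = \<mu>' c" for c
  proof (cases "c < length ?L \<and> ?L ! c \<notin> A")
    case True
    then have True': "c < length ?L \<and> ?L ! c \<notin> B" using AB by blast
    have *: "f c < length ?L" "opp M (?L ! c) = ?L ! f c"
      "\<mu> c = (if ?L ! f c \<in> marked M then edge_mult M (?L ! f c) else 0)"
      using R True unfolding represents_def by blast+
    have **: "f' c < length ?L" "opp M (?L ! c) = ?L ! f' c"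
      "\<mu>' c = (if ?L ! f' c \<in> marked M then edge_mult M (?L ! f' c) else 0)"
      using R' True' ts unfolding represents_def by blast+
    have "f c = f' c"
      using * ** spanned_leaves(1)[OF S(1)] by (metis nth_eq_iff_index_eq)
    with * ** show ?thesis by simp
  next
    case False
    then have False': "\<not> (c < length ?L \<and> ?L ! c \<notin> B)" using AB by blast
    have "f c = undefined" "\<mu> c = undefined"
      using R False by (auto simp: represents_def extensional_def)
    moreover have "f' c = undefined" "\<mu>' c = undefined"
      using R' False' ts by (auto simp: represents_def extensional_def)
    ultimately show ?thesis by simp
  qed
  then show ?thesis using ts by (auto simp: fun_eq_iff)
qed

lemma admissible_represented:
  assumes MM: "marked_map M" and eul: "eulerian_map M" and adm: "admissible M"
  obtains A ts f \<mu> where "represents M A ts f \<mu>"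
proof -
  interpret rmap M using MM by (rule rmap_of_marked)
  let ?r = "root_half_edge M"
  obtain A0 where A0: "eulerian_orientation M A0" "marked M \<subseteq> A0" "root_accessible M A0" "?r \<in> A0"
    using adm by (auto simp: admissible_def compatible_def)
  obtain n where cl: "(rot M ^^ Suc n) ?r = ?r" and dt: "distinct (?r # turn M n ?r)"
    using turn_exists[OF refl] by blast
  have vt: "vertex_of M ?r = set (?r # turn M n ?r)" by (rule vertex_of_turn[OF cl])
  let ?Z = "half_edges M - vertex_of M ?r"
  have "\<exists>B ts. eulerian_orientation M B \<and> B \<inter> frozen M = A0 \<inter> frozen M \<and>
      explores M B (frozen M) (turn M n ?r) ts \<and>
      distinct (visited M (turn M n ?r) ts) \<and> set (visited M (turn M n ?r) ts) = set (turn M n ?r) \<union> ?Z"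
  proof (rule explores_exists[OF A0(1)])
    show "opp M ` frozen M \<subseteq> frozen M" by (rule frozen_orientation(2)[OF MM A0(1,2,4)])
    show "set (turn M n ?r) \<subseteq> half_edges M" using vertex_of_subset[OF root_in] unfolding vt by simp
    show "rot_closed ?Z"
      by (rule rot_closed_Diff[OF _ rot_closed_vertex[OF root_in]]) (simp add: rot_closed_def vertex_of_subset)
    show "half_edges M - (set (turn M n ?r) \<union> ?Z) \<subseteq> frozen M"
      unfolding vt by (auto simp: frozen_def)
    show "set (turn M n ?r) \<inter> ?Z = {}" unfolding vt by auto
    show "sorted_wrt (separated A0 (frozen M)) (turn M n ?r)"
    proof -
      have sv: "vertex_of M g = vertex_of M ?r" if "g \<in> set (turn M n ?r)" for g
      proof (rule vertex_of_eq)
        show "g \<in> vertex_of M ?r" unfolding vt using that by simp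
      qed
      show ?thesis
      proof (rule sorted_wrt_mono_rel[of _ "\<lambda>_ _. True"])
        fix g g' assume "g \<in> set (turn M n ?r)" "g' \<in> set (turn M n ?r)"
        then have "vertex_of M g = vertex_of M g'" by (simp only: sv)
        then show "separated A0 (frozen M) g g'" unfolding separated_def ..
      qed (simp add: sorted_wrt_iff_nth_less)
    qed
    fix W assume W: "rot_closed W" "W \<subseteq> ?Z" "W \<noteq> {}"
    then obtain g where g: "g \<in> W" by blast
    then have "vertex_of M g \<in> vertices M" using W by (auto simp: vertices_def)
    then have acc: "(vertex_of M g, vertex_of M ?r) \<in> (unmarked_step M A0)\<^sup>*"
      using A0(3) by (simp add: root_accessible_def)
    \<comment> \<open>A path of unmarked edges from \<open>W\<close> to the root vertex must leave
      \<open>W\<close>; this turns accessibility into the form used by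
      \<open>explores_exists\<close>.\<close>
    have cross: "\<exists>h. h \<in> W \<and> opp M h \<notin> W \<and> h \<in> A0 \<and> h \<notin> marked M \<and> opp M h \<notin> marked M"
      if "(u, v) \<in> (unmarked_step M A0)\<^sup>*" "u \<subseteq> W" "\<not> v \<subseteq> W" for u v
      using that
    proof (induction rule: rtrancl_induct)
      case (step v w)
      show ?case
      proof (cases "v \<subseteq> W")
        case True
        obtain h where h: "v = vertex_of M h" "w = vertex_of M (opp M h)" "h \<in> A0" "h \<notin> marked M" "opp M h \<notin> marked M"
          using step(2) by (auto simp: unmarked_step_def)
        have "h \<in> W" using True h(1) self_in_vertex by blast
        moreover have "opp M h \<notin> W" using step.prems(2) W(1) h(2) unfolding rot_closed_def by blast
        ultimately show ?thesis using h by blast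
      next
        case False
        then show ?thesis using step.IH step.prems(1) by blast
      qed
    qed blast
    have "vertex_of M g \<subseteq> W" using W(1) g unfolding rot_closed_def by blast
    moreover have "\<not> vertex_of M ?r \<subseteq> W" using W(2) self_in_vertex[of ?r] by blast
    ultimately obtain h where h: "h \<in> W" "opp M h \<notin> W" "h \<in> A0" "h \<notin> marked M" "opp M h \<notin> marked M"
      using cross[OF acc] by blast
    \<comment> \<open>The edge found is not the root edge: \<open>?r\<close> lies outside
      \<open>W\<close>, and the opposite of \<open>?r\<close> is a head.\<close>
    have "h \<noteq> ?r" using h(1) W(2) self_in_vertex by blast
    moreover have "h \<noteq> opp M ?r" using h(3) A0(4) orientationD(2)[OF A0(1) root_in] by blast
    moreover have "h \<notin> opp M ` marked M" using h(5) by auto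
    ultimately have "h \<notin> frozen M" using h(4) by (auto simp: frozen_def)
    then show "(boundary W - frozen M) \<inter> A0 \<noteq> {}" using h by (auto simp: boundary_def)
  qed (use dt in auto)
  then obtain A ts where A: "eulerian_orientation M A" "A \<inter> frozen M = A0 \<inter> frozen M"
    "explores M A (frozen M) (turn M n ?r) ts"
    "distinct (visited M (turn M n ?r) ts)" "set (visited M (turn M n ?r) ts) = set (turn M n ?r) \<union> ?Z" by blast
  have n: "length ts = n" using explores_length[OF A(3)] by simp
  have "marked M \<subseteq> A" "?r \<in> A"
    using A(2) frozen_orientation(1)[OF MM A0(1,2,4)] by auto
  moreover have "set (?r # visited M (turn M n ?r) ts) = half_edges M"
    using A(5) vertex_of_subset[OF root_in] unfolding vt by auto
  moreover have "?r \<notin> set (visited M (turn M n ?r) ts)"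
    unfolding A(5) vt using dt by auto
  ultimately have S: "spanned M A ts"
    using A MM cl n by (auto simp: spanned_def root_visited_def)
  let ?L = "root_leaves M ts"
  let ?C = "{c. c < length ?L \<and> ?L ! c \<notin> A}"
  define f where "f = restrict (\<lambda>c. SOME d. d < length ?L \<and> opp M (?L ! c) = ?L ! d) ?C"
  define \<mu> where "\<mu> = restrict (\<lambda>c. if ?L ! f c \<in> marked M then edge_mult M (?L ! f c) else 0) ?C"
  have fC: "f c < length ?L \<and> opp M (?L ! c) = ?L ! f c" if "c \<in> ?C" for c
  proof -
    have "opp M (?L ! c) \<in> set ?L" using spanned_leaves(3)[OF S] that by force
    then have "\<exists>d. d < length ?L \<and> opp M (?L ! c) = ?L ! d" by (metis in_set_conv_nth)
    from someI_ex[OF this] show ?thesis using that by (simp add: f_def)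
  qed
  have "f \<in> extensional ?C" "\<mu> \<in> extensional ?C" unfolding f_def \<mu>_def by simp_all
  moreover have "\<mu> c = (if ?L ! f c \<in> marked M then edge_mult M (?L ! f c) else 0)" if "c \<in> ?C" for c
    using that unfolding \<mu>_def by simp
  ultimately have "represents M A ts f \<mu>"
    using S fC unfolding represents_def by blast
  then show thesis by (rule that)
qed

lemma represents_code:
  assumes R: "represents M A ts f \<mu>" and i: "(\<Sum>h\<in>marked M. edge_mult M h) < i"
  shows "(Node ts, f, \<mu>) \<in> codes i"
proof -
  have S: "spanned M A ts" using R by (simp add: represents_def)
  have MM: "marked_map M" and A: "eulerian_orientation M A" "marked M \<subseteq> A" "root_half_edge M \<in> A"
    using S by (auto simp: spanned_def)
  interpret rmap M using MM by (rule rmap_of_marked)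
  let ?r = "root_half_edge M"
  let ?t = "turn M (length ts) ?r"
  let ?L = "root_leaves M ts"
  let ?w = "True # map (\<lambda>l. l = None) (leaf_word (Node ts))"
  have ex: "explores M A (frozen M) ?t ts" and dist: "distinct (?r # visited M ?t ts)"
    and H: "set (?r # visited M ?t ts) = half_edges M"
    using S by (auto simp: spanned_def root_visited_def)
  have "eulerian_nodes (Node ts)"
    using explores_eulerian[OF ex A(1)] dist H
      eulerian_turn[OF A(1) root_in A(3) _ spanned_root(2)[OF S] explores_opening[OF ex]] S
    by (auto simp: spanned_def)
  moreover have "(f, \<mu>) \<in> decorations i ?w"
  proof -
    have Lw: "map (\<lambda>h. h \<in> A) ?L = ?w" by (rule spanned_leaf_word[OF S])
    have len: "length ?w = length ?L" unfolding Lw[symmetric] by simp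
    have wc: "?w ! c \<longleftrightarrow> ?L ! c \<in> A" if "c < length ?L" for c
      unfolding Lw[symmetric] using that by simp
    define C where "C = {c. c < length ?L \<and> ?L ! c \<notin> A}"
    have C: "{c. c < length ?w \<and> \<not> ?w ! c} = C"
      unfolding C_def len using wc by blast
    have O: "{c. c < length ?w \<and> ?w ! c} = {c. c < length ?L \<and> ?L ! c \<in> A}"
      unfolding len using wc by blast
    have fC: "f c < length ?L" "opp M (?L ! c) = ?L ! f c"
      "\<mu> c = (if ?L ! f c \<in> marked M then edge_mult M (?L ! f c) else 0)" if "c \<in> C" for c
      using R that unfolding represents_def C_def by blast+
    have LH: "?L ! c \<in> half_edges M" if "c < length ?L" for c
      using spanned_leaves(2)[OF S] that by (meson nth_mem subsetD)
    have fA: "?L ! f c \<in> A" if "c \<in> C" for c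
      using fC[OF that] that LH orientationD(2)[OF A(1), of "?L ! c"] by (simp add: C_def)
    have inj: "inj_on f C"
    proof (rule inj_onI)
      fix c d assume cd: "c \<in> C" "d \<in> C" "f c = f d"
      then have "opp M (?L ! c) = opp M (?L ! d)" using fC by metis
      then have "?L ! c = ?L ! d" by simp
      then show "c = d" using cd spanned_leaves(1)[OF S] by (simp add: C_def nth_eq_iff_index_eq)
    qed
    have img: "f ` C = {c. c < length ?L \<and> ?L ! c \<in> A}"
    proof (intro set_eqI iffI)
      fix c assume "c \<in> {c. c < length ?L \<and> ?L ! c \<in> A}"
      then obtain c' where "c' \<in> C" "f c' = c"
        using represents_opening[OF R, of c] by (auto simp: C_def)
      then show "c \<in> f ` C" by blast
    qed (use fC fA in auto)
    \<comment> \<open>A closing leaf of an unmarked edge was either stopped by the initial frozen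
      set, in which case it belongs to the root edge and its partner has position 0, or the other
      half of its edge is an earlier leaf.\<close>
    have small: "f c < c" if c: "c \<in> C" "\<mu> c = 0" for c
    proof -
      have cl: "c < length ?L" "?L ! c \<notin> A" using c by (auto simp: C_def)
      have "c \<noteq> 0"
      proof
        assume "c = 0"
        then show False using cl A(3) by (simp add: root_leaves_def)
      qed
      then obtain k where k: "c = Suc k" by (cases c) auto
      let ?l = "leaves M ?t ts"
      have kl: "k < length ?l" "?l ! k = ?L ! c" using cl k by (auto simp: root_leaves_def)
      have "?l = take k ?l @ ?l ! k # drop (Suc k) ?l" by (rule id_take_nth_drop[OF kl(1)])
      then have *: "?l ! k \<in> frozen M \<or> ?l ! k \<in> set (take k ?l) \<or> opp M (?l ! k) \<in> set (take k ?l) \<or>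
          (\<exists>g\<in>set (take k ?l). ?l ! k = opp M g)"
        using dist cl kl by (intro explores_closing[OF ex]) auto
      have dl: "distinct ?l" using spanned_leaves(1)[OF S] by (simp add: root_leaves_def)
      have "?l ! k \<notin> set (take k ?l)"
      proof
        assume "?l ! k \<in> set (take k ?l)"
        then obtain j where "j < k" "?l ! j = ?l ! k" by (auto simp: in_set_conv_nth)
        then show False using nth_eq_iff_index_eq[OF dl, of j k] kl(1) by simp
      qed
      then consider "?l ! k \<in> frozen M" | "opp M (?l ! k) \<in> set (take k ?l)" using * by auto
      then have "\<exists>d<c. opp M (?L ! c) = ?L ! d"
      proof cases
        case 1
        have nm: "?L ! f c \<notin> marked M"
          using fC(3)[OF c(1)] c(2) MM by (auto simp: marked_map_def)
        have "?L ! c \<notin> marked M" using cl A(2) by blast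
        moreover have "?L ! c \<notin> opp M ` marked M" using nm fC(2)[OF c(1)] by auto
        moreover have "?L ! c \<noteq> ?r" using cl A(3) by auto
        ultimately have "?L ! c = opp M ?r" using 1 kl by (auto simp: frozen_def)
        then have "opp M (?L ! c) = ?L ! 0" by (simp add: root_leaves_def)
        then show ?thesis using \<open>c \<noteq> 0\<close> by blast
      next
        case 2
        then obtain j where j: "j < k" "j < length ?l" "?l ! j = opp M (?l ! k)"
          by (auto simp: in_set_conv_nth)
        then have "opp M (?L ! c) = ?L ! Suc j" using kl by (simp add: root_leaves_def)
        then show ?thesis using j k by blast
      qed
      then obtain d where d: "d < c" "?L ! f c = ?L ! d" using fC(2)[OF c(1)] by metis
      then have "f c = d" using spanned_leaves(1)[OF S] cl fC(1)[OF c(1)] by (simp add: nth_eq_iff_index_eq)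
      then show ?thesis using d by simp
    qed
    have "sum \<mu> C < i"
    proof -
      let ?g = "\<lambda>c. ?L ! f c"
      have fin: "finite C" by (simp add: C_def)
      have injg: "inj_on ?g C"
      proof (rule inj_onI)
        fix c d assume cd: "c \<in> C" "d \<in> C" "?L ! f c = ?L ! f d"
        then have "f c = f d" using fC(1) spanned_leaves(1)[OF S] by (simp add: nth_eq_iff_index_eq)
        then show "c = d" using inj cd by (simp add: inj_on_def)
      qed
      have "sum \<mu> C = (\<Sum>c\<in>C. (\<lambda>h. if h \<in> marked M then edge_mult M h else 0) (?g c))"
        by (intro sum.cong refl) (simp add: fC)
      also have "\<dots> = (\<Sum>h\<in>?g ` C. if h \<in> marked M then edge_mult M h else 0)"
        by (subst sum.reindex[OF injg]) simp
      \<comment> \<open>Marked tails are opening leaves and so lie in the range of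
        \<open>?g\<close>; unmarked tails contribute 0.\<close>
      also have "\<dots> = (\<Sum>h\<in>marked M. edge_mult M h)"
      proof (rule sum.mono_neutral_cong_right)
        show "marked M \<subseteq> ?g ` C"
        proof
          fix h assume h: "h \<in> marked M"
          then obtain c where c: "c < length ?L" "?L ! c = h"
            using spanned_leaves(4)[OF S] by (metis in_set_conv_nth subsetD)
          then have "c \<in> f ` C" using h A(2) img by auto
          then show "h \<in> ?g ` C" using c by auto
        qed
      qed (use fin in auto)
      finally show ?thesis using i by simp
    qed
    moreover have "f \<in> extensional C" "\<mu> \<in> extensional C"
      using R unfolding represents_def C_def by blast+
    moreover have "\<forall>c. c < length ?w \<and> \<not> ?w ! c \<and> \<mu> c = 0 \<longrightarrow> f c < c"
      using small C by blast
    moreover have "bij_betw f C {c. c < length ?L \<and> ?L ! c \<in> A}"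
      using inj img by (simp add: bij_betw_def)
    ultimately show ?thesis
      unfolding decorations_def mem_Collect_eq prod.case C O by blast
  qed
  ultimately show ?thesis unfolding codes_def by blast
qed

section \<open>Invariance of codes under isomorphism\<close>

context rmap
begin

lemma rot_pow_in: "h \<in> half_edges M \<Longrightarrow> (rot M ^^ k) h \<in> half_edges M"
  by (induction k) (auto simp: permutes_in_image[OF rot_permutes])

lemma turn_in: "h \<in> half_edges M \<Longrightarrow> set (turn M n h) \<subseteq> half_edges M"
  using rot_pow_in[of h "Suc _"] by (auto simp: turn_def simp del: funpow.simps)

end

locale rmap_iso = rmap M for M :: "'h marked_map" +
  fixes N :: "'k marked_map" and \<phi> :: "'h \<Rightarrow> 'k"
  assumes iso: "marked_map_iso M N \<phi>" and rmN: "rooted_map N"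
begin

sublocale N: rmap N by unfold_locales (rule rmN)

lemma phi_bij: "bij_betw \<phi> (half_edges M) (half_edges N)"
  and phi_rot: "h \<in> half_edges M \<Longrightarrow> \<phi> (rot M h) = rot N (\<phi> h)"
  and phi_opp: "h \<in> half_edges M \<Longrightarrow> \<phi> (opp M h) = opp N (\<phi> h)"
  and phi_root: "\<phi> (root_half_edge M) = root_half_edge N"
  and phi_marked: "\<phi> ` marked M = marked N"
  and phi_mult: "h \<in> marked M \<Longrightarrow> edge_mult N (\<phi> h) = edge_mult M h"
  using iso by (auto simp: marked_map_iso_def)

lemma phi_inj: "inj_on \<phi> (half_edges M)" and phi_image: "\<phi> ` half_edges M = half_edges N"
  using phi_bij by (auto simp: bij_betw_def)

lemma phi_mem: "h \<in> half_edges M \<Longrightarrow> X \<subseteq> half_edges M \<Longrightarrow> \<phi> h \<in> \<phi> ` X \<longleftrightarrow> h \<in> X"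
  by (rule inj_on_image_mem_iff[OF phi_inj])

lemma phi_pow: "h \<in> half_edges M \<Longrightarrow> \<phi> ((rot M ^^ k) h) = (rot N ^^ k) (\<phi> h)"
  by (induction k) (auto simp: phi_rot rot_pow_in)

lemma phi_turn: "h \<in> half_edges M \<Longrightarrow> turn N n (\<phi> h) = map \<phi> (turn M n h)"
  unfolding turn_def using phi_pow[of h "Suc _"] by (simp del: funpow.simps)

lemma phi_turn_opp:
  "h \<in> half_edges M \<Longrightarrow> turn N n (opp N (\<phi> h)) = map \<phi> (turn M n (opp M h))"
  using phi_turn[of "opp M h" n] by (simp add: phi_opp)

text \<open>The induction is on the size of the forest, since the recursion goes along the list as
  well as below its nodes.\<close>

lemma phi_visited_leaves:
  "set s \<subseteq> half_edges M \<Longrightarrow>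
     visited N (map \<phi> s) ts = map \<phi> (visited M s ts) \<and> leaves N (map \<phi> s) ts = map \<phi> (leaves M s ts)"
proof (induction "size_list size ts" arbitrary: s ts rule: less_induct)
  case less
  show ?case
  proof (cases s)
    case (Cons h s')
    then have h: "h \<in> half_edges M" "set s' \<subseteq> half_edges M" using less.prems by auto
    show ?thesis
    proof (cases ts)
      case ts: (Cons t ts')
      have IH: "visited N (map \<phi> s') ts' = map \<phi> (visited M s' ts')" "leaves N (map \<phi> s') ts' = map \<phi> (leaves M s' ts')"
        using less.hyps[of ts' s'] h ts by auto
      show ?thesis
      proof (cases t)
        case (Node us)
        let ?t = "turn M (length us) (opp M h)"
        have "set ?t \<subseteq> half_edges M" using h by (intro turn_in) simp
        then have "visited N (map \<phi> ?t) us = map \<phi> (visited M ?t us)" "leaves N (map \<phi> ?t) us = map \<phi> (leaves M ?t us)"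
          using less.hyps[of us ?t] ts Node by auto
        then show ?thesis
          using IH h ts Node Cons by (simp add: phi_turn_opp phi_opp)
      qed (use IH ts Cons in auto)
    qed (use Cons in auto)
  qed auto
qed

lemma phi_explores:
  "explores M A F s ts \<Longrightarrow> A \<subseteq> half_edges M \<Longrightarrow> F \<subseteq> half_edges M \<Longrightarrow> set s \<subseteq> half_edges M \<Longrightarrow>
    explores N (\<phi> ` A) (\<phi> ` F) (map \<phi> s) ts"
proof (induction rule: explores.induct)
  case (Nil F)
  then show ?case by (simp add: explores.Nil)
next
  case (Opening h F s ts)
  then have h: "h \<in> half_edges M" by simp
  have "explores N (\<phi> ` A) (\<phi> ` (F \<union> {h, opp M h})) (map \<phi> s) ts"
    using Opening.prems by (intro Opening.IH) auto
  then have "explores N (\<phi> ` A) (\<phi> ` F \<union> {\<phi> h, opp N (\<phi> h)}) (map \<phi> s) ts"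
    using h by (simp add: phi_opp)
  from explores.Opening[OF imageI[OF Opening.hyps(1)] this] show ?case by simp
next
  case (Closing h F s ts)
  then have h: "h \<in> half_edges M" by simp
  have "explores N (\<phi> ` A) (\<phi> ` (F \<union> {h, opp M h})) (map \<phi> s) ts"
    using Closing.prems by (intro Closing.IH) auto
  then have ex: "explores N (\<phi> ` A) (\<phi> ` F \<union> {\<phi> h, opp N (\<phi> h)}) (map \<phi> s) ts"
    using h by (simp add: phi_opp)
  have "\<phi> h \<notin> \<phi> ` A" using phi_mem[OF h Closing.prems(1)] Closing.hyps(1) by simp
  from explores.Closing[OF this imageI[OF Closing.hyps(2)] ex] show ?case by simp
next
  case (Node h F us s ts)
  then have h: "h \<in> half_edges M" by simp
  let ?t = "turn M (length us) (opp M h)"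
  have "set ?t \<subseteq> half_edges M" using h by (intro turn_in) simp
  then have "explores N (\<phi> ` A) (\<phi> ` (F \<union> {h, opp M h})) (map \<phi> (?t @ s)) (us @ ts)"
    using Node.prems by (intro Node.IH) auto
  then have ex: "explores N (\<phi> ` A) (\<phi> ` F \<union> {\<phi> h, opp N (\<phi> h)}) (turn N (length us) (opp N (\<phi> h)) @ map \<phi> s) (us @ ts)"
    using h by (simp add: phi_turn_opp phi_opp)
  have "(rot N ^^ Suc (length us)) (opp N (\<phi> h)) = \<phi> ((rot M ^^ Suc (length us)) (opp M h))"
    using h phi_pow[of "opp M h" "Suc (length us)"] by (simp add: phi_opp del: funpow.simps)
  also have "\<dots> = opp N (\<phi> h)" unfolding Node.hyps(3) using h by (simp add: phi_opp)
  finally have cl: "(rot N ^^ Suc (length us)) (opp N (\<phi> h)) = opp N (\<phi> h)" .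
  have "\<phi> h \<notin> \<phi> ` A" "\<phi> h \<notin> \<phi> ` F" using h Node.hyps Node.prems by (auto simp: phi_mem)
  from explores.Node[OF this cl ex] show ?case by simp
qed

lemma phi_eulerian_orientation:
  assumes "eulerian_orientation M A"
  shows "eulerian_orientation N (\<phi> ` A)"
proof -
  have AH: "A \<subseteq> half_edges M" by (rule orientationD(1)[OF assms])
  have "orientation N (\<phi> ` A)"
    unfolding orientation_def
  proof (intro conjI ballI)
    show "\<phi> ` A \<subseteq> half_edges N" using AH phi_image by blast
    fix k assume "k \<in> half_edges N"
    then obtain h where h: "h \<in> half_edges M" "k = \<phi> h" using phi_image by blast
    have "opp N k \<in> \<phi> ` A \<longleftrightarrow> opp M h \<in> A"
      using h phi_mem[OF _ AH, of "opp M h"] by (simp add: phi_opp)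
    then show "k \<in> \<phi> ` A \<longleftrightarrow> opp N k \<notin> \<phi> ` A"
      using h phi_mem[OF h(1) AH] orientationD(2)[OF assms h(1)] by simp
  qed
  moreover have "2 * card (w \<inter> \<phi> ` A) = card w" if "w \<in> vertices N" for w
  proof -
    have "bij_betw ((`) \<phi>) (vertices M) (vertices N)"
      by (rule vertices_iso(1)[OF rm rmN phi_bij phi_rot])
    then have "w \<in> (`) \<phi> ` vertices M"
      using that bij_betw_imp_surj_on by blast
    then obtain v where v: "v \<in> vertices M" "w = \<phi> ` v" by blast
    have vH: "v \<subseteq> half_edges M" using v(1) vertex_of_subset by (auto simp: vertices_def)
    have "w \<inter> \<phi> ` A = \<phi> ` (v \<inter> A)"
      unfolding v(2) by (rule inj_on_image_Int[OF phi_inj vH AH, symmetric])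
    moreover have "card (\<phi> ` (v \<inter> A)) = card (v \<inter> A)"
      using vH by (intro card_image inj_on_subset[OF phi_inj]) auto
    moreover have "card w = card v"
      unfolding v(2) using vH by (intro card_image inj_on_subset[OF phi_inj])
    ultimately show ?thesis using assms v(1) by (simp add: eulerian_orientation_def)
  qed
  ultimately show ?thesis by (simp add: eulerian_orientation_def)
qed

text \<open>All ingredients of \<open>represents\<close> come from the structure of the map and from
  positions in lists; the former is transported by \<phi>, the latter do not change.\<close>

lemma phi_represents:
  assumes R: "represents M A ts f \<mu>" and N: "marked_map N"
  shows "represents N (\<phi> ` A) ts f \<mu>"
proof -
  let ?r = "root_half_edge M" and ?r' = "root_half_edge N"
  have S: "spanned M A ts" using R by (simp add: represents_def)
  have MM: "marked_map M" and A: "eulerian_orientation M A" "marked M \<subseteq> A" "?r \<in> A"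
    and cl: "(rot M ^^ Suc (length ts)) ?r = ?r"
    and ex: "explores M A (frozen M) (turn M (length ts) ?r) ts"
    and dist: "distinct (root_visited M ts)" and H: "set (root_visited M ts) = half_edges M"
    using S by (auto simp: spanned_def)
  have AH: "A \<subseteq> half_edges M" by (rule orientationD(1)[OF A(1)])
  have mH: "marked M \<subseteq> half_edges M" using MM by (simp add: marked_map_def)
  have fH: "frozen M \<subseteq> half_edges M" using mH root_in by (auto simp: frozen_def)
  have fN: "frozen N = \<phi> ` frozen M"
    using mH root_in phi_opp unfolding frozen_def phi_root[symmetric] phi_marked[symmetric]
    by (simp add: image_Un image_image subset_iff)
  have tN: "turn N (length ts) ?r' = map \<phi> (turn M (length ts) ?r)"
    unfolding phi_root[symmetric] by (rule phi_turn[OF root_in])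
  have tH: "set (turn M (length ts) ?r) \<subseteq> half_edges M" by (rule turn_in[OF root_in])
  have vN: "root_visited N ts = map \<phi> (root_visited M ts)"
    unfolding root_visited_def tN using phi_visited_leaves[OF tH, of ts] by (simp add: phi_root)
  have lN: "root_leaves N ts = map \<phi> (root_leaves M ts)"
    unfolding root_leaves_def tN using phi_visited_leaves[OF tH, of ts] by (simp add: phi_root)
  have SN: "spanned N (\<phi> ` A) ts"
    unfolding spanned_def
  proof (intro conjI)
    show "marked_map N" by (rule N)
    show "eulerian_orientation N (\<phi> ` A)" by (rule phi_eulerian_orientation[OF A(1)])
    show "marked N \<subseteq> \<phi> ` A" unfolding phi_marked[symmetric] using A(2) by blast
    show "?r' \<in> \<phi> ` A" unfolding phi_root[symmetric] using A(3) by blast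
    show "(rot N ^^ Suc (length ts)) ?r' = ?r'"
      unfolding phi_root[symmetric] phi_pow[OF root_in, symmetric] cl ..
    show "explores N (\<phi> ` A) (frozen N) (turn N (length ts) ?r') ts"
      unfolding fN tN by (rule phi_explores[OF ex AH fH tH])
    show "distinct (root_visited N ts)"
      unfolding vN using dist H phi_inj by (simp add: distinct_map)
    show "set (root_visited N ts) = half_edges N"
      unfolding vN set_map H by (rule phi_image)
  qed
  let ?L = "root_leaves M ts"
  have LH: "?L ! c \<in> half_edges M" if "c < length ?L" for c
    using spanned_leaves(2)[OF S] that by (meson nth_mem subsetD)
  have Ln: "root_leaves N ts ! c = \<phi> (?L ! c)" if "c < length ?L" for c
    using that by (simp add: lN)
  have LA: "root_leaves N ts ! c \<in> \<phi> ` A \<longleftrightarrow> ?L ! c \<in> A" if "c < length ?L" for c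
    unfolding Ln[OF that] by (rule phi_mem[OF LH[OF that] AH])
  have len: "length (root_leaves N ts) = length ?L" by (simp add: lN)
  have C: "{c. c < length (root_leaves N ts) \<and> root_leaves N ts ! c \<notin> \<phi> ` A} =
      {c. c < length ?L \<and> ?L ! c \<notin> A}"
    unfolding len using LA by blast
  have "f c < length ?L \<and> opp N (root_leaves N ts ! c) = root_leaves N ts ! f c \<and>
      \<mu> c = (if root_leaves N ts ! f c \<in> marked N then edge_mult N (root_leaves N ts ! f c) else 0)"
    if c: "c < length ?L" "?L ! c \<notin> A" for c
  proof -
    have *: "f c < length ?L" "opp M (?L ! c) = ?L ! f c"
      "\<mu> c = (if ?L ! f c \<in> marked M then edge_mult M (?L ! f c) else 0)"
      using R c unfolding represents_def by blast+
    have "root_leaves N ts ! f c \<in> marked N \<longleftrightarrow> ?L ! f c \<in> marked M"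
      unfolding Ln[OF *(1)] phi_marked[symmetric] by (rule phi_mem[OF LH[OF *(1)] mH])
    then show ?thesis
      using * Ln[OF c(1)] Ln[OF *(1)] phi_opp[OF LH[OF c(1)]] phi_mult[of "?L ! f c"] by simp
  qed
  then show ?thesis
    using SN R LA unfolding represents_def C unfolding len by blast
qed

end

lemma represents_iso:
  assumes "represents M A ts f \<mu>" "marked_map_iso M N \<phi>" "marked_map N"
  shows "represents N (\<phi> ` A) ts f \<mu>"
proof -
  interpret rmap_iso M N \<phi>
    using assms by unfold_locales (auto simp: represents_def spanned_def marked_map_def)
  show ?thesis by (rule phi_represents[OF assms(1,3)])
qed

section \<open>Maps with the same code are isomorphic\<close>

text \<open>The lengths only depend on the tree, so the lists of two maps can be zipped without
  loss.\<close>

lemma length_visited: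
  "length s = length ts \<Longrightarrow> length s' = length ts \<Longrightarrow>
    length (visited M s ts) = length (visited N s' ts) \<and> length (leaves M s ts) = length (leaves N s' ts)"
proof (induction "size_list size ts" arbitrary: s s' ts rule: less_induct)
  case less
  show ?case
  proof (cases ts)
    case ts: (Cons t ts')
    then obtain h u h' u' where s: "s = h # u" "s' = h' # u'" using less.prems by (cases s; cases s') auto
    have IH: "length (visited M u ts') = length (visited N u' ts')" "length (leaves M u ts') = length (leaves N u' ts')"
      using less.hyps[of ts' u u'] less.prems ts s by auto
    show ?thesis
    proof (cases t)
      case (Node us)
      have "length (visited M (turn M (length us) (opp M h)) us) = length (visited N (turn N (length us) (opp N h')) us) \<and>
        length (leaves M (turn M (length us) (opp M h)) us) = length (leaves N (turn N (length us) (opp N h')) us)"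
        using ts Node by (intro less.hyps) auto
      then show ?thesis using IH s ts Node by simp
    qed (use IH s ts in auto)
  qed (use less.prems in auto)
qed

lemma zip_visited_mono:
  assumes "length s = length ts" "length s' = length ts"
  shows "set (zip s s') \<subseteq> set (zip (visited M s ts) (visited N s' ts))"
    and "set (zip (leaves M s ts) (leaves N s' ts)) \<subseteq> set (zip (visited M s ts) (visited N s' ts))"
proof -
  have "set (zip s s') \<subseteq> set (zip (visited M s ts) (visited N s' ts)) \<and>
    set (zip (leaves M s ts) (leaves N s' ts)) \<subseteq> set (zip (visited M s ts) (visited N s' ts))"
    using assms
  proof (induction "size_list size ts" arbitrary: s s' ts rule: less_induct)
    case less
    show ?case
    proof (cases ts)
      case ts: (Cons t ts')
      then obtain h u h' u' where s: "s = h # u" "s' = h' # u'" using less.prems by (cases s; cases s') auto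
      have IH: "set (zip u u') \<subseteq> set (zip (visited M u ts') (visited N u' ts'))"
        "set (zip (leaves M u ts') (leaves N u' ts')) \<subseteq> set (zip (visited M u ts') (visited N u' ts'))"
        using less.hyps[of ts' u u'] less.prems ts s by auto
      show ?thesis
      proof (cases t)
        case (Node us)
        let ?t = "turn M (length us) (opp M h)" and ?t' = "turn N (length us) (opp N h')"
        have "set (zip (leaves M ?t us) (leaves N ?t' us)) \<subseteq> set (zip (visited M ?t us) (visited N ?t' us))"
          using less.hyps[of us ?t ?t'] ts Node by auto
        then show ?thesis using IH s ts Node length_visited[of ?t us ?t' M N] by auto
      qed (use IH s ts in auto)
    qed (use less.prems in auto)
  qed
  then show "set (zip s s') \<subseteq> set (zip (visited M s ts) (visited N s' ts))"
    "set (zip (leaves M s ts) (leaves N s' ts)) \<subseteq> set (zip (visited M s ts) (visited N s' ts))"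
    by blast+
qed

lemma zip_turn_rot:
  assumes "(rot M ^^ Suc n) x = x" "(rot N ^^ Suc n) y = y"
    and "(a, b) \<in> set (zip (x # turn M n x) (y # turn N n y))"
  shows "(rot M a, rot N b) \<in> set (zip (x # turn M n x) (y # turn N n y))"
proof -
  have "set (zip (x # turn M n x) (y # turn N n y)) = (\<lambda>k. ((rot M ^^ k) x, (rot N ^^ k) y)) ` {0..<Suc n}"
    unfolding Cons_turn zip_map_map zip_same_conv_map by (simp add: image_image del: upt_Suc)
  note eq = this
  from assms(3) obtain k where k: "k < Suc n" "a = (rot M ^^ k) x" "b = (rot N ^^ k) y"
    unfolding eq by auto
  show ?thesis
  proof (cases "k = n")
    case True
    then have "rot M a = (rot M ^^ 0) x" "rot N b = (rot N ^^ 0) y" using k assms(1,2) by simp_all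
    moreover have "0 \<in> {0..<Suc n}" by simp
    ultimately show ?thesis unfolding eq by blast
  next
    case False
    then have "Suc k \<in> {0..<Suc n}" using k by simp
    moreover have "rot M a = (rot M ^^ Suc k) x" "rot N b = (rot N ^^ Suc k) y" using k by simp_all
    ultimately show ?thesis unfolding eq by blast
  qed
qed

text \<open>Half-edges of the initial stack are excepted because their successors may belong to
  vertices entered before. At a new node, the successor of the last child is the half-edge toward
  the parent, at the same position in both maps.\<close>

lemma zip_visited_rot:
  assumes "explores M A F s ts" "explores N B G s' ts"
    and "(x, y) \<in> set (zip (visited M s ts) (visited N s' ts))"
  shows "(x, y) \<in> set (zip s s') \<or> (rot M x, rot N y) \<in> set (zip (visited M s ts) (visited N s' ts))"
  using assms
proof (induction arbitrary: G s' rule: explores.induct)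
  case (Nil F)
  then show ?case by simp
next
  case (Opening h F s ts)
  from Opening.prems(1) obtain h' u where "s' = h' # u" "explores N B (G \<union> {h', opp N h'}) u ts"
    by cases auto
  then show ?case using Opening.IH[of _ u] Opening.prems(2) by auto
next
  case (Closing h F s ts)
  from Closing.prems(1) obtain h' u where "s' = h' # u" "explores N B (G \<union> {h', opp N h'}) u ts"
    by cases auto
  then show ?case using Closing.IH[of _ u] Closing.prems(2) by auto
next
  case (Node h F us s ts)
  let ?t = "turn M (length us) (opp M h)"
  from Node.prems(1) obtain h' u where s': "s' = h' # u"
    and cl: "(rot N ^^ Suc (length us)) (opp N h') = opp N h'"
    and ex: "explores N B (G \<union> {h', opp N h'}) (turn N (length us) (opp N h') @ u) (us @ ts)"
    by cases auto
  let ?t' = "turn N (length us) (opp N h')"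
  have len: "length (visited M ?t us) = length (visited N ?t' us)"
    using length_visited[of ?t us ?t' M N] by simp
  have V: "visited M (h # s) (Node us # ts) = h # opp M h # visited M (?t @ s) (us @ ts)"
    "visited N (h' # u) (Node us # ts) = h' # opp N h' # visited N (?t' @ u) (us @ ts)"
    by (simp_all add: visited_append)
  let ?P = "set (zip (visited M (?t @ s) (us @ ts)) (visited N (?t' @ u) (us @ ts)))"
  have "set (zip (?t @ s) (?t' @ u)) \<subseteq> ?P"
    by (rule zip_visited_mono(1)[OF explores_length[OF Node.hyps(4)] explores_length[OF ex]])
  then have tP: "set (zip (opp M h # ?t) (opp N h' # ?t')) \<subseteq> insert (opp M h, opp N h') ?P" by auto
  have node: "(rot M a, rot N b) \<in> insert (opp M h, opp N h') ?P"
    if "(a, b) \<in> set (zip (opp M h # ?t) (opp N h' # ?t'))" for a b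
    using zip_turn_rot[OF Node.hyps(3) cl that] tP by blast
  consider "(x, y) = (h, h')" | "(x, y) = (opp M h, opp N h')" | "(x, y) \<in> ?P"
    using Node.prems(2) unfolding s' V by auto
  then show ?case
  proof cases
    case 1
    then show ?thesis using s' by simp
  next
    case 2
    then show ?thesis using node[of x y] unfolding s' V by auto
  next
    case 3
    from Node.IH[OF ex 3] show ?thesis
    proof
      assume "(x, y) \<in> set (zip (?t @ s) (?t' @ u))"
      then consider "(x, y) \<in> set (zip ?t ?t')" | "(x, y) \<in> set (zip s u)" by auto
      then show ?thesis
      proof cases
        case 1
        then show ?thesis using node[of x y] unfolding s' V by auto
      qed (simp add: s')
    next
      assume "(rot M x, rot N y) \<in> ?P"
      then show ?thesis unfolding s' V by simp
    qed
  qed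
qed

text \<open>The halves of a crossed edge are adjacent in both lists; only leaves have their opposite
  elsewhere, and that is governed by \<open>f\<close>.\<close>

lemma zip_visited_opp:
  assumes "rmap M" "rmap N" "length s = length ts" "length s' = length ts"
    and "(x, y) \<in> set (zip (visited M s ts) (visited N s' ts))"
  shows "(x, y) \<in> set (zip (leaves M s ts) (leaves N s' ts)) \<or>
    (opp M x, opp N y) \<in> set (zip (visited M s ts) (visited N s' ts))"
  using assms(3-)
proof (induction "size_list size ts" arbitrary: s s' ts rule: less_induct)
  case less
  show ?case
  proof (cases ts)
    case ts: (Cons t ts')
    then obtain h u h' u' where s: "s = h # u" "s' = h' # u'" using less.prems by (cases s; cases s') auto
    have IH: "(x, y) \<in> set (zip (leaves M u ts') (leaves N u' ts')) \<or>
        (opp M x, opp N y) \<in> set (zip (visited M u ts') (visited N u' ts'))"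
      if "(x, y) \<in> set (zip (visited M u ts') (visited N u' ts'))"
      using less.hyps[of ts' u u'] less.prems ts s that by auto
    show ?thesis
    proof (cases t)
      case (Node us)
      let ?t = "turn M (length us) (opp M h)" and ?t' = "turn N (length us) (opp N h')"
      have IH': "(x, y) \<in> set (zip (leaves M ?t us) (leaves N ?t' us)) \<or>
          (opp M x, opp N y) \<in> set (zip (visited M ?t us) (visited N ?t' us))"
        if "(x, y) \<in> set (zip (visited M ?t us) (visited N ?t' us))"
        using less.hyps[of us ?t ?t'] ts Node that by auto
      have len: "length (visited M ?t us) = length (visited N ?t' us)" "length (leaves M ?t us) = length (leaves N ?t' us)"
        using length_visited[of ?t us ?t' M N] by auto
      have V: "set (zip (visited M s ts) (visited N s' ts)) = {(h, h'), (opp M h, opp N h')} \<union>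
          set (zip (visited M ?t us) (visited N ?t' us)) \<union> set (zip (visited M u ts') (visited N u' ts'))"
        using s ts Node len by auto
      have L: "set (zip (leaves M s ts) (leaves N s' ts)) =
          set (zip (leaves M ?t us) (leaves N ?t' us)) \<union> set (zip (leaves M u ts') (leaves N u' ts'))"
        using s ts Node len by auto
      have "opp M (opp M h) = h" "opp N (opp N h') = h'"
        using rmap.opp_opp assms(1,2) by fast+
      then show ?thesis
        using less.prems(3) IH IH' unfolding V L by auto
    qed (use IH s ts less.prems in auto)
  qed (use less.prems in auto)
qed

text \<open>Pairing the visited half-edges position by position gives a relation that is closed
  under \<open>rot\<close> and \<open>opp\<close>; distinct and complete visits on both sides make
  it a bijection.\<close>

lemma represents_imp_iso:
  assumes R: "represents M A ts f \<mu>" and R': "represents N B ts f \<mu>"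
  shows "\<exists>\<phi>. marked_map_iso M N \<phi>"
proof -
  let ?r = "root_half_edge M" and ?r' = "root_half_edge N"
  let ?t = "turn M (length ts) ?r" and ?t' = "turn N (length ts) ?r'"
  have S: "spanned M A ts" "spanned N B ts" using R R' by (auto simp: represents_def)
  have MN: "marked_map M" "marked_map N" using S by (auto simp: spanned_def)
  have A: "marked M \<subseteq> A" "marked N \<subseteq> B" using S by (auto simp: spanned_def)
  interpret M: rmap M using MN(1) by (rule rmap_of_marked)
  interpret N: rmap N using MN(2) by (rule rmap_of_marked)
  let ?V = "root_visited M ts" and ?V' = "root_visited N ts"
  let ?L = "root_leaves M ts" and ?L' = "root_leaves N ts"
  have lens: "length (visited M ?t ts) = length (visited N ?t' ts)" "length (leaves M ?t ts) = length (leaves N ?t' ts)"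
    using length_visited[of ?t ts ?t' M N] by auto
  have len: "length ?V = length ?V'" "length ?L = length ?L'"
    using lens by (simp_all add: root_visited_def root_leaves_def)
  have dist: "distinct ?V" "distinct ?V'" and H: "set ?V = half_edges M" "set ?V' = half_edges N"
    using S by (auto simp: spanned_def)
  have dL: "distinct ?L" "distinct ?L'" using S spanned_leaves(1) by blast+
  define P where "P = set (zip ?V ?V')"
  have P: "P = insert (?r, ?r') (set (zip (visited M ?t ts) (visited N ?t' ts)))"
    by (simp add: P_def root_visited_def)
  have LP: "set (zip ?L ?L') \<subseteq> P"
    unfolding P using zip_visited_mono(2)[of ?t ts ?t' M N] by (auto simp: root_leaves_def)
  have Prot: "(rot M x, rot N y) \<in> P" if "(x, y) \<in> P" for x y
  proof -
    have root: "(rot M x, rot N y) \<in> P" if "(x, y) \<in> set (zip (?r # ?t) (?r' # ?t'))" for x y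
    proof -
      have "(rot M x, rot N y) \<in> set (zip (?r # ?t) (?r' # ?t'))"
        using S that by (intro zip_turn_rot) (auto simp: spanned_def)
      then show ?thesis unfolding P using zip_visited_mono(1)[of ?t ts ?t' M N] by auto
    qed
    show ?thesis
    proof (cases "(x, y) = (?r, ?r')")
      case True
      then show ?thesis by (intro root) simp
    next
      case False
      then have "(x, y) \<in> set (zip (visited M ?t ts) (visited N ?t' ts))" using that unfolding P by auto
      then have "(x, y) \<in> set (zip ?t ?t') \<or> (rot M x, rot N y) \<in> set (zip (visited M ?t ts) (visited N ?t' ts))"
        using S by (intro zip_visited_rot[of M A "frozen M" ?t ts N B "frozen N"]) (auto simp: spanned_def)
      then show ?thesis using root[of x y] unfolding P by auto
    qed
  qed
  have AB: "?L ! c \<in> A \<longleftrightarrow> ?L' ! c \<in> B" if "c < length ?L" for c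
  proof -
    have "c < length ?L \<and> ?L ! c \<notin> A \<longleftrightarrow> c < length ?L' \<and> ?L' ! c \<notin> B"
      unfolding spanned_closing_iff[OF S(1)] spanned_closing_iff[OF S(2)] ..
    then show ?thesis using that len(2) by simp
  qed
  have cl: "f c < length ?L" "opp M (?L ! c) = ?L ! f c" "opp N (?L' ! c) = ?L' ! f c"
    "\<mu> c = (if ?L ! f c \<in> marked M then edge_mult M (?L ! f c) else 0)"
    "\<mu> c = (if ?L' ! f c \<in> marked N then edge_mult N (?L' ! f c) else 0)"
    if c: "c < length ?L" "?L ! c \<notin> A" for c
  proof -
    have c': "c < length ?L'" "?L' ! c \<notin> B" using c AB len by auto
    show "f c < length ?L" "opp M (?L ! c) = ?L ! f c"
      "\<mu> c = (if ?L ! f c \<in> marked M then edge_mult M (?L ! f c) else 0)"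
      using R c unfolding represents_def by blast+
    show "opp N (?L' ! c) = ?L' ! f c"
      "\<mu> c = (if ?L' ! f c \<in> marked N then edge_mult N (?L' ! f c) else 0)"
      using R' c' unfolding represents_def by blast+
  qed
  \<comment> \<open>The common \<open>f\<close> determines opposites of leaves, directly at a
    closing leaf and through its inverse at an opening one.\<close>
  have Lopp: "(opp M (?L ! c), opp N (?L' ! c)) \<in> set (zip ?L ?L')" if c: "c < length ?L" for c
  proof (cases "?L ! c \<in> A")
    case True
    obtain c' where c': "c' < length ?L" "?L ! c' \<notin> A" "f c' = c" "opp M (?L ! c) = ?L ! c'"
      using represents_opening[OF R c True] by blast
    have "opp N (?L' ! c') = ?L' ! c" using cl(3)[OF c'(1,2)] c'(3) by simp
    then have "opp N (?L' ! c) = ?L' ! c'" by (metis N.opp_opp)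
    then show ?thesis using c' len by (auto simp: in_set_zip)
  next
    case False
    then show ?thesis using cl[OF c False] len by (auto simp: in_set_zip)
  qed
  have Popp: "(opp M x, opp N y) \<in> P" if "(x, y) \<in> P" for x y
  proof -
    have "(x, y) \<in> set (zip ?L ?L') \<or> (opp M x, opp N y) \<in> P"
    proof (cases "(x, y) = (?r, ?r')")
      case False
      then have "(x, y) \<in> set (zip (visited M ?t ts) (visited N ?t' ts))" using that unfolding P by auto
      from zip_visited_opp[OF M.rmap_axioms N.rmap_axioms _ _ this] show ?thesis
        unfolding P by (auto simp: root_leaves_def)
    qed (simp add: root_leaves_def)
    then show ?thesis
    proof
      assume "(x, y) \<in> set (zip ?L ?L')"
      then obtain c where "c < length ?L" "x = ?L ! c" "y = ?L' ! c" by (auto simp: in_set_zip)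
      then show ?thesis using Lopp LP by blast
    qed
  qed
  define \<phi> where "\<phi> x = the (map_of (zip ?V ?V') x)" for x
  have phi: "\<phi> x = y" if "(x, y) \<in> P" for x y
    using that dist(1) len unfolding \<phi>_def P_def by (simp add: map_of_is_SomeI)
  have phiP: "(x, \<phi> x) \<in> P" if "x \<in> half_edges M" for x
  proof -
    have "x \<in> set ?V" using that H(1) by simp
    then obtain k where k: "k < length ?V" "?V ! k = x" unfolding in_set_conv_nth by blast
    then have *: "(x, ?V' ! k) \<in> P"
      unfolding P_def in_set_zip using len(1) by (intro exI[of _ k]) simp
    have "\<phi> x = ?V' ! k" by (rule phi[OF *])
    then show ?thesis using * by simp
  qed
  have "marked_map_iso M N \<phi>"
    unfolding marked_map_iso_def
  proof (intro conjI ballI)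
    show "bij_betw \<phi> (half_edges M) (half_edges N)"
      unfolding bij_betw_def
    proof
      show "inj_on \<phi> (half_edges M)"
      proof (rule inj_onI)
        fix x x' assume x: "x \<in> half_edges M" "x' \<in> half_edges M" "\<phi> x = \<phi> x'"
        have "(x, \<phi> x) \<in> P" "(x', \<phi> x) \<in> P" using phiP[OF x(1)] phiP[OF x(2)] x(3) by simp_all
        then obtain k k' where "k < length ?V" "k' < length ?V" "?V ! k = x" "?V ! k' = x'"
          "?V' ! k = \<phi> x" "?V' ! k' = \<phi> x" by (auto simp: P_def in_set_zip)
        then show "x = x'" using dist(2) len by (metis nth_eq_iff_index_eq)
      qed
      show "\<phi> ` half_edges M = half_edges N"
      proof (intro set_eqI iffI)
        fix y assume "y \<in> \<phi> ` half_edges M"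
        then obtain x where x: "x \<in> half_edges M" "y = \<phi> x" by blast
        then have "(x, y) \<in> set (zip ?V ?V')" using phiP[OF x(1)] by (simp add: P_def)
        then show "y \<in> half_edges N" unfolding H(2)[symmetric] by (rule set_zip_rightD)
      next
        fix y assume "y \<in> half_edges N"
        then have "y \<in> set ?V'" using H(2) by simp
        then obtain k where "k < length ?V'" "?V' ! k = y" unfolding in_set_conv_nth by blast
        then have "(?V ! k, y) \<in> P"
          unfolding P_def in_set_zip using len(1) by (intro exI[of _ k]) simp
        then have "\<phi> (?V ! k) = y" by (rule phi)
        moreover have "?V ! k \<in> half_edges M"
          using \<open>(?V ! k, y) \<in> P\<close> H(1) by (auto simp: P_def dest: set_zip_leftD)
        ultimately show "y \<in> \<phi> ` half_edges M" by blast
      qed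
    qed
    show "\<phi> (rot M h) = rot N (\<phi> h)" "\<phi> (opp M h) = opp N (\<phi> h)" if "h \<in> half_edges M" for h
      by (rule phi[OF Prot[OF phiP[OF that]]], rule phi[OF Popp[OF phiP[OF that]]])
    show "\<phi> ?r = ?r'" by (rule phi) (simp add: P)
    have phiL: "\<phi> (?L ! c) = ?L' ! c" if "c < length ?L" for c
    proof (rule phi)
      have "(?L ! c, ?L' ! c) \<in> set (zip ?L ?L')"
        unfolding in_set_zip using that len(2) by (intro exI[of _ c]) simp
      then show "(?L ! c, ?L' ! c) \<in> P" using LP by blast
    qed
    \<comment> \<open>A positive value of \<mu> means marked in either map. Closing leaves are
      heads, which are never in \<open>marked\<close>.\<close>
    have mark: "(?L ! c \<in> marked M \<longleftrightarrow> ?L' ! c \<in> marked N) \<and>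
        (?L ! c \<in> marked M \<longrightarrow> edge_mult N (?L' ! c) = edge_mult M (?L ! c))" if c: "c < length ?L" for c
    proof (cases "?L ! c \<in> A")
      case True
      obtain c' where c': "c' < length ?L" "?L ! c' \<notin> A" "f c' = c"
        using represents_opening[OF R c True] by blast
      have "?L ! c \<in> marked M \<Longrightarrow> edge_mult M (?L ! c) > 0" "?L' ! c \<in> marked N \<Longrightarrow> edge_mult N (?L' ! c) > 0"
        using MN by (auto simp: marked_map_def)
      then show ?thesis
        using cl(4,5)[OF c'(1,2)] unfolding c'(3) by (auto split: if_splits)
    next
      case False
      then show ?thesis using A AB[OF c] by blast
    qed
    show "\<phi> ` marked M = marked N"
    proof (intro set_eqI iffI)
      fix y assume "y \<in> \<phi> ` marked M"
      then obtain x where x: "x \<in> marked M" "y = \<phi> x" by blast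
      then obtain c where "c < length ?L" "?L ! c = x"
        using spanned_leaves(4)[OF S(1)] by (metis in_set_conv_nth subsetD)
      then show "y \<in> marked N" using mark phiL x by metis
    next
      fix y assume y: "y \<in> marked N"
      then obtain c where "c < length ?L'" "?L' ! c = y"
        using spanned_leaves(4)[OF S(2)] by (metis in_set_conv_nth subsetD)
      then have "?L ! c \<in> marked M" "y = \<phi> (?L ! c)" using mark phiL y len by metis+
      then show "y \<in> \<phi> ` marked M" by blast
    qed
    show "edge_mult N (\<phi> h) = edge_mult M h" if h: "h \<in> marked M" for h
    proof -
      obtain c where "c < length ?L" "?L ! c = h"
        using spanned_leaves(4)[OF S(1)] h by (metis in_set_conv_nth subsetD)
      then show ?thesis using mark phiL h by metis
    qed
  qed
  then show ?thesis by blast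
qed

lemma spanned_vertices:
  assumes S: "spanned M A ts"
  obtains vs where "map card vs = node_degrees (Node ts)" "distinct vs" "set vs = vertices M"
proof -
  let ?r = "root_half_edge M"
  let ?t = "turn M (length ts) ?r"
  interpret rmap M using S by (intro rmap_of_marked) (simp add: spanned_def)
  have ex: "explores M A (frozen M) ?t ts" and dist: "distinct (?r # visited M ?t ts)"
    and H: "set (?r # visited M ?t ts) = half_edges M" and cl: "(rot M ^^ Suc (length ts)) ?r = ?r"
    using S by (auto simp: spanned_def root_visited_def)
  have vt: "vertex_of M ?r = set (?r # ?t)" by (rule vertex_of_turn[OF cl])
  obtain vs where vs: "map card vs = concat (map node_degrees ts)" "distinct vs"
    "set vs \<subseteq> vertices M" "\<Union>(set vs) = set (visited M ?t ts) - set ?t"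
    using explores_vertices[OF ex] dist H by auto
  have "card (vertex_of M ?r) = Suc (length ts)"
    unfolding vt distinct_card[OF spanned_root(2)[OF S]] by simp
  moreover have "?r \<notin> \<Union>(set vs)" unfolding vs(4) using dist by simp
  then have "vertex_of M ?r \<notin> set vs" using self_in_vertex by blast
  moreover have "vertices M \<subseteq> set (vertex_of M ?r # vs)"
  proof
    fix v assume "v \<in> vertices M"
    then obtain h where h: "h \<in> half_edges M" "v = vertex_of M h" by (auto simp: vertices_def)
    show "v \<in> set (vertex_of M ?r # vs)"
    proof (cases "h \<in> vertex_of M ?r")
      case True
      then show ?thesis using vertex_of_eq[OF True] h(2) by simp
    next
      case False
      then have "h \<in> \<Union>(set vs)" unfolding vs(4) using h(1) H vt by auto
      then obtain w where w: "w \<in> set vs" "h \<in> w" by blast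
      then have "w = vertex_of M h" using vs(3) in_vertex_iff by blast
      then show ?thesis using w h by simp
    qed
  qed
  moreover have "vertex_of M ?r \<in> vertices M" using root_in by (auto simp: vertices_def)
  ultimately show thesis
    using vs by (intro that[of "vertex_of M ?r # vs"]) auto
qed

section \<open>The map of a code\<close>

context rmap
begin

lemma card_vertex_turn:
  assumes "(rot M ^^ Suc (length us)) x = x" "distinct (x # turn M (length us) x)" "x \<in> A"
    and "list_all2 (\<lambda>h t. t = Opening \<longleftrightarrow> h \<in> A) (turn M (length us) x) us"
    and "length us + 1 = 2 * k" "count_list us Opening = k - 1"
  shows "2 * card (vertex_of M x \<inter> A) = card (vertex_of M x)"
proof -
  have v: "vertex_of M x = set (x # turn M (length us) x)" by (rule vertex_of_turn[OF assms(1)])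
  have "card (set (x # turn M (length us) x) \<inter> A) = Suc (count_list us Opening)"
    using card_opening[OF assms(4)] assms(2,3) by simp
  moreover have "card (set (x # turn M (length us) x)) = Suc (length us)"
    unfolding distinct_card[OF assms(2)] by simp
  ultimately show ?thesis unfolding v using assms(5,6) by simp
qed

text \<open>The converse of \<open>eulerian_turn\<close> at every node: the opening children and the
  outgoing half-edge toward the parent make up half the degree. This is what turns the constructed
  set of tails into an Eulerian orientation.\<close>

lemma explores_balanced:
  assumes "explores M A F s ts" "\<forall>t\<in>set ts. eulerian_nodes t" "distinct (visited M s ts)"
    and "set (visited M s ts) \<subseteq> half_edges M" "\<And>h. h \<in> half_edges M \<Longrightarrow> h \<notin> A \<Longrightarrow> opp M h \<in> A"
    and "g \<in> set (visited M s ts) - set s"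
  shows "2 * card (vertex_of M g \<inter> A) = card (vertex_of M g)"
  using assms
proof (induction rule: explores.induct)
  case (Node h F us s ts)
  let ?t = "turn M (length us) (opp M h)"
  have sub: "set ?t \<subseteq> set (visited M ?t us)" "distinct ?t"
    using set_visited[of ?t us M] distinct_visited[of ?t us M] Node.prems(2) by auto
  have dist: "distinct (opp M h # ?t)" using sub Node.prems(2) by auto
  have h: "h \<in> half_edges M" using Node.prems(3) by simp
  show ?case
  proof (cases "g \<in> set (opp M h # ?t)")
    case True
    have "vertex_of M g = vertex_of M (opp M h)"
    proof (rule vertex_of_eq)
      show "g \<in> vertex_of M (opp M h)" unfolding vertex_of_turn[OF Node.hyps(3)] by (rule True)
    qed
    moreover obtain k where k: "length us + 1 = 2 * k" "count_list us Opening = k - 1"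
      using Node.prems(1) by auto
    have "list_all2 (\<lambda>h t. t = Opening \<longleftrightarrow> h \<in> A) ?t us"
      using explores_opening[OF Node.hyps(4)] by (simp add: list_all2_append)
    then have "2 * card (vertex_of M (opp M h) \<inter> A) = card (vertex_of M (opp M h))"
      using Node.prems(4)[OF h Node.hyps(1)] by (intro card_vertex_turn[OF Node.hyps(3) dist _ _ k])
    ultimately show ?thesis by simp
  next
    case False
    show ?thesis
    proof (rule Node.IH)
      show "\<forall>t\<in>set (us @ ts). eulerian_nodes t" using Node.prems(1) by auto
      show "distinct (visited M (?t @ s) (us @ ts))" using Node.prems(2) by (simp add: visited_append)
      show "set (visited M (?t @ s) (us @ ts)) \<subseteq> half_edges M" using Node.prems(3) by (simp add: visited_append)
      show "g \<in> set (visited M (?t @ s) (us @ ts)) - set (?t @ s)"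
        using Node.prems(5) False by (auto simp: visited_append)
    qed (rule Node.prems(4))
  qed
next
  case (Opening h F s ts)
  show ?case
  proof (rule Opening.IH)
  qed (use Opening.prems in auto)
next
  case (Closing h F s ts)
  show ?case
  proof (rule Closing.IH)
  qed (use Closing.prems in auto)
qed auto

end

text \<open>Tree edges are unmarked and point from child to parent, so going up the tree is an
  allowed path.\<close>

lemma explores_accessible:
  fixes M :: "'h marked_map"
  assumes "rmap M" "explores M A F s ts" "marked M \<union> opp M ` marked M \<subseteq> F"
    and "set (visited M s ts) \<subseteq> half_edges M" "\<And>h. h \<in> half_edges M \<Longrightarrow> h \<notin> A \<Longrightarrow> opp M h \<in> A"
    and "\<And>h. h \<in> set s \<Longrightarrow> (vertex_of M h, v) \<in> (unmarked_step M A)\<^sup>*"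
    and "g \<in> set (visited M s ts)"
  shows "(vertex_of M g, v) \<in> (unmarked_step M A)\<^sup>*"
  using assms(2-)
proof (induction rule: explores.induct)
  case (Node h F us s ts)
  interpret rmap M by (rule assms(1))
  let ?t = "turn M (length us) (opp M h)"
  have h: "h \<in> half_edges M" using Node.prems(2) by simp
  have "opp M h \<in> A" by (rule Node.prems(3)[OF h Node.hyps(1)])
  moreover have "h \<notin> marked M" using Node.hyps(2) Node.prems(1) by blast
  moreover have "opp M h \<notin> marked M"
  proof
    assume "opp M h \<in> marked M"
    then have "opp M (opp M h) \<in> opp M ` marked M" by (rule imageI)
    then show False using Node.hyps(2) Node.prems(1) by auto
  qed
  ultimately have "(vertex_of M (opp M h), vertex_of M (opp M (opp M h))) \<in> unmarked_step M A"
    unfolding unmarked_step_def using opp_opp[of h] by (intro CollectI exI[of _ "opp M h"]) simp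
  moreover have hv: "(vertex_of M h, v) \<in> (unmarked_step M A)\<^sup>*" by (rule Node.prems(4)) simp
  ultimately have ov: "(vertex_of M (opp M h), v) \<in> (unmarked_step M A)\<^sup>*"
    by (simp add: converse_rtrancl_into_rtrancl)
  show ?case
  proof (cases "g \<in> {h, opp M h}")
    case True
    then show ?thesis using hv ov by auto
  next
    case False
    show ?thesis
    proof (rule Node.IH)
      show "marked M \<union> opp M ` marked M \<subseteq> F \<union> {h, opp M h}" using Node.prems(1) by blast
      show "set (visited M (?t @ s) (us @ ts)) \<subseteq> half_edges M" using Node.prems(2) by (simp add: visited_append)
      show "g \<in> set (visited M (?t @ s) (us @ ts))" using Node.prems(5) False by (auto simp: visited_append)
      fix h' assume "h' \<in> set (?t @ s)"
      then show "(vertex_of M h', v) \<in> (unmarked_step M A)\<^sup>*"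
      proof (cases "h' \<in> set ?t")
        case True
        then have "vertex_of M h' = vertex_of M (opp M h)"
          by (intro vertex_of_eq) (simp add: vertex_of_turn[OF Node.hyps(3)])
        then show ?thesis using ov by simp
      qed (use Node.prems(4) in auto)
    qed (rule Node.prems(3))
  qed
next
  case (Opening h F s ts)
  show ?case
  proof (cases "g = h")
    case False
    show ?thesis
    proof (rule Opening.IH)
    qed (use Opening.prems False in auto)
  qed (use Opening.prems in simp)
next
  case (Closing h F s ts)
  show ?case
  proof (cases "g = h")
    case False
    show ?thesis
    proof (rule Closing.IH)
    qed (use Closing.prems False in auto)
  qed (use Closing.prems in simp)
qed auto

section \<open>Connectedness, and permutations with prescribed cycles\<close>

lemma visited_reachable:
  assumes "\<And>h. h \<in> set s \<Longrightarrow> (r, h) \<in> {(x, y). y = rot M x \<or> y = opp M x}\<^sup>*" "g \<in> set (visited M s ts)"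
  shows "(r, g) \<in> {(x, y). y = rot M x \<or> y = opp M x}\<^sup>*"
  using assms
proof (induction M s ts rule: visited.induct)
  case (1 M h s us ts)
  let ?R = "{(x, y). y = rot M x \<or> y = opp M x}\<^sup>*"
  have h: "(r, h) \<in> ?R" by (rule "1.prems") simp
  have o: "(r, opp M h) \<in> ?R" by (rule rtrancl_into_rtrancl[OF h]) simp
  have pow: "(r, (rot M ^^ k) (opp M h)) \<in> ?R" for k
  proof (induction k)
    case (Suc k)
    show ?case by (rule rtrancl_into_rtrancl[OF Suc]) simp
  qed (use o in simp)
  from "1.prems"(2) consider "g = h" | "g = opp M h" | "g \<in> set (visited M (turn M (length us) (opp M h)) us)"
    | "g \<in> set (visited M s ts)" by auto
  then show ?case
  proof cases
    case 3
    show ?thesis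
    proof (rule "1.IH"(1)[OF _ 3])
      fix h' assume "h' \<in> set (turn M (length us) (opp M h))"
      then obtain j where "h' = (rot M ^^ Suc j) (opp M h)" unfolding turn_def by auto
      then show "(r, h') \<in> ?R" using pow[of "Suc j"] by simp
    qed
  next
    case 4
    show ?thesis by (rule "1.IH"(2)[OF _ 4]) (rule "1.prems", simp)
  qed (use h o in simp_all)
qed auto

text \<open>On a finite orbit a backward step is an iterate of the permutation, so reachability from
  the root suffices for connectedness.\<close>

lemma reachable_sym:
  fixes p q :: "'a \<Rightarrow> 'a"
  assumes p: "permutation p" and q: "\<And>x. q (q x) = x"
    and "(x, y) \<in> {(x, y). y = p x \<or> y = q x}\<^sup>*"
  shows "(y, x) \<in> {(x, y). y = p x \<or> y = q x}\<^sup>*"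
  using assms(3)
proof (induction rule: rtrancl_induct)
  case (step y z)
  let ?R = "{(x, y). y = p x \<or> y = q x}\<^sup>*"
  have orb: "(a, b) \<in> ?R" if "b \<in> orbit p a" for a b
    using that
  proof (induction rule: orbit.induct)
    case (step b)
    show ?case by (rule rtrancl_into_rtrancl[OF step.IH]) simp
  qed auto
  have "(z, y) \<in> ?R"
  proof (cases "z = p y")
    case True
    have "y \<in> orbit p (p y)"
      unfolding permutation_orbit_step[OF p] by (rule permutation_self_in_orbit[OF p])
    then show ?thesis unfolding True by (rule orb)
  next
    case False
    then have "y = q z" using step.hyps(2) q by auto
    then show ?thesis by auto
  qed
  then show ?case using step.IH by (rule rtrancl_trans)
qed simp

text \<open>The product of the cycles: on each list, all factors but one act as the
  identity.\<close>

lemma permutation_of_cycles: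
  assumes "distinct (concat cs)"
  shows "\<exists>p. p permutes set (concat cs) \<and> (\<forall>c\<in>set cs. \<forall>x\<in>set c. p x = cycle_of_list c x)"
  using assms
proof (induction cs)
  case Nil
  show ?case by (intro exI[of _ id]) (auto simp: permutes_id)
next
  case (Cons c cs)
  then obtain p where p: "p permutes set (concat cs)" "\<And>d x. d \<in> set cs \<Longrightarrow> x \<in> set d \<Longrightarrow> p x = cycle_of_list d x"
    by auto
  have disj: "set c \<inter> set (concat cs) = {}" using Cons.prems by auto
  let ?p = "cycle_of_list c \<circ> p"
  have "?p permutes set (concat (c # cs))"
    using p(1) cycle_permutes[of c] by (intro permutes_compose) (auto intro: permutes_subset)
  moreover have "?p x = cycle_of_list c x" if "x \<in> set c" for x
  proof -
    have "x \<notin> set (concat cs)" using disj that by blast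
    then show ?thesis using permutes_not_in[OF p(1)] by simp
  qed
  moreover have "?p x = cycle_of_list d x" if d: "d \<in> set cs" "x \<in> set d" for d x
  proof -
    have "cycle_of_list d x \<in> set d" using permutes_in_image[OF cycle_permutes] d(2) by metis
    then have "cycle_of_list d x \<notin> set c" using disj d(1) by auto
    then show ?thesis using p(2)[OF d] by (simp add: id_outside_supp)
  qed
  ultimately have "\<forall>d\<in>set (c # cs). \<forall>x\<in>set d. ?p x = cycle_of_list d x"
    unfolding list.set(2) by blast
  with \<open>?p permutes set (concat (c # cs))\<close> show ?case by blast
qed

text \<open>The k-th power of a cycle rotates its list by k places, so its value at the first entry
  is the entry at index k modulo the length.\<close>

lemma turn_of_cycle:
  assumes d: "distinct (x # xs)" and p: "\<And>y. y \<in> set (x # xs) \<Longrightarrow> rot M y = cycle_of_list (x # xs) y"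
  shows "(rot M ^^ Suc (length xs)) x = x" "turn M (length xs) x = xs"
proof -
  let ?c = "x # xs"
  have pow: "(rot M ^^ k) x = (cycle_of_list ?c ^^ k) x \<and> (rot M ^^ k) x \<in> set ?c" for k
  proof (induction k)
    case (Suc k)
    have "rot M ((rot M ^^ k) x) = cycle_of_list ?c ((rot M ^^ k) x)" using Suc p by blast
    moreover have "cycle_of_list ?c ((rot M ^^ k) x) \<in> set ?c"
      using permutes_in_image[OF cycle_permutes[of ?c]] Suc by blast
    ultimately show ?case using Suc by simp
  qed simp
  have nth: "(rot M ^^ k) x = ?c ! (k mod length ?c)" for k
  proof -
    have "(rot M ^^ k) x = map (cycle_of_list ?c ^^ k) ?c ! 0" using pow[of k] by simp
    also have "\<dots> = rotate k ?c ! 0" unfolding cyclic_rotation[OF d] ..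
    also have "\<dots> = ?c ! (k mod length ?c)" by (subst nth_rotate) auto
    finally show ?thesis .
  qed
  show "(rot M ^^ Suc (length xs)) x = x" unfolding nth by simp
  show "turn M (length xs) x = xs"
  proof (rule nth_equalityI)
    fix j assume "j < length (turn M (length xs) x)"
    then have j: "j < length xs" by simp
    have "turn M (length xs) x ! j = (rot M ^^ Suc j) x" using j by (rule nth_turn)
    also have "\<dots> = xs ! j" unfolding nth using j by simp
    finally show "turn M (length xs) x ! j = xs ! j" .
  qed simp
qed

text \<open>\<open>g\<close> is completed by its inverse on \<open>Y\<close> and by the identity
  elsewhere. With \<open>X\<close> the heads and \<open>Y\<close> the tails, the result becomes
  \<open>opp\<close>.\<close>

lemma involution_of_bij:
  assumes g: "bij_betw g X Y" and XY: "X \<inter> Y = {}"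
  shows "\<exists>m. m permutes (X \<union> Y) \<and> (\<forall>x. m (m x) = x) \<and> (\<forall>x\<in>X. m x = g x) \<and> (\<forall>x\<in>X \<union> Y. m x \<in> X \<longleftrightarrow> x \<in> Y)"
proof -
  let ?h = "inv_into X g"
  define m where "m x = (if x \<in> X then g x else if x \<in> Y then ?h x else x)" for x
  have gY: "g x \<in> Y" if "x \<in> X" for x using g that by (auto simp: bij_betw_def)
  have hX: "?h y \<in> X" "g (?h y) = y" if "y \<in> Y" for y
    using g that by (auto simp: bij_betw_def inv_into_into f_inv_into_f)
  have hg: "?h (g x) = x" if "x \<in> X" for x using g that by (simp add: bij_betw_inv_into_left)
  have mm: "m (m x) = x" for x
  proof -
    consider "x \<in> X" | "x \<in> Y" | "x \<notin> X" "x \<notin> Y" by blast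
    then show ?thesis
    proof cases
      case 1
      then have "g x \<notin> X" using gY XY by blast
      then show ?thesis using 1 gY[OF 1] hg[OF 1] by (simp add: m_def)
    next
      case 2
      then have "x \<notin> X" using XY by blast
      then show ?thesis using 2 hX[OF 2] by (simp add: m_def)
    qed (simp add: m_def)
  qed
  have "m permutes (X \<union> Y)"
    unfolding permutes_def
  proof (intro conjI allI impI)
    fix y show "\<exists>!x. m x = y" using mm by metis
  qed (simp add: m_def)
  moreover have "m x \<in> X \<longleftrightarrow> x \<in> Y" if "x \<in> X \<union> Y" for x
  proof (cases "x \<in> X")
    case True
    then have "m x \<in> Y" "x \<notin> Y" using gY XY by (auto simp: m_def)
    then show ?thesis using XY by blast
  next
    case False
    then have "x \<in> Y" using that by blast
    then show ?thesis using False hX(1) by (simp add: m_def)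
  qed
  ultimately show ?thesis using mm by (intro exI[of _ m]) (simp add: m_def)
qed

text \<open>Numbering of the half-edges of a forest in the order of their visit, starting from \<open>n\<close>: the
  upper half-edges of the roots, those of the leaves, those of the nodes, and the half-edges around
  each node.\<close>

fun fsize :: "'a blossom list \<Rightarrow> nat" where
  "fsize [] = 0"
| "fsize (Node us # ts) = 2 + fsize us + fsize ts"
| "fsize (t # ts) = 1 + fsize ts"

fun tops :: "nat \<Rightarrow> 'a blossom list \<Rightarrow> nat list" where
  "tops n [] = []"
| "tops n (Node us # ts) = n # tops (n + 2 + fsize us) ts"
| "tops n (t # ts) = n # tops (n + 1) ts"

fun leaf_tops :: "nat \<Rightarrow> 'a blossom list \<Rightarrow> nat list" where
  "leaf_tops n [] = []"
| "leaf_tops n (Node us # ts) = leaf_tops (n + 2) us @ leaf_tops (n + 2 + fsize us) ts"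
| "leaf_tops n (t # ts) = n # leaf_tops (n + 1) ts"

fun node_tops :: "nat \<Rightarrow> 'a blossom list \<Rightarrow> nat list" where
  "node_tops n [] = []"
| "node_tops n (Node us # ts) = n # node_tops (n + 2) us @ node_tops (n + 2 + fsize us) ts"
| "node_tops n (t # ts) = node_tops (n + 1) ts"

fun node_cycles :: "nat \<Rightarrow> 'a blossom list \<Rightarrow> nat list list" where
  "node_cycles n [] = []"
| "node_cycles n (Node us # ts) =
     (Suc n # tops (n + 2) us) # node_cycles (n + 2) us @ node_cycles (n + 2 + fsize us) ts"
| "node_cycles n (t # ts) = node_cycles (n + 1) ts"

lemma fsize_append [simp]: "fsize (us @ ts) = fsize us + fsize ts"
  by (induction us rule: fsize.induct) auto

lemma length_tops [simp]: "length (tops n ts) = length ts"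
  by (induction n ts rule: tops.induct) auto

lemma tops_append: "tops n (us @ ts) = tops n us @ tops (n + fsize us) ts"
  by (induction n us rule: tops.induct) (auto simp: algebra_simps)

lemma leaf_tops_append: "leaf_tops n (us @ ts) = leaf_tops n us @ leaf_tops (n + fsize us) ts"
  by (induction n us rule: leaf_tops.induct) (auto simp: algebra_simps)

lemma node_tops_append: "node_tops n (us @ ts) = node_tops n us @ node_tops (n + fsize us) ts"
  by (induction n us rule: node_tops.induct) (auto simp: algebra_simps)

lemma node_cycles_append: "node_cycles n (us @ ts) = node_cycles n us @ node_cycles (n + fsize us) ts"
  by (induction n us rule: node_cycles.induct) (auto simp: algebra_simps)

lemma upt_node:
  "[n..<Suc (Suc (n + (a + b)))] =
    n # Suc n # [Suc (Suc n)..<Suc (Suc (n + a))] @ [Suc (Suc (n + a))..<Suc (Suc (n + a + b))]"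
proof -
  have "[n..<Suc (Suc (n + (a + b)))] = n # Suc n # [Suc (Suc n)..<Suc (Suc (n + (a + b)))]"
    by (simp add: upt_conv_Cons del: upt_Suc)
  also have "[Suc (Suc n)..<Suc (Suc (n + (a + b)))] =
      [Suc (Suc n)..<Suc (Suc (n + a))] @ [Suc (Suc (n + a))..<Suc (Suc (n + a + b))]"
    using upt_add_eq_append[of "Suc (Suc n)" "Suc (Suc (n + a))" b] by (simp add: add.assoc del: upt_Suc)
  finally show ?thesis .
qed

text \<open>The half-edges sorted by edges, as needed for \<open>opp\<close>: a tree edge has the
  halves \<open>x\<close> and \<open>Suc x\<close>.\<close>

lemma mset_leaf_tops:
  "mset (leaf_tops n ts @ node_tops n ts @ map Suc (node_tops n ts)) = mset [n..<n + fsize ts]"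
proof (induction n ts rule: leaf_tops.induct)
  case (2 n us ts)
  have "mset [Suc (Suc n)..<Suc (Suc (n + fsize us))] =
      mset (leaf_tops (n + 2) us @ node_tops (n + 2) us @ map Suc (node_tops (n + 2) us))"
    "mset [Suc (Suc (n + fsize us))..<Suc (Suc (n + fsize us + fsize ts))] =
      mset (leaf_tops (n + 2 + fsize us) ts @ node_tops (n + 2 + fsize us) ts @ map Suc (node_tops (n + 2 + fsize us) ts))"
    unfolding "2.IH" by simp_all
  then show ?case by (simp add: upt_node del: upt_Suc mset_upt)
qed (auto simp: upt_conv_Cons simp del: upt_Suc mset_upt)

text \<open>The same half-edges sorted by vertices, as needed for \<open>rot\<close>: the initial
  stack belongs to a vertex outside the forest, and each node has its own cycle.\<close>

lemma mset_node_cycles: "mset (tops n ts @ concat (node_cycles n ts)) = mset [n..<n + fsize ts]"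
proof (induction n ts rule: node_cycles.induct)
  case (2 n us ts)
  have "mset [Suc (Suc n)..<Suc (Suc (n + fsize us))] = mset (tops (n + 2) us @ concat (node_cycles (n + 2) us))"
    "mset [Suc (Suc (n + fsize us))..<Suc (Suc (n + fsize us + fsize ts))] =
      mset (tops (n + 2 + fsize us) ts @ concat (node_cycles (n + 2 + fsize us) ts))"
    unfolding "2.IH" by simp_all
  then show ?case by (simp add: upt_node del: upt_Suc mset_upt)
qed (auto simp: upt_conv_Cons simp del: upt_Suc mset_upt)

lemma length_leaf_tops: "length (leaf_tops n ts) = length (concat (map leaf_word ts))"
  by (induction n ts rule: leaf_tops.induct) auto

lemma visited_tops:
  assumes "\<And>x. x \<in> set (node_tops n ts) \<Longrightarrow> opp M x = Suc x"
    and "\<And>c. c \<in> set (node_cycles n ts) \<Longrightarrow> turn M (length c - 1) (hd c) = tl c"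
  shows "visited M (tops n ts) ts = [n..<n + fsize ts] \<and> leaves M (tops n ts) ts = leaf_tops n ts"
  using assms
proof (induction n ts rule: leaf_tops.induct)
  case (2 n us ts)
  have o: "opp M n = Suc n" and t: "turn M (length us) (Suc n) = tops (n + 2) us"
    using "2.prems"(1)[of n] "2.prems"(2)[of "Suc n # tops (n + 2) us"] by simp_all
  have "visited M (tops (n + 2) us) us = [n + 2..<n + 2 + fsize us] \<and> leaves M (tops (n + 2) us) us = leaf_tops (n + 2) us"
    using "2.prems" by (intro "2.IH"(1)) auto
  moreover have "visited M (tops (n + 2 + fsize us) ts) ts = [n + 2 + fsize us..<n + 2 + fsize us + fsize ts] \<and>
      leaves M (tops (n + 2 + fsize us) ts) ts = leaf_tops (n + 2 + fsize us) ts"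
    using "2.prems" by (intro "2.IH"(2)) auto
  ultimately show ?case
    by (simp add: o t upt_node del: upt_Suc)
qed (auto simp: upt_conv_Cons simp del: upt_Suc)

lemma node_tops_ge: "x \<in> set (node_tops n ts) \<Longrightarrow> n \<le> x"
  by (induction n ts rule: node_tops.induct) fastforce+

text \<open>The last assumption is what the exploration has to find at a closing leaf: it is frozen
  from the start or matched with an earlier leaf. An upper half \<open>x\<close> of a tree edge is
  still free when it is met, as its partner is the larger number \<open>Suc x\<close>.\<close>

lemma explores_tops:
  fixes ts :: "unit blossom list"
  assumes "\<And>x. opp M (opp M x) = x"
    and "\<And>x. x \<in> set (node_tops n ts) \<Longrightarrow> opp M x = Suc x \<and> x \<notin> A \<and> x \<notin> F"
    and "\<And>c. c \<in> set (node_cycles n ts) \<Longrightarrow>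
      (rot M ^^ length c) (hd c) = hd c \<and> turn M (length c - 1) (hd c) = tl c"
    and "map (\<lambda>h. h \<in> A) (leaf_tops n ts) = map (\<lambda>l. l = None) (concat (map leaf_word ts))"
    and "\<And>a x b. leaf_tops n ts = a @ x # b \<Longrightarrow> x \<notin> A \<Longrightarrow> x \<in> F \<or> opp M x \<in> set a"
  shows "explores M A F (tops n ts) ts"
  using assms(2-)
proof (induction "fsize ts" arbitrary: n ts F rule: less_induct)
  case less
  show ?case
  proof (cases ts)
    case Nil
    then show ?thesis by (simp add: explores.Nil)
  next
    case (Cons t ts')
    have leaf: "explores M A (F \<union> {n, opp M n}) (tops (n + 1) ts') ts'" if t: "t \<notin> range Node"
    proof -
      have ts: "leaf_tops n ts = n # leaf_tops (n + 1) ts'" "node_tops n ts = node_tops (n + 1) ts'"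
        "node_cycles n ts = node_cycles (n + 1) ts'" "fsize ts' < fsize ts" "length (leaf_word t) = 1"
        using t Cons by (cases t; simp)+
      have "explores M A (F \<union> {n, opp M n}) (tops (n + 1) ts') ts'"
      proof (rule less.hyps[OF ts(4)])
        show "opp M x = Suc x \<and> x \<notin> A \<and> x \<notin> F \<union> {n, opp M n}" if x: "x \<in> set (node_tops (n + 1) ts')" for x
        proof -
          have *: "opp M x = Suc x" "x \<notin> A" "x \<notin> F" using less.prems(1)[of x] x ts(2) by auto
          have ge: "n + 1 \<le> x" by (rule node_tops_ge[OF x])
          have "x \<noteq> opp M n"
          proof
            assume "x = opp M n"
            then have "Suc x = n" using *(1) assms(1)[of n] by simp
            then show False using ge by simp
          qed
          then show ?thesis using * ge by simp
        qed
        show "(rot M ^^ length c) (hd c) = hd c \<and> turn M (length c - 1) (hd c) = tl c"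
          if "c \<in> set (node_cycles (n + 1) ts')" for c
          using less.prems(2)[of c] that ts(3) by simp
        show "map (\<lambda>h. h \<in> A) (leaf_tops (n + 1) ts') = map (\<lambda>l. l = None) (concat (map leaf_word ts'))"
          using less.prems(3) ts(1,5) Cons by (auto simp: length_Suc_conv)
        show "x \<in> F \<union> {n, opp M n} \<or> opp M x \<in> set a"
          if "leaf_tops (n + 1) ts' = a @ x # b" "x \<notin> A" for a x b
        proof -
          have "x \<in> F \<or> opp M x \<in> set (n # a)" by (rule less.prems(4)) (use that ts(1) in auto)
          moreover have "x = opp M n" if "opp M x = n" using that assms(1)[of x] by simp
          ultimately show ?thesis by auto
        qed
      qed
      then show ?thesis .
    qed
    show ?thesis
    proof (cases t)
      case Opening
      have "n \<in> A" using less.prems(3) Cons Opening by simp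
      from explores.Opening[OF this leaf] show ?thesis using Opening Cons by (simp add: image_iff)
    next
      case (Closing u)
      have nA: "n \<notin> A" using less.prems(3) Cons Closing by simp
      have "n \<in> F \<or> opp M n \<in> set []" by (rule less.prems(4)[OF _ nA]) (simp add: Cons Closing)
      then have "n \<in> F" by simp
      from explores.Closing[OF nA this leaf] show ?thesis using Closing Cons by (simp add: image_iff)
    next
      case (Node us)
      have n: "opp M n = Suc n" "n \<notin> A" "n \<notin> F" using less.prems(1)[of n] Cons Node by auto
      have cl: "(rot M ^^ Suc (length us)) (Suc n) = Suc n" and t: "turn M (length us) (Suc n) = tops (n + 2) us"
        using less.prems(2)[of "Suc n # tops (n + 2) us"] Cons Node by (simp_all del: funpow.simps)
      have ts: "leaf_tops n ts = leaf_tops (n + 2) (us @ ts')"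
        "node_tops n ts = n # node_tops (n + 2) (us @ ts')"
        "node_cycles n ts = (Suc n # tops (n + 2) us) # node_cycles (n + 2) (us @ ts')"
        "tops n ts = n # tops (n + 2 + fsize us) ts'"
        using Cons Node by (simp_all add: leaf_tops_append node_tops_append node_cycles_append)
      have "explores M A (F \<union> {n, opp M n}) (tops (n + 2) (us @ ts')) (us @ ts')"
      proof (rule less.hyps)
        show "fsize (us @ ts') < fsize ts" using Cons Node by simp
        show "opp M x = Suc x \<and> x \<notin> A \<and> x \<notin> F \<union> {n, opp M n}" if x: "x \<in> set (node_tops (n + 2) (us @ ts'))" for x
          using less.prems(1)[of x] x ts(2) node_tops_ge[OF x] n(1) by auto
        show "(rot M ^^ length c) (hd c) = hd c \<and> turn M (length c - 1) (hd c) = tl c"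
          if "c \<in> set (node_cycles (n + 2) (us @ ts'))" for c
          using less.prems(2)[of c] that ts(3) by simp
        show "map (\<lambda>h. h \<in> A) (leaf_tops (n + 2) (us @ ts')) = map (\<lambda>l. l = None) (concat (map leaf_word (us @ ts')))"
          using less.prems(3) unfolding ts(1) by (simp add: Cons Node)
        show "x \<in> F \<union> {n, opp M n} \<or> opp M x \<in> set a"
          if "leaf_tops (n + 2) (us @ ts') = a @ x # b" "x \<notin> A" for a x b
          using less.prems(4)[of a x b] that ts(1) by auto
      qed
      then have "explores M A (F \<union> {n, opp M n}) (turn M (length us) (opp M n) @ tops (n + 2 + fsize us) ts') (us @ ts')"
        by (simp add: n(1) t tops_append)
      then show ?thesis
        unfolding ts(4) unfolding Cons Node using n cl by (intro explores.Node) (simp_all del: funpow.simps)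
    qed
  qed
qed

lemma node_cycles_nonempty: "c \<in> set (node_cycles n ts) \<Longrightarrow> c \<noteq> []"
  by (induction n ts rule: node_cycles.induct) auto

text \<open>The half-edges are the numbers in the order of their visit, with 0 for the root
  half-edge. Rotation is the product of the vertex cycles, and the opposite joins leaves by
  \<open>f\<close> and the two halves of tree edges. The orientation is dictated by the leaf word
  and by the direction toward the root.\<close>

lemma code_realized:
  fixes ts :: "unit blossom list"
  assumes eul: "eulerian_nodes (Node ts)"
    and dec: "(f, \<mu>) \<in> decorations i (True # map (\<lambda>l. l = None) (leaf_word (Node ts)))"
  obtains M :: "nat marked_map" and A where "represents M A ts f \<mu>" "eulerian_map M" "admissible M"
    "(\<Sum>h\<in>marked M. edge_mult M h) < i"
proof -
  define w where "w = True # map (\<lambda>l. l = None) (leaf_word (Node ts))"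
  define L where "L = 0 # leaf_tops 1 ts"
  define T where "T = set (node_tops 1 ts)"
  define H where "H = {0..<1 + fsize ts}"
  define C where "C = {c. c < length L \<and> \<not> w ! c}"
  define Op where "Op = {c. c < length L \<and> w ! c}"
  have lenL: "length L = length w" by (simp add: L_def w_def length_leaf_tops)
  have f: "f \<in> extensional C" "bij_betw f C Op" "\<mu> \<in> extensional C"
    "\<And>c. c \<in> C \<Longrightarrow> \<mu> c = 0 \<Longrightarrow> f c < c" "sum \<mu> C < i"
    using dec unfolding w_def[symmetric] decorations_def C_def Op_def lenL by auto
  have fOp: "f c \<in> Op" if "c \<in> C" for c using f(2) that by (auto simp: bij_betw_def)
  have COp: "C \<inter> Op = {}" "C \<union> Op = {..<length L}" by (auto simp: C_def Op_def)
  have "mset (L @ node_tops 1 ts @ map Suc (node_tops 1 ts)) = mset (0 # [1..<1 + fsize ts])"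
    unfolding L_def using mset_leaf_tops[of 1 ts] by (simp del: upt_Suc mset_upt)
  moreover have upt0: "0 # [1..<1 + fsize ts] = [0..<1 + fsize ts]"
    by (simp add: upt_conv_Cons del: upt_Suc)
  ultimately have ms: "mset (L @ node_tops 1 ts @ map Suc (node_tops 1 ts)) = mset [0..<1 + fsize ts]"
    by (simp only:)
  then have "distinct (L @ node_tops 1 ts @ map Suc (node_tops 1 ts))"
    using mset_eq_imp_distinct_iff distinct_upt by blast
  then have dL: "distinct L" and LT: "set L \<inter> T = {}" "set L \<inter> Suc ` T = {}" "T \<inter> Suc ` T = {}"
    by (auto simp: T_def)
  have LTH: "set L \<union> T \<union> Suc ` T = H"
    using mset_eq_setD[OF ms] by (simp add: T_def H_def Un_assoc del: upt_Suc)
  let ?l = "\<lambda>c. L ! c"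
  have Leq: "?l c = ?l d \<longleftrightarrow> c = d" if "c < length L" "d < length L" for c d
    using dL that by (rule nth_eq_iff_index_eq)
  have CL: "c < length L" if "c \<in> C \<union> Op" for c using that COp(2) by blast
  \<comment> \<open>\<open>X\<close> collects the heads, namely closing leaves and upper halves of
    tree edges; \<open>A\<close> collects the tails.\<close>
  define X where "X = ?l ` C \<union> T"
  define A where "A = ?l ` Op \<union> Suc ` T"
  have setL: "set L = ?l ` C \<union> ?l ` Op"
    unfolding image_Un[symmetric] COp(2) by (auto simp: set_conv_nth)
  have CO: "?l ` C \<inter> ?l ` Op = {}"
  proof -
    have False if "c \<in> C" "d \<in> Op" "?l c = ?l d" for c d
    proof -
      have "c = d" using that Leq[of c d] CL by blast
      then show False using that COp(1) by blast
    qed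
    then show ?thesis by blast
  qed
  have "(P \<union> T) \<inter> (Q \<union> Suc ` T) = {}" if "P \<inter> Q = {}" "set L = P \<union> Q" for P Q
    using that LT by blast
  from this[OF CO setL] have XA1: "X \<inter> A = {}" unfolding X_def A_def .
  have XA2: "X \<union> A = H" unfolding X_def A_def LTH[symmetric] setL by (simp only: Un_ac)
  note XA = XA1 XA2
  define ix where "ix = inv_into {..<length L} ?l"
  have ix: "ix (?l c) = c" if "c < length L" for c
  proof -
    have "inj_on ?l {..<length L}" by (rule inj_on_nth[OF dL]) simp
    then show ?thesis unfolding ix_def using that by (intro inv_into_f_f) simp_all
  qed
  define g where "g x = (if x \<in> T then Suc x else ?l (f (ix x)))" for x
  have gT: "g x = Suc x" if "x \<in> T" for x using that by (simp add: g_def)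
  have gC: "g (?l c) = ?l (f c)" if "c \<in> C" for c
  proof -
    have "?l c \<notin> T" using LT(1) setL that by blast
    then show ?thesis using ix CL that by (simp add: g_def)
  qed
  have "bij_betw g (?l ` C) (?l ` Op)"
    unfolding bij_betw_def
  proof
    show "inj_on g (?l ` C)"
    proof (rule inj_onI, elim imageE, hypsubst)
      fix c d assume cd: "c \<in> C" "d \<in> C" "g (?l c) = g (?l d)"
      then have "f c = f d" using gC Leq[of "f c" "f d"] fOp CL by auto
      then show "?l c = ?l d" using cd f(2) by (auto simp: bij_betw_def inj_on_def)
    qed
    have "g ` ?l ` C = ?l ` f ` C" unfolding image_image using gC by (intro image_cong) auto
    then show "g ` ?l ` C = ?l ` Op" using f(2) by (simp add: bij_betw_def)
  qed
  moreover have "bij_betw g T (Suc ` T)"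
    using gT by (auto simp: bij_betw_def inj_on_def)
  moreover have "?l ` Op \<inter> Suc ` T = {}" using LT(2) setL by blast
  ultimately have "bij_betw g X A" unfolding X_def A_def by (rule bij_betw_combine)
  from involution_of_bij[OF this XA(1)] obtain m where
    m: "m permutes H" "\<And>x. m (m x) = x" "\<And>x. x \<in> X \<Longrightarrow> m x = g x" "\<And>x. x \<in> H \<Longrightarrow> m x \<in> X \<longleftrightarrow> x \<in> A"
    unfolding XA(2) by blast
  have mC: "m (?l c) = ?l (f c)" "m (?l (f c)) = ?l c" if "c \<in> C" for c
  proof -
    have "?l c \<in> X" using that by (auto simp: X_def)
    then show "m (?l c) = ?l (f c)" using m(3) gC[OF that] by simp
    then show "m (?l (f c)) = ?l c" using m(2) by metis
  qed
  have mT: "m x = Suc x" if "x \<in> T" for x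
    using that m(3)[of x] gT by (simp add: X_def)
  define cs where "cs = (0 # tops 1 ts) # node_cycles 1 ts"
  have mcs: "mset (concat cs) = mset [0..<1 + fsize ts]"
    unfolding upt0[symmetric] using mset_node_cycles[of 1 ts] by (simp add: cs_def del: upt_Suc mset_upt)
  have dcs: "distinct (concat cs)" using mset_eq_imp_distinct_iff[OF mcs] distinct_upt by blast
  have scs: "set (concat cs) = H" using mset_eq_setD[OF mcs] by (simp only: H_def set_upt)
  obtain p where p: "p permutes H" "\<And>c x. c \<in> set cs \<Longrightarrow> x \<in> set c \<Longrightarrow> p x = cycle_of_list c x"
    using permutation_of_cycles[OF dcs] unfolding scs by blast
  \<comment> \<open>A marked edge is recorded by its tail, but \<mu> is indexed by closing
    positions; \<open>em\<close> goes back from the tail to the position through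
    \<open>f\<close>.\<close>
  define Mk where "Mk = (\<lambda>c. ?l (f c)) ` {c \<in> C. \<mu> c > 0}"
  define em where "em x = \<mu> (inv_into C f (ix x))" for x
  have em: "em (?l (f c)) = \<mu> c" if "c \<in> C" for c
    using ix CL[of "f c"] fOp[OF that] bij_betw_inv_into_left[OF f(2) that] by (simp add: em_def)
  define M where "M = \<lparr>half_edges = H, rot = p, opp = m, root_half_edge = 0 :: nat, marked = Mk, edge_mult = em\<rparr>"
  have Msel [simp]: "half_edges M = H" "rot M = p" "opp M = m" "root_half_edge M = 0" "marked M = Mk" "edge_mult M = em"
    by (simp_all add: M_def)
  have cyc: "(p ^^ length c) (hd c) = hd c \<and> turn M (length c - 1) (hd c) = tl c" if c: "c \<in> set cs" for c
  proof -
    have "c \<noteq> []" using c node_cycles_nonempty by (auto simp: cs_def)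
    then obtain x xs where xs: "c = x # xs" by (cases c) auto
    have d1: "distinct (x # xs)" using dcs c unfolding distinct_concat_iff xs by blast
    have d2: "rot M y = cycle_of_list (x # xs) y" if "y \<in> set (x # xs)" for y
      using p(2)[OF c] that unfolding xs by simp
    show ?thesis
      using turn_of_cycle[OF d1 d2] unfolding xs by (simp del: funpow.simps)
  qed
  have cl0: "(rot M ^^ Suc (length ts)) 0 = 0" and turn0: "turn M (length ts) 0 = tops 1 ts"
    using cyc[of "0 # tops 1 ts"] by (simp_all add: cs_def del: funpow.simps)
  have VL: "visited M (tops 1 ts) ts = [1..<1 + fsize ts]" "leaves M (tops 1 ts) ts = leaf_tops 1 ts"
    using visited_tops[of 1 ts M] mT cyc by (auto simp: T_def cs_def)
  have RV: "root_visited M ts = [0..<1 + fsize ts]" and RL: "root_leaves M ts = L"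
    unfolding root_visited_def root_leaves_def Msel turn0 VL L_def by (simp_all only: upt0)
  have H0: "0 \<in> H" by (simp add: H_def)
  have nX: "x \<in> X \<longleftrightarrow> x \<notin> A" if "x \<in> H" for x using XA that by blast
  have mH: "m x \<in> H \<longleftrightarrow> x \<in> H" for x by (rule permutes_in_image[OF m(1)])
  have oA: "m x \<in> A \<longleftrightarrow> x \<notin> A" if "x \<in> H" for x
    using m(4)[OF that] nX[of "m x"] mH that by blast
  have rm: "rooted_map M"
    unfolding rooted_map_def Msel
  proof (intro conjI ballI)
    show "finite H" by (simp add: H_def)
    show "m h \<noteq> h" if "h \<in> H" for h using oA[OF that] by metis
    let ?R = "{(x, y). y = p x \<or> y = m x}\<^sup>*"
    have reach: "(0, h) \<in> ?R" if "h \<in> H" for h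
    proof (cases "h = 0")
      case False
      then have hv: "h \<in> set (visited M (tops 1 ts) ts)" unfolding VL using that by (auto simp: H_def simp del: upt_Suc)
      have "(0, g) \<in> {(x, y). y = rot M x \<or> y = opp M x}\<^sup>*" if "g \<in> set (tops 1 ts)" for g
      proof -
        have pow: "(0, (p ^^ k) 0) \<in> ?R" for k
        proof (induction k)
          case (Suc k)
          show ?case by (rule rtrancl_into_rtrancl[OF Suc]) simp
        qed simp
        have "g \<in> (\<lambda>j. (p ^^ Suc j) 0) ` set [0..<length ts]"
          using that unfolding turn0[symmetric] turn_def set_map Msel .
        then obtain j where "g = (p ^^ Suc j) 0" by (rule imageE)
        then show ?thesis using pow[of "Suc j"] by simp
      qed
      from visited_reachable[OF this hv] show ?thesis by simp
    qed simp
    have perm: "permutation p" using p(1) by (auto simp: permutation_permutes H_def)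
    fix h h' assume "h \<in> H" "h' \<in> H"
    then have "(0, h) \<in> ?R" "(0, h') \<in> ?R" using reach by blast+
    then have "(h, 0) \<in> ?R" "(0, h') \<in> ?R" using reachable_sym[OF perm m(2)] by blast+
    then show "(h, h') \<in> ?R" by (rule rtrancl_trans)
  next
    show "p permutes H" "m permutes H" "0 \<in> H" by (rule p(1) m(1) H0)+
    show "m (m h) = h" for h by (rule m(2))
  qed
  interpret rmap M by unfold_locales (rule rm)
  have MkOp: "Mk \<subseteq> ?l ` Op" using fOp by (auto simp: Mk_def)
  have MkA: "Mk \<subseteq> A" using MkOp by (auto simp: A_def)
  have AH: "A \<subseteq> H" using XA by blast
  have mm: "marked_map M"
    unfolding marked_map_def Msel
  proof (intro conjI ballI)
    show "Mk \<subseteq> H" using MkA AH by blast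
    fix h assume h: "h \<in> Mk"
    then show "m h \<notin> Mk" using oA[of h] MkA AH by blast
    show "em h > 0" using h em by (auto simp: Mk_def)
  qed (rule rm)
  have w0: "0 \<in> Op" by (simp add: Op_def L_def w_def)
  have LA: "?l c \<in> A \<longleftrightarrow> w ! c" if "c < length L" for c
  proof -
    have "?l c \<notin> Suc ` T" using LT(2) that nth_mem[of c L] by blast
    moreover have "?l c \<in> ?l ` Op \<longleftrightarrow> c \<in> Op"
      using Leq[OF that] CL by blast
    ultimately show ?thesis using that by (simp add: A_def Op_def)
  qed
  have Aw: "map (\<lambda>h. h \<in> A) L = w"
    by (rule nth_equalityI) (use lenL LA in auto)
  have A0: "0 \<in> A" using LA[of 0] by (simp add: L_def w_def)
  have m0: "\<exists>c\<in>C. f c = 0" using f(2) w0 by (auto simp: bij_betw_def image_iff)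
  \<comment> \<open>All frozen half-edges are leaves, so freezing never blocks a tree edge.\<close>
  have frL: "frozen M \<subseteq> set L"
  proof -
    have "m ` Mk \<subseteq> ?l ` C" using mC(2) by (auto simp: Mk_def)
    moreover have "m 0 \<in> ?l ` C" using m0 mC(2) by (fastforce simp: L_def)
    moreover have "0 \<in> set L" by (simp add: L_def)
    ultimately show ?thesis using MkOp setL by (auto simp: frozen_def)
  qed
  have ex: "explores M A (frozen M) (tops 1 ts) ts"
  proof (rule explores_tops)
    show "opp M x = Suc x \<and> x \<notin> A \<and> x \<notin> frozen M" if "x \<in> set (node_tops 1 ts)" for x
    proof -
      have x: "x \<in> T" using that by (simp add: T_def)
      then have "x \<in> X" "x \<in> H" using LTH by (auto simp: X_def)
      then show ?thesis using mT[OF x] nX frL LT(1) x by auto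
    qed
    show "(rot M ^^ length c) (hd c) = hd c \<and> turn M (length c - 1) (hd c) = tl c"
      if "c \<in> set (node_cycles 1 ts)" for c
      using cyc[of c] that by (simp add: cs_def)
    show "map (\<lambda>h. h \<in> A) (leaf_tops 1 ts) = map (\<lambda>l. l = None) (concat (map leaf_word ts))"
      using Aw by (simp add: L_def w_def)
    show "x \<in> frozen M \<or> opp M x \<in> set a" if ax: "leaf_tops 1 ts = a @ x # b" "x \<notin> A" for a x b
    proof -
      \<comment> \<open>Position 0 of \<open>L\<close> is the root half-edge, so positions in
        \<open>L\<close> exceed those in the leaf list by one.\<close>
      let ?c = "Suc (length a)"
      have c: "?c < length L" "?l ?c = x" using ax(1) by (simp_all add: L_def)
      then have cC: "?c \<in> C" using LA[of ?c] ax(2) by (simp add: C_def)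
      show ?thesis
      proof (cases "\<mu> ?c > 0")
        case True
        then have "?l (f ?c) \<in> Mk" using cC by (auto simp: Mk_def)
        then have "m (?l (f ?c)) \<in> m ` Mk" by (rule imageI)
        then show ?thesis using mC(2)[OF cC] c(2) by (simp add: frozen_def)
      next
        case False
        \<comment> \<open>An unmarked closing leaf has an earlier partner: either the root
          half-edge, whose edge is frozen, or a leaf in \<open>a\<close>.\<close>
        then have lt: "f ?c < ?c" using f(4)[OF cC] by simp
        show ?thesis
        proof (cases "f ?c")
          case 0
          then have "m 0 = x" using mC(2)[OF cC] c(2) by (simp add: L_def)
          then show ?thesis by (auto simp: frozen_def)
        next
          case (Suc j)
          then have j: "j < length a" using lt by simp
          have "m x = ?l (Suc j)" using mC(1)[OF cC] c(2) Suc by simp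
          also have "\<dots> = a ! j" using ax(1) j by (simp add: L_def nth_append)
          finally show ?thesis using j by simp
        qed
      qed
    qed
  qed (simp add: m(2))
  have dV: "distinct (visited M (tops 1 ts) ts)" and VH: "set (visited M (tops 1 ts) ts) \<subseteq> half_edges M"
    unfolding VL by (auto simp: H_def simp del: upt_Suc)
  have oA': "opp M h \<in> A" if "h \<in> half_edges M" "h \<notin> A" for h using oA[of h] that by simp
  have root: "vertex_of M 0 = set (0 # tops 1 ts)"
    using vertex_of_turn[OF cl0] unfolding turn0 .
  have d0: "distinct (0 # turn M (length ts) 0)"
    unfolding turn0 using dcs by (simp add: cs_def)
  have vbal: "2 * card (vertex_of M h \<inter> A) = card (vertex_of M h)" if h: "h \<in> half_edges M" for h
  proof (cases "h \<in> set (0 # tops 1 ts)")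
    case True
    then have "vertex_of M h = vertex_of M 0" by (intro vertex_of_eq) (simp add: root)
    moreover obtain k where k: "length ts + 1 = 2 * k" "count_list ts Opening = k - 1" using eul by auto
    have "2 * card (vertex_of M 0 \<inter> A) = card (vertex_of M 0)"
      using explores_opening[OF ex] by (intro card_vertex_turn[OF cl0 d0 A0 _ k]) (simp only: turn0)
    ultimately show ?thesis by simp
  next
    case False
    then have "h \<in> set (visited M (tops 1 ts) ts) - set (tops 1 ts)"
      unfolding VL using h by (auto simp: H_def simp del: upt_Suc)
    from explores_balanced[OF ex _ dV VH oA' this] show ?thesis using eul by auto
  qed
  have eo: "eulerian_orientation M A"
    unfolding eulerian_orientation_def orientation_def
  proof (intro conjI ballI)
    show "A \<subseteq> half_edges M" using AH by simp
    show "h \<in> A \<longleftrightarrow> opp M h \<notin> A" if "h \<in> half_edges M" for h using oA[of h] that by simp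
    show "2 * card (v \<inter> A) = card v" if "v \<in> vertices M" for v
      using that vbal by (auto simp: vertices_def)
  qed
  have S: "spanned M A ts"
    unfolding spanned_def RV
    using mm eo MkA A0 cl0 ex turn0 by (simp add: H_def del: upt_Suc funpow.simps)
  have CC: "{c. c < length L \<and> L ! c \<notin> A} = C"
    using LA by (auto simp: C_def)
  have "represents M A ts f \<mu>"
    unfolding represents_def RL CC
  proof (intro conjI allI impI S f(1) f(3))
    fix c assume c: "c < length L" "L ! c \<notin> A"
    then have cC: "c \<in> C" using CC by blast
    show "f c < length L" using fOp[OF cC] CL by blast
    show "opp M (L ! c) = L ! f c" using mC(1)[OF cC] by simp
    have "L ! f c \<in> Mk \<longleftrightarrow> \<mu> c > 0"
    proof
      assume "L ! f c \<in> Mk"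
      then obtain d where d: "d \<in> C" "\<mu> d > 0" "?l (f c) = ?l (f d)" by (auto simp: Mk_def)
      then have "f c = f d" using Leq[of "f c" "f d"] fOp[OF cC] fOp[OF d(1)] CL by blast
      then have "c = d" using f(2) cC d(1) by (auto simp: bij_betw_def inj_on_def)
      then show "\<mu> c > 0" using d by simp
    qed (use cC in \<open>auto simp: Mk_def\<close>)
    then show "\<mu> c = (if L ! f c \<in> marked M then edge_mult M (L ! f c) else 0)"
      using em[OF cC] by simp
  qed
  moreover have "eulerian_map M"
    unfolding eulerian_map_def
  proof
    fix v assume "v \<in> vertices M"
    then have "2 * card (v \<inter> A) = card v" using eo by (simp add: eulerian_orientation_def)
    then show "even (card v)" by (metis dvd_triv_left)
  qed
  moreover have "admissible M"
    unfolding admissible_def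
  proof (intro exI[of _ A] conjI eo)
    show "compatible M A" using MkA by (simp add: compatible_def)
    show "root_half_edge M \<in> A" using A0 by simp
    show "root_accessible M A"
      unfolding root_accessible_def
    proof
      fix v assume "v \<in> vertices M"
      then obtain h where h: "h \<in> half_edges M" "v = vertex_of M h" by (auto simp: vertices_def)
      show "(v, vertex_of M (root_half_edge M)) \<in> (unmarked_step M A)\<^sup>*"
      proof (cases "h = 0")
        case False
        then have hv: "h \<in> set (visited M (tops 1 ts) ts)" unfolding VL using h by (auto simp: H_def simp del: upt_Suc)
        have acc: "(vertex_of M g, vertex_of M 0) \<in> (unmarked_step M A)\<^sup>*" if "g \<in> set (tops 1 ts)" for g
        proof -
          have "vertex_of M g = vertex_of M 0" 
          proof (rule vertex_of_eq)
            show "g \<in> vertex_of M 0" unfolding root using that by simp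
          qed
          then show ?thesis by simp
        qed
        have "marked M \<union> opp M ` marked M \<subseteq> frozen M" by (auto simp: frozen_def)
        from explores_accessible[OF rmap_axioms ex this VH oA' acc hv]
        have "(vertex_of M h, vertex_of M 0) \<in> (unmarked_step M A)\<^sup>*" .
        then show ?thesis using h by simp
      qed (use h in simp)
    qed
  qed
  moreover have "(\<Sum>h\<in>marked M. edge_mult M h) < i"
  proof -
    have "inj_on (\<lambda>c. ?l (f c)) {c \<in> C. \<mu> c > 0}"
    proof (rule inj_onI)
      fix c d assume cd: "c \<in> {c \<in> C. \<mu> c > 0}" "d \<in> {c \<in> C. \<mu> c > 0}" "?l (f c) = ?l (f d)"
      then have "f c = f d" using Leq[of "f c" "f d"] fOp CL by blast
      then show "c = d" using cd f(2) by (auto simp: bij_betw_def inj_on_def)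
    qed
    then have "(\<Sum>h\<in>marked M. edge_mult M h) = (\<Sum>c\<in>{c \<in> C. \<mu> c > 0}. em (?l (f c)))"
      unfolding Msel Mk_def by (rule sum.reindex_cong) auto
    also have "\<dots> = (\<Sum>c\<in>{c \<in> C. \<mu> c > 0}. \<mu> c)" using em by (intro sum.cong) auto
    also have "\<dots> \<le> sum \<mu> C" by (intro sum_mono2) (auto simp: C_def)
    finally show ?thesis using f(5) by simp
  qed
  ultimately show thesis by (rule that)
qed

section \<open>Statistics and assembly of the bijection\<close>

text \<open>Both numbers are half the number of half-edges, counted by vertices and by
  edges.\<close>

lemma half_degree_edge_count:
  assumes M: "marked_map M" and eul: "eulerian_map M"
  shows "map_half_degree M = map_edge_count M"
proof -
  interpret rmap M using M by (rule rmap_of_marked)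
  have fin: "finite (vertices M)" using finite_half_edges by (simp add: vertices_def)
  have disj: "pairwise disjnt (vertices M)"
    unfolding pairwise_def disjnt_iff using in_vertex_iff by metis
  have un: "\<Union>(vertices M) = half_edges M"
    unfolding vertices_def using vertex_of_subset self_in_vertex by blast
  have "card (half_edges M) = (\<Sum>v\<in>vertices M. card v)"
    unfolding un[symmetric] by (rule card_Union_disjoint) (use disj finite_vertex in auto)
  also have "\<dots> = (\<Sum>v\<in>vertices M. 2 * (card v div 2))"
    using eul by (intro sum.cong) (auto simp: eulerian_map_def)
  also have "\<dots> = 2 * map_half_degree M"
    by (simp add: map_half_degree_def sum_distrib_left)
  finally have 1: "card (half_edges M) = 2 * map_half_degree M" .
  have "card (\<Union>(edges M)) = (\<Sum>e\<in>edges M. card e)"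
  proof (rule card_Union_disjoint)
    show "pairwise disjnt (edges M)"
      by (auto simp: pairwise_def disjnt_def edges_def)
  qed (auto simp: edges_def)
  also have "\<Union>(edges M) = half_edges M" by (auto simp: edges_def)
  also have "(\<Sum>e\<in>edges M. card e) = (\<Sum>e\<in>edges M. 2)"
  proof (rule sum.cong)
    fix e assume "e \<in> edges M"
    then obtain h where "h \<in> half_edges M" "e = {h, opp M h}" by (auto simp: edges_def)
    then show "card e = 2" using opp_neq[of h] by simp
  qed simp
  also have "\<dots> = 2 * map_edge_count M" by (simp add: map_edge_count_def)
  finally show ?thesis using 1 by simp
qed

lemma spanned_statistics:
  assumes "spanned M A ts"
  shows "map_vertices_of_degree d M = tree_nodes_of_degree d (Node ts)"
    and "map_half_degree M = tree_half_degree (Node ts)"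
    and "map_weight M = tree_weight (Node ts)"
proof -
  obtain vs where vs: "map card vs = node_degrees (Node ts)" "distinct vs" "set vs = vertices M"
    using spanned_vertices[OF assms] by blast
  have "count_list (map card vs) d = card {v \<in> set vs. card v = d}"
    using vs(2)
  proof (induction vs)
    case (Cons v vs)
    have "{u \<in> set (v # vs). card u = d} = (if card v = d then insert v else id) {u \<in> set vs. card u = d}"
      by auto
    then show ?case using Cons by simp
  qed simp
  then show "map_vertices_of_degree d M = tree_nodes_of_degree d (Node ts)"
    unfolding map_vertices_of_degree_def tree_nodes_of_degree_def vs(1,3) by simp
  show "map_half_degree M = tree_half_degree (Node ts)"
    unfolding map_half_degree_def tree_half_degree_def vs(1,3)[symmetric]
    using vs(2) by (simp add: sum_list_distinct_conv_sum_set o_def)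
  show "map_weight M = tree_weight (Node ts)"
    unfolding map_weight_def tree_weight_def vs(1,3)[symmetric]
    using vs(2) by (simp add: prod.distinct_set_conv_list o_def)
qed

text \<open>One realizing map is chosen for each code. Distinct codes give distinct classes because
  the code is an isomorphism invariant; every class is hit because an admissible map has a code, and
  this code determines it up to isomorphism.\<close>

lemma codes_admissible_maps:
  obtains F where "bij_betw F (codes i) (admissible_maps i)"
    "\<And>t f \<mu>. (t, f, \<mu>) \<in> codes i \<Longrightarrow>
       (\<forall>d. on_class (map_vertices_of_degree d) (F (t, f, \<mu>)) = tree_nodes_of_degree d t) \<and>
       on_class map_half_degree (F (t, f, \<mu>)) = tree_half_degree t \<and>
       on_class map_weight (F (t, f, \<mu>)) = tree_weight t"
proof -
  let ?G = "{M :: nat marked_map. marked_map M \<and> eulerian_map M \<and> admissible M \<and> (\<Sum>h\<in>marked M. edge_mult M h) < i}"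
  define rep where "rep M c = (\<exists>A ts. fst c = Node ts \<and> represents M A ts (fst (snd c)) (snd (snd c)))"
    for M :: "nat marked_map" and c
  have "\<forall>c\<in>codes i. \<exists>M. M \<in> ?G \<and> rep M c"
  proof
    fix c assume "c \<in> codes i"
    moreover obtain t f \<mu> where "c = (t, f, \<mu>)" by (cases c)
    ultimately have *: "c = (t, f, \<mu>)" "t \<in> range Node" "eulerian_nodes t"
      "(f, \<mu>) \<in> decorations i (True # map (\<lambda>l. l = None) (leaf_word t))"
      by (simp_all add: codes_def)
    then obtain ts where ts: "t = Node ts" by blast
    note c = *(1,3,4)[unfolded ts]
    obtain M :: "nat marked_map" and A where "represents M A ts f \<mu>" "eulerian_map M" "admissible M"
      "(\<Sum>h\<in>marked M. edge_mult M h) < i"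
      using code_realized[OF c(2,3)] by blast
    moreover from this(1) have "marked_map M" by (simp add: represents_def spanned_def)
    moreover from \<open>represents M A ts f \<mu>\<close> have "rep M c" unfolding rep_def c(1) by auto
    ultimately show "\<exists>M. M \<in> ?G \<and> rep M c" by blast
  qed
  from bchoice[OF this] obtain m where m: "\<And>c. c \<in> codes i \<Longrightarrow> m c \<in> ?G \<and> rep (m c) c" by blast
  define F where "F c = marked_map_iso_rel `` {m c}" for c
  have FA: "F c \<in> admissible_maps i" if "c \<in> codes i" for c
    unfolding F_def admissible_maps_def by (rule quotientI) (use m[OF that] in blast)
  have mF: "m c \<in> F c" if "c \<in> codes i" for c
    using equiv_class_self[OF equiv_marked_map_iso_rel] m[OF that] by (simp add: F_def)
  have "bij_betw F (codes i) (admissible_maps i)"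
    unfolding bij_betw_def
  proof
    show "inj_on F (codes i)"
    proof (rule inj_onI)
      fix c c' assume c: "c \<in> codes i" "c' \<in> codes i" "F c = F c'"
      then have "(m c, m c') \<in> marked_map_iso_rel"
        using mF[OF c(2)] unfolding c(3)[symmetric] by (simp add: F_def)
      then obtain \<phi> where \<phi>: "marked_map (m c')" "marked_map_iso (m c) (m c') \<phi>"
        by (auto simp: marked_map_iso_rel_def)
      obtain A ts where A: "fst c = Node ts" "represents (m c) A ts (fst (snd c)) (snd (snd c))"
        using m[OF c(1)] by (auto simp: rep_def)
      obtain A' ts' where A': "fst c' = Node ts'" "represents (m c') A' ts' (fst (snd c')) (snd (snd c'))"
        using m[OF c(2)] by (auto simp: rep_def)
      have "ts = ts' \<and> fst (snd c) = fst (snd c') \<and> snd (snd c) = snd (snd c')"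
        using represents_unique[OF represents_iso[OF A(2) \<phi>(2,1)] A'(2)] .
      then show "c = c'" using A(1) A'(1) by (simp add: prod_eq_iff)
    qed
    show "F ` codes i = admissible_maps i"
    proof (intro set_eqI iffI)
      fix K assume "K \<in> admissible_maps i"
      then obtain M where M: "M \<in> ?G" "K = marked_map_iso_rel `` {M}"
        unfolding admissible_maps_def quotient_def by blast
      then obtain A ts f \<mu> where R: "represents M A ts f \<mu>"
        using admissible_represented[of M] by blast
      have c: "(Node ts, f, \<mu>) \<in> codes i" (is "?c \<in> _")
        using represents_code[OF R] M by blast
      obtain A' where "represents (m ?c) A' ts f \<mu>"
        using m[OF c] by (auto simp: rep_def)
      then obtain \<phi> where "marked_map_iso (m ?c) M \<phi>"
        using represents_imp_iso R by blast
      then have "(m ?c, M) \<in> marked_map_iso_rel"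
        using m[OF c] M by (auto simp: marked_map_iso_rel_def)
      then have "F ?c = K"
        unfolding F_def M(2) by (rule equiv_class_eq[OF equiv_marked_map_iso_rel])
      then show "K \<in> F ` codes i" using c by blast
    qed (use FA in blast)
  qed
  moreover have "(\<forall>d. on_class (map_vertices_of_degree d) (F (t, f, \<mu>)) = tree_nodes_of_degree d t) \<and>
       on_class map_half_degree (F (t, f, \<mu>)) = tree_half_degree t \<and>
       on_class map_weight (F (t, f, \<mu>)) = tree_weight t" if c: "(t, f, \<mu>) \<in> codes i" for t f \<mu>
  proof -
    obtain A ts where "t = Node ts" "represents (m (t, f, \<mu>)) A ts f \<mu>"
      using m[OF c] by (auto simp: rep_def)
    then have "spanned (m (t, f, \<mu>)) A ts" "t = Node ts" by (simp_all add: represents_def)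
    note st = spanned_statistics[OF this(1), folded this(2)]
    note cl = on_class_eq[OF FA[OF c] mF[OF c]]
    have "on_class (map_vertices_of_degree d) (F (t, f, \<mu>)) = map_vertices_of_degree d (m (t, f, \<mu>))" for d
      by (rule cl) (rule map_statistics_iso)
    moreover have "on_class map_half_degree (F (t, f, \<mu>)) = map_half_degree (m (t, f, \<mu>))"
      by (rule cl) (rule map_statistics_iso)
    moreover have "on_class map_weight (F (t, f, \<mu>)) = map_weight (m (t, f, \<mu>))"
      by (rule cl) (rule map_weight_iso)
    ultimately show ?thesis using st by simp
  qed
  ultimately show thesis by (rule that)
qed

theorem proposition2:
  fixes i :: nat
  assumes "i \<ge> 1"
  shows "(\<exists>f. bij_betw f (enriched_trees i) (admissible_maps i) \<and>
              (\<forall>t\<in>enriched_trees i. \<forall>k\<ge>1.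
                 tree_nodes_of_degree (2 * k) t = on_class (map_vertices_of_degree (2 * k)) (f t)) \<and>
              (\<forall>t\<in>enriched_trees i. tree_half_degree t = on_class map_half_degree (f t))) \<and>
         (\<forall>C\<in>admissible_maps i. on_class map_half_degree C = on_class map_edge_count C) \<and>
         (\<forall>n. finite {t \<in> enriched_trees i. tree_half_degree t = n}) \<and>
         (\<forall>n. finite {C \<in> admissible_maps i. on_class map_half_degree C = n}) \<and>
         gen_fun tree_half_degree tree_weight (enriched_trees i) = r_series i - of_nat i \<and>
         gen_fun (on_class map_half_degree) (on_class map_weight) (admissible_maps i)
           = r_series i - of_nat i"
proof -
  obtain g where g: "bij_betw g (enriched_trees i) (codes i)" "\<And>u. u \<in> enriched_trees i \<Longrightarrow> fst (g u) = shape u"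
    using enriched_trees_codes[OF assms] by blast
  obtain F where F: "bij_betw F (codes i) (admissible_maps i)"
    "\<And>t f \<mu>. (t, f, \<mu>) \<in> codes i \<Longrightarrow>
       (\<forall>d. on_class (map_vertices_of_degree d) (F (t, f, \<mu>)) = tree_nodes_of_degree d t) \<and>
       on_class map_half_degree (F (t, f, \<mu>)) = tree_half_degree t \<and>
       on_class map_weight (F (t, f, \<mu>)) = tree_weight t"
    using codes_admissible_maps by blast
  let ?f = "F \<circ> g"
  have f: "bij_betw ?f (enriched_trees i) (admissible_maps i)"
    by (rule bij_betw_trans[OF g(1) F(1)])
  have st: "on_class (map_vertices_of_degree d) (?f t) = tree_nodes_of_degree d t"
    "on_class map_half_degree (?f t) = tree_half_degree t" "on_class map_weight (?f t) = tree_weight t"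
    if t: "t \<in> enriched_trees i" for t d
  proof -
    obtain h \<mu> where gt: "g t = (shape t, h, \<mu>)" using g(2)[OF t] by (metis prod.collapse)
    then have "(shape t, h, \<mu>) \<in> codes i" using bij_betwE[OF g(1)] t by metis
    note F(2)[OF this]
    then show "on_class (map_vertices_of_degree d) (?f t) = tree_nodes_of_degree d t"
      "on_class map_half_degree (?f t) = tree_half_degree t" "on_class map_weight (?f t) = tree_weight t"
      by (simp_all add: gt tree_nodes_of_degree_def tree_half_degree_def tree_weight_def node_degrees_shape)
  qed
  have "on_class map_half_degree K = on_class map_edge_count K" if K: "K \<in> admissible_maps i" for K
  proof -
    obtain M where M: "marked_map M" "eulerian_map M" "K = marked_map_iso_rel `` {M}"
      using K unfolding admissible_maps_def quotient_def by blast
    have MK: "M \<in> K" unfolding M(3) using equiv_class_self[OF equiv_marked_map_iso_rel] M(1) by simp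
    have "on_class map_half_degree K = map_half_degree M"
      by (rule on_class_eq[OF K MK]) (rule map_statistics_iso)
    moreover have "on_class map_edge_count K = map_edge_count M"
      by (rule on_class_eq[OF K MK]) (rule map_statistics_iso)
    ultimately show ?thesis using half_degree_edge_count[OF M(1,2)] by simp
  qed
  moreover have "finite {K \<in> admissible_maps i. on_class map_half_degree K = n}" for n
  proof -
    have "bij_betw ?f {t \<in> enriched_trees i. tree_half_degree t = n} {K \<in> admissible_maps i. on_class map_half_degree K = n}"
      by (rule bij_betw_Collect[OF f]) (simp only: st)
    then show ?thesis using bij_betw_finite finite_enriched_trees by blast
  qed
  moreover have "gen_fun (on_class map_half_degree) (on_class map_weight) (admissible_maps i)
      = gen_fun tree_half_degree tree_weight (enriched_trees i)"
    by (rule gen_fun_reindex[OF f]) (simp_all only: st)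
  ultimately show ?thesis
    using f st gen_fun_enriched_trees[OF assms] finite_enriched_trees by (intro conjI exI[of _ ?f]) simp_all
qed

end
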